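(* Let $(M,c_M,J^M)$ and $(N,c_N,J^N)$ be almost Hermitian manifolds. If $\dim M\geq4$, $\dim N\geq4$ let $D^M$, $D^N$ be the Weyl connections of $(M,c_M,J^M)$, $(N,c_N,J^N)$, respectively; if $\dim M=2$ or $\dim N=2$ then $D^M$ or $D^N$ will denote any Weyl connection on $(M,c_M)$ or $(N,c_N)$, respectively. Let $\varphi:(M,J^M)\to(N,J^N)$ be a holomorphic map. (i) If $(\mathrm d^{D^N}\omega_N)^{(1,2)\oplus(2,1)}=0$, where $\omega_N$ is the Kähler form of $(N,c_N,J^N)$, then $\varphi:(M,c_M,D^M)\to(N,c_N,D^N)$ is a harmonic map. (ii) If the map $\varphi:(M,c_M)\to(N,c_N)$ is horizontally weakly conformal and has nowhere degenerate fibres then $\varphi:(M,c_M,D^M)\to(N,c_N,D^N)$ is a harmonic map and hence a harmonic morphism.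
   Context: Category: smooth, real analytic or complex analytic (in the last, everything is holomorphic, including $J$ as an endomorphism field of the holomorphic tangent bundle); $\mathbb K=\mathbb R,\mathbb R,\mathbb C$, respectively. Manifolds are connected. Conformal manifold $(M^m,c)$: a reduction of the frame bundle to $CO(m,\mathbb K)=\{a: a^Ta=\rho_m(a)I_m,\ \rho_m(a)\in\mathbb K\setminus\{0\}\}$; equivalently a class of local metrics $g$ (local representatives) differing by nowhere zero (positive if $\mathbb K=\mathbb R$) function factors. $L^2$ is the associated line bundle via $\rho_m$; $c$ is an $L^2$-valued metric. A Weyl connection $D$ on $(M,c)$ is a torsion free linear connection preserving $c$; $Dg=-2\alpha^g\otimes g$. Almost Hermitian manifold $(M,c,J)$: $J$ an almost complex structure with $c(JX,JY)=c(X,Y)$. Its Kähler form is the $L^2$-valued 2-form $\omega(X,Y)=c(JX,Y)$; $\mathrm d^D$ is the exterior covariant derivative for the connection induced by $D$ on $L^2$ (in terms of a representative $g$ with $c=g\otimes s^2$ and $\omega^g(X,Y)=g(JX,Y)$: $\mathrm d^D\omega=(\mathrm d\omega^g+2\alpha^g\wedge\omega^g)\otimes s^2$). The superscript $(1,2)\oplus(2,1)$ denotes the component of that type with respect to $J^N$. If $\dim M\ge4$, the Weyl connection of $(M,c,J)$ is the unique Weyl connection $D$ on $(M,c)$ with $\operatorname{trace}_c(DJ)=0$. Holomorphic map: $\mathrm d\varphi\circ J^M=J^N\circ\mathrm d\varphi$. Harmonic map $\varphi:(M,c_M,D^M)\to(N,c_N,D^N)$: $\operatorname{trace}_{c_M}(D\,\mathrm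 d\varphi)=0$, where $D$ is the connection on $\varphi^*(TN)\otimes T^*M$ induced by $D^M$, $D^N$, $\varphi$. Harmonic morphism: a map pulling back local harmonic functions (with respect to $c_N,D^N$) to harmonic functions (with respect to $c_M,D^M$). Horizontally weakly conformal: for local representatives $g,h$ there is a function $\Lambda$ with $g^{-1}(\varphi^*\alpha,\varphi^*\beta)=\Lambda\,h^{-1}(\alpha,\beta)$ for all covectors $\alpha,\beta$ on $N$. Nowhere degenerate fibres: $\ker\mathrm d\varphi$ is nondegenerate with respect to $c_M$ at each point (automatic if $\mathbb K=\mathbb R$). *)

theory Defs
  imports "HOL-Analysis.Analysis"
begin

section \<open>Scalars and the category\<close>

text \<open>
  The scalar field \<open>\<K>\<close>. The norm-preserving embedding \<open>cplx\<close> of real algebras into \<open>complex\<close>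
  forces \<open>'a\<close> to be a copy of the reals or of the complex numbers, so a type of this class is
  exactly \<open>\<K> = \<real>\<close> or \<open>\<K> = \<complex>\<close>. The embedding is used to complexify tensors.
\<close>

class scalar = real_normed_field + euclidean_space +
  fixes cplx :: "'a \<Rightarrow> complex"
  assumes cplx_add: "cplx (x + y) = cplx x + cplx y"
    and cplx_mult: "cplx (x * y) = cplx x * cplx y"
    and cplx_scaleR: "cplx (r *\<^sub>R x) = r *\<^sub>R cplx x"
    and norm_cplx: "norm (cplx x) = norm x"

instantiation real :: scalar
begin
definition cplx_real :: "real \<Rightarrow> complex" where "cplx_real = complex_of_real"
instance by standard (simp_all add: cplx_real_def scaleR_conv_of_real)
end

instantiation complex :: scalar
begin
definition cplx_complex :: "complex \<Rightarrow> complex" where "cplx_complex = id"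
instance by standard (simp_all add: cplx_complex_def)
end

text \<open>Being a positive real number, for an element of \<open>\<K>\<close>.\<close>

definition positive :: "'k::scalar \<Rightarrow> bool" where
  "positive x \<longleftrightarrow> (\<exists>r>0. x = of_real r)"

text \<open>
  All derivatives are taken over \<open>\<K>\<close>. Hence for \<open>\<K> = \<real>\<close> the two regularity classes give the smooth
  and the real analytic category, while for \<open>\<K> = \<complex>\<close> both give the complex analytic one.
\<close>

datatype regularity = C_infinity | C_omega

definition pd :: "'m \<Rightarrow> ('k::scalar ^ 'm::finite \<Rightarrow> 'k) \<Rightarrow> 'k ^ 'm \<Rightarrow> 'k" where
  "pd i f x = deriv (\<lambda>t. f (x + axis i t)) 0"

primrec C_k :: "nat \<Rightarrow> ('k::scalar ^ 'm::finite) set \<Rightarrow> ('k ^ 'm \<Rightarrow> 'k) \<Rightarrow> bool" where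
  "C_k 0 S f \<longleftrightarrow> continuous_on S f"
| "C_k (Suc n) S f \<longleftrightarrow> continuous_on S f \<and>
     (\<forall>i. (\<forall>x\<in>S. (\<lambda>t. f (x + axis i t)) field_differentiable (at 0)) \<and> C_k n S (pd i f))"

definition smooth_fun :: "('k::scalar ^ 'm::finite) set \<Rightarrow> ('k ^ 'm \<Rightarrow> 'k) \<Rightarrow> bool" where
  "smooth_fun S f \<longleftrightarrow> (\<forall>n. C_k n S f)"

text \<open>
  A multi-index is a function \<open>\<alpha> :: 'm \<Rightarrow> nat\<close>; the series is summed unconditionally. On open sets
  smoothness already follows from the expansion.
\<close>

definition analytic_fun :: "('k::scalar ^ 'm::finite) set \<Rightarrow> ('k ^ 'm \<Rightarrow> 'k) \<Rightarrow> bool" where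
  "analytic_fun S f \<longleftrightarrow> smooth_fun S f \<and>
     (\<forall>p\<in>S. \<exists>r>0. \<exists>a :: ('m \<Rightarrow> nat) \<Rightarrow> 'k. \<forall>x\<in>ball p r.
        ((\<lambda>\<alpha>. a \<alpha> * (\<Prod>i\<in>UNIV. (x $ i - p $ i) ^ \<alpha> i)) has_sum f x) UNIV)"

definition regular ::
  "regularity \<Rightarrow> ('k::scalar ^ 'm::finite) set \<Rightarrow> ('k ^ 'm \<Rightarrow> 'k) \<Rightarrow> bool" where
  "regular cat S f \<longleftrightarrow>
     (case cat of C_infinity \<Rightarrow> smooth_fun S f | C_omega \<Rightarrow> analytic_fun S f)"

section \<open>Manifolds and maps\<close>

datatype ('a, 'k, 'm) chart = Chart (dom: "'a set") (crd: "'a \<Rightarrow> 'k ^ 'm")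

definition cinv :: "('a, 'k::scalar, 'm::finite) chart \<Rightarrow> 'k ^ 'm \<Rightarrow> 'a" where
  "cinv C = inv_into (dom C) (crd C)"

definition carrier :: "('a, 'k, 'm::finite) chart set \<Rightarrow> 'a set" where
  "carrier A = (\<Union>C\<in>A. dom C)"

text \<open>
  A connected manifold of dimension \<open>CARD('m)\<close> is given by an atlas, not necessarily maximal. It is
  Hausdorff and second countable by the sort of \<open>'a\<close>.
\<close>

definition manifold ::
  "regularity \<Rightarrow> ('a::{t2_space,second_countable_topology}, 'k::scalar, 'm::finite) chart set \<Rightarrow> bool"
  where
  "manifold cat A \<longleftrightarrow>
     connected (carrier A) \<and>
     (\<forall>C\<in>A. open (dom C) \<and> open (crd C ` dom C) \<and>
        homeomorphism (dom C) (crd C ` dom C) (crd C) (cinv C)) \<and>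
     (\<forall>C\<in>A. \<forall>C'\<in>A. \<forall>a.
        regular cat (crd C ` (dom C \<inter> dom C')) (\<lambda>x. crd C' (cinv C x) $ a))"

definition regular_on ::
  "regularity \<Rightarrow> ('a, 'k::scalar, 'm::finite) chart set \<Rightarrow> 'a set \<Rightarrow> ('a \<Rightarrow> 'k) \<Rightarrow> bool" where
  "regular_on cat A U f \<longleftrightarrow>
     (\<forall>C\<in>A. regular cat (crd C ` (U \<inter> dom C)) (\<lambda>x. f (cinv C x)))"

text \<open>\<open>cd C i f p\<close> is the derivative of \<open>f\<close> at \<open>p\<close> in the direction of the \<open>i\<close>-th coordinate of \<open>C\<close>.\<close>

definition cd :: "('a, 'k::scalar, 'm::finite) chart \<Rightarrow> 'm \<Rightarrow> ('a \<Rightarrow> 'k) \<Rightarrow> 'a \<Rightarrow> 'k" where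
  "cd C i f p = pd i (\<lambda>x. f (cinv C x)) (crd C p)"

definition regular_map ::
  "regularity \<Rightarrow> ('a::topological_space, 'k::scalar, 'm::finite) chart set \<Rightarrow>
     ('b::topological_space, 'k, 'n::finite) chart set \<Rightarrow> ('a \<Rightarrow> 'b) \<Rightarrow> bool" where
  "regular_map cat A B \<phi> \<longleftrightarrow>
     \<phi> ` carrier A \<subseteq> carrier B \<and> continuous_on (carrier A) \<phi> \<and>
     (\<forall>C\<in>A. \<forall>C'\<in>B. \<forall>a.
        regular cat (crd C ` {p\<in>dom C. \<phi> p \<in> dom C'}) (\<lambda>x. crd C' (\<phi> (cinv C x)) $ a))"

text \<open>The matrix of \<open>d\<phi>\<close> at \<open>p\<close>; rows are indexed by the coordinates of the target chart \<open>C'\<close>.\<close>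

definition dmap ::
  "('a, 'k::scalar, 'm::finite) chart \<Rightarrow> ('b, 'k, 'n::finite) chart \<Rightarrow> ('a \<Rightarrow> 'b) \<Rightarrow> 'a \<Rightarrow> 'k ^ 'm ^ 'n"
  where
  "dmap C C' \<phi> p = (\<chi> a i. cd C i (\<lambda>q. crd C' (\<phi> q) $ a) p)"

definition jac ::
  "('a, 'k::scalar, 'm::finite) chart \<Rightarrow> ('a, 'k, 'm) chart \<Rightarrow> 'a \<Rightarrow> 'k ^ 'm ^ 'm" where
  "jac C C' p = dmap C C' (\<lambda>q. q) p"

section \<open>Tensor fields and connections\<close>

text \<open>
  A tensor field is the family of its components in the charts of the atlas, subject to the
  transformation law on overlaps. Values outside the relevant domains are irrelevant.
\<close>

type_synonym ('a, 'k, 'm) field1 = "('a, 'k, 'm) chart \<Rightarrow> 'a \<Rightarrow> 'k ^ 'm"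
type_synonym ('a, 'k, 'm) field2 = "('a, 'k, 'm) chart \<Rightarrow> 'a \<Rightarrow> 'k ^ 'm ^ 'm"
type_synonym ('a, 'k, 'm) field3 = "('a, 'k, 'm) chart \<Rightarrow> 'a \<Rightarrow> 'k ^ 'm ^ 'm ^ 'm"

definition one_form ::
  "regularity \<Rightarrow> ('a, 'k::scalar, 'm::finite) chart set \<Rightarrow> 'a set \<Rightarrow> ('a, 'k, 'm) field1 \<Rightarrow> bool"
  where
  "one_form cat A U \<alpha> \<longleftrightarrow>
     (\<forall>C\<in>A. \<forall>i. regular_on cat A (U \<inter> dom C) (\<lambda>p. \<alpha> C p $ i)) \<and>
     (\<forall>C\<in>A. \<forall>C'\<in>A. \<forall>p\<in>U \<inter> dom C \<inter> dom C'. \<forall>i.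
        \<alpha> C p $ i = (\<Sum>a\<in>UNIV. jac C C' p $ a $ i * \<alpha> C' p $ a))"

text \<open>Covariant tensors of order two: \<open>g C p $ i $ j = g(\<partial>\<^sub>i, \<partial>\<^sub>j)\<close>.\<close>

definition covariant2 ::
  "regularity \<Rightarrow> ('a, 'k::scalar, 'm::finite) chart set \<Rightarrow> 'a set \<Rightarrow> ('a, 'k, 'm) field2 \<Rightarrow> bool"
  where
  "covariant2 cat A U g \<longleftrightarrow>
     (\<forall>C\<in>A. \<forall>i j. regular_on cat A (U \<inter> dom C) (\<lambda>p. g C p $ i $ j)) \<and>
     (\<forall>C\<in>A. \<forall>C'\<in>A. \<forall>p\<in>U \<inter> dom C \<inter> dom C'.
        g C p = transpose (jac C C' p) ** g C' p ** jac C C' p)"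

text \<open>Endomorphism fields: \<open>J(\<partial>\<^sub>j) = (\<Sum>i. J C p $ i $ j \<cdot> \<partial>\<^sub>i)\<close>.\<close>

definition endo_field ::
  "regularity \<Rightarrow> ('a, 'k::scalar, 'm::finite) chart set \<Rightarrow> ('a, 'k, 'm) field2 \<Rightarrow> bool" where
  "endo_field cat A J \<longleftrightarrow>
     (\<forall>C\<in>A. \<forall>i j. regular_on cat A (dom C) (\<lambda>p. J C p $ i $ j)) \<and>
     (\<forall>C\<in>A. \<forall>C'\<in>A. \<forall>p\<in>dom C \<inter> dom C'. jac C C' p ** J C p = J C' p ** jac C C' p)"

text \<open>
  A linear connection on the tangent bundle, given by its Christoffel symbols
  \<open>D\<^bsub>\<partial>\<^sub>i\<^esub> \<partial>\<^sub>j = (\<Sum>k. D C p $ k $ i $ j \<cdot> \<partial>\<^sub>k)\<close>.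
\<close>

definition linear_connection ::
  "regularity \<Rightarrow> ('a, 'k::scalar, 'm::finite) chart set \<Rightarrow> ('a, 'k, 'm) field3 \<Rightarrow> bool" where
  "linear_connection cat A D \<longleftrightarrow>
     (\<forall>C\<in>A. \<forall>k i j. regular_on cat A (dom C) (\<lambda>p. D C p $ k $ i $ j)) \<and>
     (\<forall>C\<in>A. \<forall>C'\<in>A. \<forall>p\<in>dom C \<inter> dom C'. \<forall>a i j.
        (\<Sum>k\<in>UNIV. jac C C' p $ a $ k * D C p $ k $ i $ j) =
        cd C i (\<lambda>q. cd C j (\<lambda>r. crd C' r $ a) q) p +
        (\<Sum>b\<in>UNIV. \<Sum>c\<in>UNIV. D C' p $ a $ b $ c * jac C C' p $ b $ i * jac C C' p $ c $ j))"

definition torsion_free ::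
  "('a, 'k::scalar, 'm::finite) chart set \<Rightarrow> ('a, 'k, 'm) field3 \<Rightarrow> bool" where
  "torsion_free A D \<longleftrightarrow>
     (\<forall>C\<in>A. \<forall>p\<in>dom C. \<forall>k i j. D C p $ k $ i $ j = D C p $ k $ j $ i)"

section \<open>Conformal manifolds and Weyl connections\<close>

definition bil :: "'k::scalar ^ 'm::finite ^ 'm \<Rightarrow> 'k ^ 'm \<Rightarrow> 'k ^ 'm \<Rightarrow> 'k" where
  "bil G v w = (\<Sum>i\<in>UNIV. \<Sum>j\<in>UNIV. G $ i $ j * v $ i * w $ j)"

text \<open>The trace of a bilinear form with components \<open>b i j\<close> with respect to the metric \<open>G\<close>.\<close>

definition mtrace :: "'k::scalar ^ 'm::finite ^ 'm \<Rightarrow> ('m \<Rightarrow> 'm \<Rightarrow> 'k) \<Rightarrow> 'k" where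
  "mtrace G b = (\<Sum>i\<in>UNIV. \<Sum>j\<in>UNIV. matrix_inv G $ i $ j * b i j)"

text \<open>
  Local metrics are \<open>\<K>\<close>-bilinear and nondegenerate. The condition \<open>\<real> = UNIV\<close> expresses \<open>\<K> = \<real>\<close>,
  in which case they are positive definite.
\<close>

definition local_metric ::
  "regularity \<Rightarrow> ('a::topological_space, 'k::scalar, 'm::finite) chart set \<Rightarrow> 'a set \<Rightarrow>
     ('a, 'k, 'm) field2 \<Rightarrow> bool" where
  "local_metric cat A U g \<longleftrightarrow>
     open U \<and> U \<subseteq> carrier A \<and> covariant2 cat A U g \<and>
     (\<forall>C\<in>A. \<forall>p\<in>U \<inter> dom C. transpose (g C p) = g C p \<and> invertible (g C p) \<and>
        (\<real> = (UNIV :: 'k set) \<longrightarrow> (\<forall>v. v \<noteq> 0 \<longrightarrow> positive (bil (g C p) v v))))"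

text \<open>
  A conformal structure is given by a family of pairs \<open>(U, g)\<close> of local representatives \<open>g\<close> defined on
  \<open>U\<close>. As for atlases, maximality is not required.
\<close>

type_synonym ('a, 'k, 'm) cstruct = "('a set \<times> ('a, 'k, 'm) field2) set"

definition conformal_structure ::
  "regularity \<Rightarrow> ('a::topological_space, 'k::scalar, 'm::finite) chart set \<Rightarrow>
     ('a, 'k, 'm) cstruct \<Rightarrow> bool" where
  "conformal_structure cat A c \<longleftrightarrow>
     (\<forall>(U, g)\<in>c. local_metric cat A U g) \<and>
     (\<Union>(U, g)\<in>c. U) = carrier A \<and>
     (\<forall>(U, g)\<in>c. \<forall>(V, h)\<in>c. \<exists>f. regular_on cat A (U \<inter> V) f \<and>
        (\<forall>p\<in>U \<inter> V. f p \<noteq> 0 \<and> (\<real> = (UNIV :: 'k set) \<longrightarrow> positive (f p))) \<and>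
        (\<forall>C\<in>A. \<forall>p\<in>U \<inter> V \<inter> dom C. \<forall>i j. h C p $ i $ j = f p * g C p $ i $ j))"

text \<open>\<open>cov_metric D g C p i j k = (D\<^bsub>\<partial>\<^sub>i\<^esub> g)(\<partial>\<^sub>j, \<partial>\<^sub>k)\<close>.\<close>

definition cov_metric ::
  "('a, 'k::scalar, 'm::finite) field3 \<Rightarrow> ('a, 'k, 'm) field2 \<Rightarrow> ('a, 'k, 'm) chart \<Rightarrow> 'a \<Rightarrow>
     'm \<Rightarrow> 'm \<Rightarrow> 'm \<Rightarrow> 'k" where
  "cov_metric D g C p i j k =
     cd C i (\<lambda>q. g C q $ j $ k) p -
     (\<Sum>l\<in>UNIV. D C p $ l $ i $ j * g C p $ l $ k) -
     (\<Sum>l\<in>UNIV. D C p $ l $ i $ k * g C p $ j $ l)"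

text \<open>\<open>\<alpha>\<close> is the form \<open>\<alpha>\<^sup>g\<close> on \<open>U\<close> with \<open>D g = - 2 \<alpha>\<^sup>g \<otimes> g\<close>.\<close>

definition weyl_form ::
  "regularity \<Rightarrow> ('a, 'k::scalar, 'm::finite) chart set \<Rightarrow> ('a, 'k, 'm) field3 \<Rightarrow> 'a set \<Rightarrow>
     ('a, 'k, 'm) field2 \<Rightarrow> ('a, 'k, 'm) field1 \<Rightarrow> bool" where
  "weyl_form cat A D U g \<alpha> \<longleftrightarrow>
     one_form cat A U \<alpha> \<and>
     (\<forall>C\<in>A. \<forall>p\<in>U \<inter> dom C. \<forall>i j k.
        cov_metric D g C p i j k = - 2 * \<alpha> C p $ i * g C p $ j $ k)"

definition weyl_connection ::
  "regularity \<Rightarrow> ('a, 'k::scalar, 'm::finite) chart set \<Rightarrow> ('a, 'k, 'm) cstruct \<Rightarrow>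
     ('a, 'k, 'm) field3 \<Rightarrow> bool" where
  "weyl_connection cat A c D \<longleftrightarrow>
     linear_connection cat A D \<and> torsion_free A D \<and>
     (\<forall>(U, g)\<in>c. \<exists>\<alpha>. weyl_form cat A D U g \<alpha>)"

section \<open>Almost Hermitian manifolds\<close>

definition almost_complex ::
  "regularity \<Rightarrow> ('a, 'k::scalar, 'm::finite) chart set \<Rightarrow> ('a, 'k, 'm) field2 \<Rightarrow> bool" where
  "almost_complex cat A J \<longleftrightarrow>
     endo_field cat A J \<and> (\<forall>C\<in>A. \<forall>p\<in>dom C. J C p ** J C p = - mat 1)"

definition almost_hermitian ::
  "regularity \<Rightarrow> ('a::{t2_space,second_countable_topology}, 'k::scalar, 'm::finite) chart set \<Rightarrow>
     ('a, 'k, 'm) cstruct \<Rightarrow> ('a, 'k, 'm) field2 \<Rightarrow> bool" where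
  "almost_hermitian cat A c J \<longleftrightarrow>
     manifold cat A \<and> conformal_structure cat A c \<and> almost_complex cat A J \<and>
     (\<forall>(U, g)\<in>c. \<forall>C\<in>A. \<forall>p\<in>U \<inter> dom C. \<forall>X Y.
        bil (g C p) (J C p *v X) (J C p *v Y) = bil (g C p) X Y)"

text \<open>\<open>cov_endo D J C p i k j\<close> is the \<open>k\<close>-th component of \<open>(D\<^bsub>\<partial>\<^sub>i\<^esub> J)(\<partial>\<^sub>j)\<close>.\<close>

definition cov_endo ::
  "('a, 'k::scalar, 'm::finite) field3 \<Rightarrow> ('a, 'k, 'm) field2 \<Rightarrow> ('a, 'k, 'm) chart \<Rightarrow> 'a \<Rightarrow>
     'm \<Rightarrow> 'm \<Rightarrow> 'm \<Rightarrow> 'k" where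
  "cov_endo D J C p i k j =
     cd C i (\<lambda>q. J C q $ k $ j) p +
     (\<Sum>l\<in>UNIV. D C p $ k $ i $ l * J C p $ l $ j) -
     (\<Sum>l\<in>UNIV. D C p $ l $ i $ j * J C p $ k $ l)"

text \<open>
  The Weyl connection of an almost Hermitian manifold of dimension at least four, characterised
  by \<open>trace\<^sub>c (D J) = 0\<close>. Traces of representatives of \<open>c\<close> differ by nowhere zero factors.
\<close>

definition hermitian_weyl_connection ::
  "regularity \<Rightarrow> ('a, 'k::scalar, 'm::finite) chart set \<Rightarrow> ('a, 'k, 'm) cstruct \<Rightarrow>
     ('a, 'k, 'm) field2 \<Rightarrow> ('a, 'k, 'm) field3 \<Rightarrow> bool" where
  "hermitian_weyl_connection cat A c J D \<longleftrightarrow>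
     weyl_connection cat A c D \<and>
     (\<forall>(U, g)\<in>c. \<forall>C\<in>A. \<forall>p\<in>U \<inter> dom C. \<forall>k.
        mtrace (g C p) (\<lambda>i j. cov_endo D J C p i k j) = 0)"

text \<open>The components of \<open>\<omega>\<^sup>g(X, Y) = g(J X, Y)\<close>.\<close>

definition kaehler_form ::
  "('a, 'k::scalar, 'm::finite) field2 \<Rightarrow> ('a, 'k, 'm) field2 \<Rightarrow> ('a, 'k, 'm) field2" where
  "kaehler_form g J C p = (\<chi> i j. bil (g C p) (J C p *v axis i 1) (axis j 1))"

text \<open>
  The components of \<open>d\<omega>\<^sup>g + 2 \<alpha>\<^sup>g \<and> \<omega>\<^sup>g\<close>, which represents the exterior covariant derivative \<open>d\<^sup>D \<omega>\<close>
  of the Kaehler form with respect to the local representative \<open>g\<close>.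
\<close>

definition dD_omega ::
  "('a, 'k::scalar, 'm::finite) field2 \<Rightarrow> ('a, 'k, 'm) field2 \<Rightarrow> ('a, 'k, 'm) field1 \<Rightarrow>
     ('a, 'k, 'm) chart \<Rightarrow> 'a \<Rightarrow> 'k ^ 'm ^ 'm ^ 'm" where
  "dD_omega g J \<alpha> C p = (\<chi> i j k.
     (let \<omega> = kaehler_form g J in
        cd C i (\<lambda>q. \<omega> C q $ j $ k) p + cd C j (\<lambda>q. \<omega> C q $ k $ i) p + cd C k (\<lambda>q. \<omega> C q $ i $ j) p +
        2 * (\<alpha> C p $ i * \<omega> C p $ j $ k + \<alpha> C p $ j * \<omega> C p $ k $ i + \<alpha> C p $ k * \<omega> C p $ i $ j)))"

text \<open>
  Type decomposition at a point. Vectors and forms are complexified by means of \<open>cplx\<close>, which changes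
  nothing if \<open>\<K> = \<complex>\<close>. The projection onto vectors of type \<open>(1,0)\<close> is \<open>type_proj J True\<close>, the one onto
  type \<open>(0,1)\<close> is \<open>type_proj J False\<close>. The component of type \<open>(r, s)\<close> of a 3-form is obtained by
  inserting these projections in all ways in which exactly \<open>r\<close> of them are of type \<open>(1,0)\<close>.
\<close>

definition eval3 :: "'k::scalar ^ 'm::finite ^ 'm ^ 'm \<Rightarrow> complex ^ 'm \<Rightarrow> complex ^ 'm \<Rightarrow> complex ^ 'm \<Rightarrow> complex"
  where
  "eval3 \<Omega> X Y Z = (\<Sum>i\<in>UNIV. \<Sum>j\<in>UNIV. \<Sum>k\<in>UNIV. cplx (\<Omega> $ i $ j $ k) * X $ i * Y $ j * Z $ k)"

definition type_proj :: "'k::scalar ^ 'm::finite ^ 'm \<Rightarrow> bool \<Rightarrow> complex ^ 'm \<Rightarrow> complex ^ 'm" where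
  "type_proj J e X =
     (let JX = (\<chi> i j. cplx (J $ i $ j)) *v X
      in (1/2) *s (if e then X - \<i> *s JX else X + \<i> *s JX))"

definition type_component ::
  "'k::scalar ^ 'm::finite ^ 'm \<Rightarrow> nat \<times> nat \<Rightarrow> 'k ^ 'm ^ 'm ^ 'm \<Rightarrow>
     complex ^ 'm \<Rightarrow> complex ^ 'm \<Rightarrow> complex ^ 'm \<Rightarrow> complex" where
  "type_component J rs \<Omega> X Y Z =
     (\<Sum>(e1, e2, e3) \<in> {(e1, e2, e3).
          rs = (of_bool e1 + of_bool e2 + of_bool e3,
                of_bool (\<not> e1) + of_bool (\<not> e2) + of_bool (\<not> e3))}.
        eval3 \<Omega> (type_proj J e1 X) (type_proj J e2 Y) (type_proj J e3 Z))"

text \<open>\<open>(d\<^sup>D \<omega>)\<^bsup>(1,2) \<oplus> (2,1)\<^esup> = 0\<close>\<close>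

definition dD_omega_mixed_zero ::
  "regularity \<Rightarrow> ('a, 'k::scalar, 'm::finite) chart set \<Rightarrow> ('a, 'k, 'm) cstruct \<Rightarrow>
     ('a, 'k, 'm) field2 \<Rightarrow> ('a, 'k, 'm) field3 \<Rightarrow> bool" where
  "dD_omega_mixed_zero cat A c J D \<longleftrightarrow>
     (\<forall>(U, g)\<in>c. \<forall>\<alpha>. weyl_form cat A D U g \<alpha> \<longrightarrow>
        (\<forall>C\<in>A. \<forall>p\<in>U \<inter> dom C. \<forall>X Y Z.
           type_component (J C p) (1, 2) (dD_omega g J \<alpha> C p) X Y Z +
           type_component (J C p) (2, 1) (dD_omega g J \<alpha> C p) X Y Z = 0))"

section \<open>Holomorphic maps, harmonic maps and harmonic morphisms\<close>

definition holomorphic_map ::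
  "regularity \<Rightarrow> ('a::topological_space, 'k::scalar, 'm::finite) chart set \<Rightarrow> ('a, 'k, 'm) field2 \<Rightarrow>
     ('b::topological_space, 'k, 'n::finite) chart set \<Rightarrow> ('b, 'k, 'n) field2 \<Rightarrow> ('a \<Rightarrow> 'b) \<Rightarrow> bool"
  where
  "holomorphic_map cat A JM B JN \<phi> \<longleftrightarrow>
     regular_map cat A B \<phi> \<and>
     (\<forall>C\<in>A. \<forall>C'\<in>B. \<forall>p\<in>dom C. \<phi> p \<in> dom C' \<longrightarrow>
        dmap C C' \<phi> p ** JM C p = JN C' (\<phi> p) ** dmap C C' \<phi> p)"

text \<open>\<open>(D d\<phi>)(\<partial>\<^sub>i, \<partial>\<^sub>j)\<close>, component \<open>a\<close> in the chart \<open>C'\<close> of the target.\<close>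

definition second_fundamental ::
  "('a, 'k::scalar, 'm::finite) field3 \<Rightarrow> ('b, 'k, 'n::finite) field3 \<Rightarrow>
     ('a, 'k, 'm) chart \<Rightarrow> ('b, 'k, 'n) chart \<Rightarrow> ('a \<Rightarrow> 'b) \<Rightarrow> 'a \<Rightarrow> 'n \<Rightarrow> 'm \<Rightarrow> 'm \<Rightarrow> 'k" where
  "second_fundamental DM DN C C' \<phi> p a i j =
     cd C i (\<lambda>q. cd C j (\<lambda>r. crd C' (\<phi> r) $ a) q) p -
     (\<Sum>k\<in>UNIV. DM C p $ k $ i $ j * dmap C C' \<phi> p $ a $ k) +
     (\<Sum>b\<in>UNIV. \<Sum>c\<in>UNIV.
        DN C' (\<phi> p) $ a $ b $ c * dmap C C' \<phi> p $ b $ i * dmap C C' \<phi> p $ c $ j)"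

definition harmonic_map ::
  "regularity \<Rightarrow>
     ('a::topological_space, 'k::scalar, 'm::finite) chart set \<Rightarrow> ('a, 'k, 'm) cstruct \<Rightarrow> ('a, 'k, 'm) field3 \<Rightarrow>
     ('b::topological_space, 'k, 'n::finite) chart set \<Rightarrow> ('b, 'k, 'n) field3 \<Rightarrow> ('a \<Rightarrow> 'b) \<Rightarrow> bool" where
  "harmonic_map cat A cM DM B DN \<phi> \<longleftrightarrow>
     regular_map cat A B \<phi> \<and>
     (\<forall>(U, g)\<in>cM. \<forall>C\<in>A. \<forall>C'\<in>B. \<forall>p\<in>U \<inter> dom C. \<phi> p \<in> dom C' \<longrightarrow>
        (\<forall>a. mtrace (g C p) (second_fundamental DM DN C C' \<phi> p a) = 0))"

text \<open>\<open>\<K>\<close>-valued functions \<open>f\<close> on \<open>V\<close> with \<open>trace\<^sub>c (D d f) = 0\<close>.\<close>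

definition harmonic_fun ::
  "regularity \<Rightarrow> ('a, 'k::scalar, 'm::finite) chart set \<Rightarrow> ('a, 'k, 'm) cstruct \<Rightarrow>
     ('a, 'k, 'm) field3 \<Rightarrow> 'a set \<Rightarrow> ('a \<Rightarrow> 'k) \<Rightarrow> bool" where
  "harmonic_fun cat A c D V f \<longleftrightarrow>
     regular_on cat A V f \<and>
     (\<forall>(U, g)\<in>c. \<forall>C\<in>A. \<forall>p\<in>V \<inter> U \<inter> dom C.
        mtrace (g C p) (\<lambda>i j.
          cd C i (\<lambda>q. cd C j f q) p - (\<Sum>k\<in>UNIV. D C p $ k $ i $ j * cd C k f p)) = 0)"

definition harmonic_morphism ::
  "regularity \<Rightarrow>
     ('a::topological_space, 'k::scalar, 'm::finite) chart set \<Rightarrow> ('a, 'k, 'm) cstruct \<Rightarrow> ('a, 'k, 'm) field3 \<Rightarrow>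
     ('b::topological_space, 'k, 'n::finite) chart set \<Rightarrow> ('b, 'k, 'n) cstruct \<Rightarrow> ('b, 'k, 'n) field3 \<Rightarrow>
     ('a \<Rightarrow> 'b) \<Rightarrow> bool" where
  "harmonic_morphism cat A cM DM B cN DN \<phi> \<longleftrightarrow>
     regular_map cat A B \<phi> \<and>
     (\<forall>V f. open V \<and> V \<subseteq> carrier B \<and> harmonic_fun cat B cN DN V f \<longrightarrow>
        harmonic_fun cat A cM DM {p\<in>carrier A. \<phi> p \<in> V} (\<lambda>p. f (\<phi> p)))"

text \<open>\<open>\<Lambda>\<close> may vanish. A covector \<open>\<alpha>\<close> on the target pulls back to \<open>\<alpha> v* d\<phi>\<close>.\<close>

definition horizontally_weakly_conformal ::
  "('a, 'k::scalar, 'm::finite) chart set \<Rightarrow> ('a, 'k, 'm) cstruct \<Rightarrow>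
     ('b, 'k, 'n::finite) chart set \<Rightarrow> ('b, 'k, 'n) cstruct \<Rightarrow> ('a \<Rightarrow> 'b) \<Rightarrow> bool" where
  "horizontally_weakly_conformal A cM B cN \<phi> \<longleftrightarrow>
     (\<forall>(U, g)\<in>cM. \<forall>(V, h)\<in>cN. \<exists>\<Lambda> :: 'a \<Rightarrow> 'k.
        \<forall>C\<in>A. \<forall>C'\<in>B. \<forall>p\<in>U \<inter> dom C. \<phi> p \<in> V \<inter> dom C' \<longrightarrow>
          (\<forall>\<alpha> \<beta>. bil (matrix_inv (g C p)) (\<alpha> v* dmap C C' \<phi> p) (\<beta> v* dmap C C' \<phi> p) =
                  \<Lambda> p * bil (matrix_inv (h C' (\<phi> p))) \<alpha> \<beta>))"

definition nowhere_degenerate_fibres ::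
  "('a, 'k::scalar, 'm::finite) chart set \<Rightarrow> ('a, 'k, 'm) cstruct \<Rightarrow>
     ('b, 'k, 'n::finite) chart set \<Rightarrow> ('a \<Rightarrow> 'b) \<Rightarrow> bool" where
  "nowhere_degenerate_fibres A cM B \<phi> \<longleftrightarrow>
     (\<forall>(U, g)\<in>cM. \<forall>C\<in>A. \<forall>C'\<in>B. \<forall>p\<in>U \<inter> dom C. \<phi> p \<in> dom C' \<longrightarrow>
        (let K = {v. dmap C C' \<phi> p *v v = 0}
         in \<forall>v\<in>K. (\<forall>w\<in>K. bil (g C p) v w = 0) \<longrightarrow> v = 0))"

end

theory Submission
  imports Defs
begin

text \<open>
  At a point and in charts, write \<open>P = d\<phi>\<close>. Covariant differentiation of \<open>J\<^sup>N P = P J\<^sup>M\<close> gives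
  \<open>(D d\<phi>)(X, J\<^sup>M Y) + P ((D\<^sub>X J\<^sup>M) Y) = (D\<^sub>P\<^sub>X J\<^sup>N) (P Y) + J\<^sup>N (D d\<phi>)(X, Y)\<close>. Take the trace. The first term
  vanishes because \<open>D d\<phi>\<close> is symmetric and \<open>J\<^sup>M\<close> is skew, the second by the choice of \<open>D\<^sup>M\<close> (in
  dimension two, \<open>D J = 0\<close> for every Weyl connection). Hence \<open>\<phi>\<close> is harmonic as soon as the trace of
  \<open>(D\<^sup>N J\<^sup>N)(P \<cdot>, P \<cdot>)\<close> vanishes. If \<open>\<phi>\<close> is horizontally weakly conformal, this trace is a multiple of
  \<open>trace (D\<^sup>N J\<^sup>N) = 0\<close>. If the mixed part of \<open>d\<^sup>D\<omega>\<close> vanishes, then \<open>D\<^sup>N J\<^sup>N\<close> is quasi-Kaehler,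
  \<open>(D\<^sub>J\<^sub>X J) (J Y) = - (D\<^sub>X J) Y\<close>, and the trace equals its own negative, as the form \<open>P g\<^sup>-\<^sup>1 P\<^sup>T\<close> is
  \<open>J\<^sup>N\<close>-invariant. That pulled back harmonic functions are harmonic follows from the composition law;
  they are regular since analytic functions can be composed as multivariate power series.
\<close>

section \<open>Calculus over \<open>\<K>\<close>\<close>

text \<open>The definitions provide derivatives over K only along coordinate axes, for real and
  complex K at once. The chain rule, the symmetry of second derivatives and the substitution of
  power series are therefore derived from partial derivatives before any geometry. The geometry is
  then matrix algebra at one point: a connection with its direction fixed is a matrix, and covariant
  differentiation of J adds a commutator. The form \<alpha> drops out, because D g = -2 \<alpha> g
  turns d\<omega> + 2 \<alpha> \<and> \<omega> into the cyclic sum of g((D_X J) Y, Z), where the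
  Christoffel terms cancel by vanishing torsion. In dimension two D_X J is g-skew, hence a multiple
  of J, and it also anticommutes with J, hence it is zero. A nondegenerate metric with an orthogonal
  J forces even dimension, so dimension two and dimension at least four are all the cases. For
  harmonicity, the traced identity gives J tau = 0 on the target, where tau is the trace of D
  d\<phi>, and J is invertible.\<close>

lemma axis_add: "axis i (s + t) = axis i s + (axis i t :: 'k::monoid_add ^ 'm)"
  by (simp add: vec_eq_iff axis_def)

lemma axis_0: "axis i (0::'k::zero) = (0 :: 'k ^ 'm)"
  by (simp add: axis_def vec_eq_iff)

lemma norm_axis_eq: "norm (axis i (t::'k::real_normed_vector) :: 'k ^ 'm::finite) = norm t"
proof -
  have "(\<Sum>j\<in>UNIV. (norm (if j = i then t else 0))\<^sup>2) = (\<Sum>j\<in>UNIV. if j = i then (norm t)\<^sup>2 else 0)"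
    by (intro sum.cong) auto
  then show ?thesis
    by (simp add: norm_vec_def L2_set_def axis_def if_distrib cong: if_cong)
qed

lemma continuous_axis: "continuous_on S (\<lambda>t. axis i (t :: 'k::real_normed_vector) :: 'k ^ 'm::finite)"
proof -
  have "continuous_on S (\<lambda>t. (\<chi> j. if j = i then t else (0::'k)) :: 'k ^ 'm)"
  proof (rule continuous_on_vec_lambda)
    fix j show "continuous_on S (\<lambda>t. if j = i then t else (0::'k))"
      by (cases "j = i") auto
  qed
  then show ?thesis by (simp add: axis_def)
qed

text \<open>\<open>pd\<close> is a total function and says nothing where the derivative fails to
  exist. This relation records existence together with the value, so the rules of calculus are
  proved for it and turned into equations by \<open>pd_eqI\<close>.\<close>

definition has_pd :: "'m \<Rightarrow> ('k::scalar ^ 'm::finite \<Rightarrow> 'k) \<Rightarrow> 'k \<Rightarrow> 'k ^ 'm \<Rightarrow> bool" where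
  "has_pd i f d x \<longleftrightarrow> ((\<lambda>t. f (x + axis i t)) has_field_derivative d) (at 0)"

lemma pd_eqI: "has_pd i f d x \<Longrightarrow> pd i f x = d"
  unfolding has_pd_def pd_def by (rule DERIV_imp_deriv)

lemma has_pd_pd: "(\<lambda>t. f (x + axis i t)) field_differentiable (at 0) \<longleftrightarrow> has_pd i f (pd i f x) x"
  unfolding has_pd_def pd_def by (simp add: DERIV_deriv_iff_field_differentiable)

lemma C_k_has_pd: "C_k (Suc n) S f \<Longrightarrow> x \<in> S \<Longrightarrow> has_pd i f (pd i f x) x"
  by (simp add: has_pd_pd)

lemma has_pd_const: "has_pd i (\<lambda>_. c) 0 x"
  by (simp add: has_pd_def)

lemma has_pd_add:
  "has_pd i f a x \<Longrightarrow> has_pd i g b x \<Longrightarrow> has_pd i (\<lambda>x. f x + g x) (a + b) x"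
  unfolding has_pd_def by (rule DERIV_add)

lemma has_pd_mult:
  "has_pd i f a x \<Longrightarrow> has_pd i g b x \<Longrightarrow> has_pd i (\<lambda>x. f x * g x) (a * g x + f x * b) x"
  unfolding has_pd_def by (auto dest: DERIV_mult simp: algebra_simps axis_0)

lemma has_pd_sum:
  "(\<And>c. c \<in> I \<Longrightarrow> has_pd i (f c) (a c) x) \<Longrightarrow> has_pd i (\<lambda>x. \<Sum>c\<in>I. f c x) (\<Sum>c\<in>I. a c) x"
  by (induction I rule: infinite_finite_induct) (auto intro: has_pd_const has_pd_add)

lemma eventually_axis_line:
  fixes x :: "'k::real_normed_vector ^ 'm::finite"
  assumes "open S" "x \<in> S"
  shows "eventually (\<lambda>t. x + axis i t \<in> S) (nhds 0)"
proof -
  have "continuous_on UNIV (\<lambda>t. x + axis i t)"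
    by (intro continuous_intros continuous_axis)
  then have "open ((\<lambda>t. x + axis i t) -` S)"
    using assms(1) by (simp add: continuous_on_open_vimage)
  moreover have "0 \<in> (\<lambda>t. x + axis i t) -` S"
    using assms(2) by (simp add: axis_0)
  ultimately show ?thesis
    by (auto simp: eventually_nhds intro!: exI[of _ "(\<lambda>t. x + axis i t) -` S"])
qed

lemma has_pd_cong:
  assumes "open S" "x \<in> S" "\<And>y. y \<in> S \<Longrightarrow> f y = g y"
  shows "has_pd i f d x \<longleftrightarrow> has_pd i g d x"
  unfolding has_pd_def
  by (rule DERIV_cong_ev[OF refl _ refl])
     (rule eventually_mono[OF eventually_axis_line[OF assms(1,2)] assms(3)])

lemma pd_cong:
  assumes "open S" "x \<in> S" "\<And>y. y \<in> S \<Longrightarrow> f y = g y"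
  shows "pd i f x = pd i g x"
  unfolding pd_def
  by (rule deriv_cong_ev[OF _ refl])
     (rule eventually_mono[OF eventually_axis_line[OF assms(1,2)] assms(3)])

text \<open>Moving the base point along the same axis only translates the parameter. This makes
  one-variable theorems available on whole axis-parallel lines, not just at parameter 0.\<close>

lemma has_pd_shift:
  "has_pd i f d (x + axis i t) \<longleftrightarrow> ((\<lambda>s. f (x + axis i s)) has_field_derivative d) (at t)"
  unfolding has_pd_def DERIV_def by (simp add: axis_add axis_0 add.assoc)

section \<open>The classes \<open>C_k\<close>: algebra, differentiability, composition, mixed
  derivatives\<close>

lemma C_k_continuous: "C_k n S f \<Longrightarrow> continuous_on S f"
  by (cases n) auto

lemma C_k_pred: "C_k (Suc n) S f \<Longrightarrow> C_k n S f"
  by (induction n arbitrary: f) auto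

lemma C_k_subset: "C_k n S f \<Longrightarrow> T \<subseteq> S \<Longrightarrow> C_k n T f"
  by (induction n arbitrary: f) (auto intro: continuous_on_subset)

text \<open>A partial derivative looks at values around the point, so agreement on \<open>S\<close>
  passes to derivatives because \<open>S\<close> is open. In this way a derivative is replaced by a
  formula for it that is known on \<open>S\<close> only.\<close>

lemma C_k_cong:
  "open S \<Longrightarrow> (\<And>x. x \<in> S \<Longrightarrow> f x = g x) \<Longrightarrow> C_k n S f \<longleftrightarrow> C_k n S g"
proof (induction n arbitrary: f g)
  case 0
  then show ?case by (auto cong: continuous_on_cong)
next
  case (Suc n)
  have 1: "pd i f x = pd i g x" if "x \<in> S" for i x
    using Suc.prems that by (intro pd_cong) auto
  have "C_k n S (pd i f) \<longleftrightarrow> C_k n S (pd i g)" for i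
    using Suc.prems 1 by (intro Suc.IH) auto
  moreover have "has_pd i f d x \<longleftrightarrow> has_pd i g d x" if "x \<in> S" for i x d
    using Suc.prems that by (intro has_pd_cong) auto
  ultimately show ?case
    using Suc.prems 1 by (auto simp: has_pd_pd cong: continuous_on_cong)
qed

lemma C_k_congI:
  "open S \<Longrightarrow> C_k n S g \<Longrightarrow> (\<And>x. x \<in> S \<Longrightarrow> f x = g x) \<Longrightarrow> C_k n S f"
  by (metis C_k_cong)

lemma C_k_const: "C_k n S (\<lambda>_. c)"
proof (induction n arbitrary: c)
  case (Suc n)
  have "pd i (\<lambda>_::'a^'b. c) = (\<lambda>_. 0)" for i
    by (auto intro: pd_eqI has_pd_const)
  with Suc show ?case by auto
qed auto

lemma C_k_add:
  "open S \<Longrightarrow> C_k n S f \<Longrightarrow> C_k n S g \<Longrightarrow> C_k n S (\<lambda>x. f x + g x)"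
proof (induction n arbitrary: f g)
  case (Suc n)
  have 1: "has_pd i (\<lambda>x. f x + g x) (pd i f x + pd i g x) x" if "x \<in> S" for i x
    using Suc.prems that by (intro has_pd_add C_k_has_pd) auto
  have "C_k n S (pd i (\<lambda>x. f x + g x))" for i
  proof -
    have "C_k n S (\<lambda>x. pd i f x + pd i g x)"
      using Suc.prems by (intro Suc.IH) auto
    then show ?thesis
      by (rule C_k_congI[OF Suc.prems(1)]) (rule pd_eqI[OF 1])
  qed
  moreover have "(\<lambda>t. f (x + axis i t) + g (x + axis i t)) field_differentiable (at 0)" if "x \<in> S" for i x
    using 1[OF that] by (auto simp: has_pd_def field_differentiable_def)
  ultimately show ?case
    using Suc.prems by (auto intro!: continuous_intros)
qed (auto intro: continuous_intros)

lemma C_k_sum: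
  "open S \<Longrightarrow> (\<And>c. c \<in> I \<Longrightarrow> C_k n S (f c)) \<Longrightarrow> C_k n S (\<lambda>x. \<Sum>c\<in>I. f c x)"
  by (induction I rule: infinite_finite_induct) (auto intro: C_k_const C_k_add)

lemma C_k_mult:
  "open S \<Longrightarrow> C_k n S f \<Longrightarrow> C_k n S g \<Longrightarrow> C_k n S (\<lambda>x. f x * g x)"
proof (induction n arbitrary: f g)
  case (Suc n)
  have 1: "has_pd i (\<lambda>x. f x * g x) (pd i f x * g x + f x * pd i g x) x" if "x \<in> S" for i x
    using Suc.prems that by (intro has_pd_mult C_k_has_pd) auto
  have "C_k n S (pd i (\<lambda>x. f x * g x))" for i
  proof -
    have "C_k n S (\<lambda>x. pd i f x * g x + f x * pd i g x)"
      using Suc.prems by (intro C_k_add Suc.IH) (auto intro: C_k_pred)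
    then show ?thesis
      by (rule C_k_congI[OF Suc.prems(1)]) (rule pd_eqI[OF 1])
  qed
  moreover have "(\<lambda>t. f (x + axis i t) * g (x + axis i t)) field_differentiable (at 0)" if "x \<in> S" for i x
    using 1[OF that] by (auto simp: has_pd_def field_differentiable_def)
  ultimately show ?case
    using Suc.prems by (auto intro!: continuous_intros)
qed (auto intro: continuous_intros)

text \<open>
  The increment is decomposed into steps along the axes; on each of them the mean value inequality
  compares \<open>f\<close> with its linearisation.
\<close>

lemma C_1_has_derivative:
  fixes f :: "'k::scalar ^ 'm::finite \<Rightarrow> 'k"
  assumes S: "open S" and f: "C_k (Suc 0) S f" and x: "x \<in> S"
  shows "(f has_derivative (\<lambda>h. \<Sum>i\<in>UNIV. pd i f x * h $ i)) (at x)"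
  unfolding has_derivative_at_alt
proof (intro conjI allI impI)
  show "bounded_linear (\<lambda>h. \<Sum>i\<in>UNIV. pd i f x * h $ i)"
    by (intro bounded_linear_sum bounded_linear_const_mult bounded_linear_vec_nth)
next
  fix e :: real assume "e > 0"
  \<comment> \<open>Each coordinate gets an equal share of \<open>e\<close>, since every coordinate
    of the increment is bounded by its norm.\<close>
  define e' where "e' = e / real CARD('m)"
  have e': "e' > 0" using \<open>e > 0\<close> by (simp add: e'_def)
  have "eventually (\<lambda>y. y \<in> S \<and> (\<forall>i. dist (pd i f y) (pd i f x) < e')) (nhds x)"
  proof (intro eventually_conj eventually_all_finite)
    show "eventually (\<lambda>y. y \<in> S) (nhds x)"
      using S x by (rule eventually_nhds_in_open)
    fix i
    have "continuous_on S (pd i f)" using f by simp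
    then have "isCont (pd i f) x" using S x by (simp add: continuous_on_eq_continuous_at)
    then have "(pd i f \<longlongrightarrow> pd i f x) (nhds x)"
      by (simp add: isCont_def tendsto_at_iff_tendsto_nhds)
    then show "eventually (\<lambda>y. dist (pd i f y) (pd i f x) < e') (nhds x)"
      using e' by (rule tendstoD)
  qed
  then obtain d where d: "d > 0"
    and dd: "\<forall>y. dist y x < d \<longrightarrow> y \<in> S \<and> (\<forall>i. dist (pd i f y) (pd i f x) < e')"
    unfolding eventually_nhds_metric by blast
  have dS: "y \<in> S" and dp: "dist (pd i f y) (pd i f x) < e'" if "dist y x < d" for y i
    using dd that by blast+
  show "\<exists>d>0. \<forall>y. norm (y - x) < d \<longrightarrow>
      norm (f y - f x - (\<Sum>i\<in>UNIV. pd i f x * (y - x) $ i)) \<le> e * norm (y - x)"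
  proof (intro exI conjI allI impI)
    show "d > 0" by fact
    fix y assume y: "norm (y - x) < d"
    define h where "h = y - x"
    \<comment> \<open>The partial increments: adding one index to \<open>I\<close> is one step along
      one axis, and \<open>hs UNIV\<close> is the full increment.\<close>
    define hs where "hs I = (\<chi> i. if i \<in> I then h $ i else 0)" for I
    have "norm (f (x + hs I) - f x - (\<Sum>i\<in>I. pd i f x * h $ i)) \<le> (\<Sum>i\<in>I. e' * norm (h $ i))" for I
    proof (induction I rule: infinite_finite_induct)
      case (insert j I)
      define z where "z = x + hs I"
      define u where "u t = f (z + axis j t) - pd j f x * t" for t
      have near: "dist (z + axis j t) x < d" if "norm t \<le> norm (h $ j)" for t
      proof -
        have "norm (hs I + axis j t) \<le> norm h"
          using that insert by (intro norm_le_componentwise_cart) (auto simp: hs_def axis_def)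
        moreover have "dist (z + axis j t) x = norm (hs I + axis j t)"
          by (simp add: z_def dist_norm add.assoc)
        ultimately show ?thesis using y unfolding h_def by linarith
      qed
      \<comment> \<open>The mean value inequality is applied over K itself, on the convex set of
        scalars of norm at most \<open>norm (h $ j)\<close>. There the derivative of
        \<open>u\<close> is a difference of partial derivatives of \<open>f\<close> at points close
        to \<open>x\<close>.\<close>
      have "norm (u (h $ j) - u 0) \<le> e' * norm (h $ j - 0)"
      proof (rule field_differentiable_bound)
        show "convex (cball (0::'k) (norm (h $ j)))" by (rule convex_cball)
        fix t assume t: "t \<in> cball (0::'k) (norm (h $ j))"
        have "has_pd j f (pd j f (z + axis j t)) (z + axis j t)"
          using f near[of t] t by (intro C_k_has_pd[of 0 S]) (auto intro: dS)
        then have "((\<lambda>t. f (z + axis j t)) has_field_derivative pd j f (z + axis j t)) (at t)"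
          by (simp add: has_pd_shift)
        then show "(u has_field_derivative (pd j f (z + axis j t) - pd j f x))
            (at t within cball 0 (norm (h $ j)))"
          unfolding u_def
          by (intro has_field_derivative_at_within[OF DERIV_diff] DERIV_cmult_Id)
        show "norm (pd j f (z + axis j t) - pd j f x) \<le> e'"
          using dp[OF near[of t], of j] t by (simp add: dist_norm)
      qed auto
      moreover have "x + hs (insert j I) = z + axis j (h $ j)"
        using insert by (auto simp: z_def hs_def vec_eq_iff axis_def)
      ultimately have 1: "norm (f (x + hs (insert j I)) - f z - pd j f x * h $ j) \<le> e' * norm (h $ j)"
        by (simp add: u_def axis_0 algebra_simps)
      have 2: "f (x + hs (insert j I)) - f x - (\<Sum>i\<in>insert j I. pd i f x * h $ i) =
        (f (x + hs (insert j I)) - f z - pd j f x * h $ j) + (f z - f x - (\<Sum>i\<in>I. pd i f x * h $ i))"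
        using insert by simp
      show ?case
        unfolding 2 using norm_triangle_mono[OF 1 insert.IH[folded z_def]] insert by simp
    next
      case empty
      have "hs {} = 0" by (simp add: hs_def vec_eq_iff)
      then show ?case by simp
    next
      case (infinite I)
      then show ?case by simp
    qed
    moreover have "hs UNIV = h" by (simp add: hs_def vec_eq_iff)
    ultimately have "norm (f y - f x - (\<Sum>i\<in>UNIV. pd i f x * h $ i)) \<le> (\<Sum>i\<in>UNIV. e' * norm (h $ i))"
      by (metis h_def add_diff_cancel_left' diff_add_cancel add.commute)
    also have "\<dots> \<le> (\<Sum>i\<in>(UNIV::'m set). e' * norm h)"
      using e' by (intro sum_mono mult_left_mono Finite_Cartesian_Product.norm_nth_le) auto
    also have "\<dots> = e * norm h" by (simp add: e'_def)
    finally show "norm (f y - f x - (\<Sum>i\<in>UNIV. pd i f x * (y - x) $ i)) \<le> e * norm (y - x)"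
      by (simp add: h_def)
  qed
qed

lemma bounded_linear_axis: "bounded_linear (axis i :: 'k::real_normed_vector \<Rightarrow> 'k ^ 'm::finite)"
  by (rule bounded_linear_intro[where K = 1])
     (auto simp: axis_add norm_axis_eq, auto simp: axis_def vec_eq_iff)

text \<open>The inner map moves in all coordinates at once, so the total derivative of
  \<open>F\<close> is required; \<open>C_1_has_derivative\<close> supplies it from continuous
  partial derivatives.\<close>

lemma has_pd_compose:
  fixes F :: "'k::scalar ^ 'n::finite \<Rightarrow> 'k" and G :: "'k ^ 'm::finite \<Rightarrow> 'k ^ 'n"
  assumes "open T" "C_k (Suc 0) T F" "G x \<in> T" and G: "\<And>c. has_pd i (\<lambda>x. G x $ c) (g c) x"
  shows "has_pd i (\<lambda>x. F (G x)) (\<Sum>c\<in>UNIV. pd c F (G x) * g c) x"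
proof -
  \<comment> \<open>The vector-valued curve is assembled from its components as a sum of axis
    vectors, whose derivatives are known one by one.\<close>
  have "((\<lambda>t. \<Sum>c\<in>UNIV. axis c (G (x + axis i t) $ c)) has_derivative
      (\<lambda>t. \<Sum>c\<in>UNIV. axis c (g c * t))) (at 0)"
    using G unfolding has_pd_def has_field_derivative_def
    by (intro has_derivative_sum bounded_linear.has_derivative[OF bounded_linear_axis])
  moreover have "(\<Sum>c\<in>UNIV. axis c (v c)) = (\<chi> c. v c)" for v :: "'n \<Rightarrow> 'k"
    by (simp add: vec_eq_iff axis_def)
  ultimately have "((\<lambda>t. G (x + axis i t)) has_derivative (\<lambda>t. \<chi> c. g c * t)) (at 0)"
    by simp
  moreover have "(F has_derivative (\<lambda>h. \<Sum>c\<in>UNIV. pd c F (G x) * h $ c)) (at (G (x + axis i 0)))"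
    using C_1_has_derivative[OF assms(1-3)] by (simp add: axis_0)
  ultimately have "((\<lambda>t. F (G (x + axis i t))) has_derivative
      (\<lambda>t. \<Sum>c\<in>UNIV. pd c F (G x) * (\<chi> c. g c * t) $ c)) (at 0)"
    by (rule has_derivative_compose)
  moreover have "(\<lambda>t. \<Sum>c\<in>UNIV. pd c F (G x) * (\<chi> c. g c * t) $ c) = (*) (\<Sum>c\<in>UNIV. pd c F (G x) * g c)"
    by (auto simp: sum_distrib_right mult.assoc)
  ultimately show ?thesis
    by (simp add: has_pd_def has_field_derivative_def)
qed

lemma continuous_on_vec_components:
  "(\<And>c. continuous_on S (\<lambda>x. G x $ c)) \<Longrightarrow> continuous_on S (G :: _ \<Rightarrow> 'k::topological_space ^ 'n::finite)"
  using continuous_on_vec_lambda[of S "\<lambda>c x. G x $ c"] by simp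

text \<open>By the chain rule the derivative is a sum of products of \<open>pd c F\<close> after
  \<open>G\<close> with derivatives of \<open>G\<close>. The induction therefore varies
  \<open>F\<close> and uses \<open>G\<close> at one order less.\<close>

lemma C_k_compose:
  fixes F :: "'k::scalar ^ 'n::finite \<Rightarrow> 'k" and G :: "'k ^ 'm::finite \<Rightarrow> 'k ^ 'n"
  assumes S: "open S" and T: "open T" and GT: "G ` S \<subseteq> T"
  shows "C_k n T F \<Longrightarrow> (\<And>c. C_k n S (\<lambda>x. G x $ c)) \<Longrightarrow> C_k n S (\<lambda>x. F (G x))"
proof (induction n arbitrary: F)
  case 0
  then have "continuous_on S G" by (intro continuous_on_vec_components) simp
  then show ?case using 0 GT by (auto intro: continuous_on_compose2)
next
  case (Suc n)
  have "continuous_on S G" using Suc.prems by (intro continuous_on_vec_components) simp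
  then have cont: "continuous_on S (\<lambda>x. F (G x))"
    using Suc.prems GT by (auto intro: continuous_on_compose2)
  have "C_k (Suc 0) T F" using Suc.prems(1) by (auto intro: C_k_continuous)
  then have 1: "has_pd i (\<lambda>x. F (G x)) (\<Sum>c\<in>UNIV. pd c F (G x) * pd i (\<lambda>x. G x $ c) x) x" if "x \<in> S" for i x
    using Suc.prems that GT by (intro has_pd_compose[OF T] C_k_has_pd[of n S]) auto
  have "C_k n S (\<lambda>x. \<Sum>c\<in>UNIV. pd c F (G x) * pd i (\<lambda>x. G x $ c) x)" for i
  proof (intro C_k_sum C_k_mult S)
    have "C_k n T (pd c F)" for c using Suc.prems(1) by simp
    moreover have "C_k n S (\<lambda>x. G x $ c)" for c using Suc.prems(2) by (rule C_k_pred)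
    ultimately show "C_k n S (\<lambda>x. pd c F (G x))" for c by (rule Suc.IH)
    show "C_k n S (pd i (\<lambda>x. G x $ c))" for c using Suc.prems(2)[of c] by simp
  qed
  then have "C_k n S (pd i (\<lambda>x. F (G x)))" for i
    by (rule C_k_congI[OF S]) (rule pd_eqI[OF 1])
  moreover have "(\<lambda>t. F (G (x + axis i t))) field_differentiable (at 0)" if "x \<in> S" for i x
    using 1[OF that] by (auto simp: has_pd_def field_differentiable_def)
  ultimately show ?case using cont by simp
qed

lemma C_k_local:
  "(\<And>x. x \<in> S \<Longrightarrow> \<exists>T. open T \<and> x \<in> T \<and> C_k n T f) \<Longrightarrow> C_k n S f"
proof (induction n arbitrary: f)
  case 0
  have "isCont f x" if "x \<in> S" for x
    using 0[OF that] by (auto simp: continuous_on_eq_continuous_at)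
  then show ?case by (simp add: continuous_at_imp_continuous_on)
next
  case (Suc n)
  have "isCont f x" if "x \<in> S" for x
    using Suc.prems[OF that] by (auto simp: continuous_on_eq_continuous_at)
  then have "continuous_on S f" by (simp add: continuous_at_imp_continuous_on)
  moreover have "C_k n S (pd i f)" for i
    by (rule Suc.IH) (use Suc.prems in fastforce)
  ultimately show ?case using Suc.prems by fastforce
qed

text \<open>The mean value theorem as an equality concerns real functions of a real variable.
  Restricting to real parameters and pairing the values with a fixed \<open>b\<close> makes it
  usable for both scalar fields.\<close>

lemma pd_real_line:
  fixes f :: "'k::scalar ^ 'm::finite \<Rightarrow> 'k"
  assumes "has_pd i f d (x + axis i (of_real t))"
  shows "((\<lambda>s. inner b (f (x + axis i (of_real s)))) has_real_derivative inner b d) (at t)"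
proof -
  have "((\<lambda>s. f (x + axis i s)) has_field_derivative d) (at (of_real t))"
    using assms by (simp add: has_pd_shift)
  then have "((\<lambda>s. f (x + axis i (of_real s))) has_derivative (\<lambda>s. d * of_real s)) (at t)"
    unfolding has_field_derivative_def
    by (rule has_derivative_compose[rotated]) (rule has_derivative_of_real, rule has_derivative_ident)
  then have "((\<lambda>s. inner b (f (x + axis i (of_real s)))) has_derivative (\<lambda>s. inner b (d * of_real s))) (at t)"
    by (rule has_derivative_inner_right)
  moreover have "(\<lambda>s. inner b (d * of_real s)) = (*) (inner b d)"
    by (auto simp: mult.commute[of d] simp flip: scaleR_conv_of_real)
  ultimately show ?thesis by (simp add: has_field_derivative_def)
qed

text \<open>
  The second difference quotient in the directions \<open>i\<close> and \<open>j\<close> takes, by two applications of the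
  mean value theorem, a value of the mixed derivative in either order.
\<close>

lemma second_difference:
  fixes f :: "'k::scalar ^ 'm::finite \<Rightarrow> 'k"
  assumes f: "C_k (Suc (Suc 0)) (ball x r) f" and h: "0 < h" "2 * h < r"
  obtains y where "dist y x \<le> 2 * h"
    "inner b (f (x + axis i (of_real h) + axis j (of_real h)) - f (x + axis i (of_real h))
       - f (x + axis j (of_real h)) + f x) = h * h * inner b (pd j (pd i f) y)"
proof -
  define pt where "pt s t = x + axis i (of_real s) + axis j (of_real t)" for s t
  have near: "dist (pt s t) x \<le> 2 * h" if "0 \<le> s" "s \<le> h" "0 \<le> t" "t \<le> h" for s t
  proof -
    have "norm (axis i (of_real s) + axis j (of_real t) :: 'k ^ 'm) \<le> s + t"
      by (rule order_trans[OF norm_triangle_ineq]) (use that in \<open>simp add: norm_axis_eq\<close>)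
    then show ?thesis using that by (simp add: pt_def dist_norm add.assoc)
  qed
  have near': "pt s t \<in> ball x r" if "0 \<le> s" "s \<le> h" "0 \<le> t" "t \<le> h" for s t
    using near[OF that] h by (simp add: dist_commute)
  \<comment> \<open>The difference in direction \<open>j\<close>, as a function of the step in
    direction \<open>i\<close>; its increment over [0, h] is the second difference.\<close>
  define u where "u s = inner b (f (pt s h)) - inner b (f (pt s 0))" for s
  have pti: "pt s t = (x + axis j (of_real t)) + axis i (of_real s)" for s t
    by (simp add: pt_def add_ac)
  have "(u has_real_derivative (inner b (pd i f (pt s h)) - inner b (pd i f (pt s 0)))) (at s)"
    if "0 \<le> s" "s \<le> h" for s
    unfolding u_def pti
  proof (intro DERIV_diff pd_real_line C_k_has_pd[OF f])
    show "x + axis j (of_real h) + axis i (of_real s) \<in> ball x r"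
      using near'[of s h] that h by (simp only: pti)
    show "x + axis j (of_real 0) + axis i (of_real s) \<in> ball x r"
      using near'[of s 0] that h by (simp only: pti)
  qed
  from MVT2[OF h(1) this] obtain s where s: "0 < s" "s < h"
    and 1: "u h - u 0 = (h - 0) * (inner b (pd i f (pt s h)) - inner b (pd i f (pt s 0)))"
    by auto
  have "((\<lambda>t. inner b (pd i f (pt s t))) has_real_derivative inner b (pd j (pd i f) (pt s t))) (at t)"
    if "0 \<le> t" "t \<le> h" for t
  proof -
    have "C_k (Suc 0) (ball x r) (pd i f)" using f by simp
    then show ?thesis
      unfolding pt_def
    proof (intro pd_real_line C_k_has_pd)
      show "x + axis i (of_real s) + axis j (of_real t) \<in> ball x r"
        using near'[of s t] that s by (simp only: pt_def)
    qed
  qed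
  from MVT2[OF h(1) this] obtain t where t: "0 < t" "t < h"
    and 2: "inner b (pd i f (pt s h)) - inner b (pd i f (pt s 0)) = (h - 0) * inner b (pd j (pd i f) (pt s t))"
    by auto
  have "u h - u 0 = h * h * inner b (pd j (pd i f) (pt s t))"
    unfolding 1 2 by simp
  moreover have "u h - u 0 = inner b (f (x + axis i (of_real h) + axis j (of_real h)) - f (x + axis i (of_real h))
       - f (x + axis j (of_real h)) + f x)"
    by (simp add: u_def pt_def axis_0 inner_diff_right inner_add_right)
  ultimately show ?thesis
    using that near[of s t] s t by simp
qed

text \<open>The second difference is symmetric in \<open>i\<close> and \<open>j\<close>, while the
  intermediate points tend to \<open>x\<close> with the step size. The comparison is made for one
  \<open>b\<close> at a time, as those points depend on \<open>b\<close>.\<close>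

lemma pd_commute:
  fixes f :: "'k::scalar ^ 'm::finite \<Rightarrow> 'k"
  assumes S: "open S" and f: "C_k (Suc (Suc 0)) S f" and x: "x \<in> S"
  shows "pd i (pd j f) x = pd j (pd i f) x"
proof -
  obtain r where r: "r > 0" "ball x r \<subseteq> S" using S x open_contains_ball by blast
  have f': "C_k (Suc (Suc 0)) (ball x r) f" using C_k_subset[OF f r(2)] .
  have cont: "isCont (pd j' (pd i' f)) x" for i' j'
  proof -
    have "continuous_on S (pd j' (pd i' f))" using f by simp
    then show ?thesis using S x by (simp add: continuous_on_eq_continuous_at)
  qed
  have "dist (pd i (pd j f) x) (pd j (pd i f) x) = 0"
  proof (rule ccontr)
    assume "dist (pd i (pd j f) x) (pd j (pd i f) x) \<noteq> 0"
    then obtain b where b: "inner b (pd i (pd j f) x) \<noteq> inner b (pd j (pd i f) x)"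
      by (metis dist_self vector_eq_ldot)
    \<comment> \<open>Half the gap: a common number cannot be within \<open>e\<close> of both
      values.\<close>
    define e where "e = \<bar>inner b (pd i (pd j f) x) - inner b (pd j (pd i f) x)\<bar> / 2"
    have "e > 0" using b by (simp add: e_def)
    have "eventually (\<lambda>y. dist (inner b (pd j' (pd i' f) y)) (inner b (pd j' (pd i' f) x)) < e) (nhds x)" for i' j'
    proof -
      have "((\<lambda>y. inner b (pd j' (pd i' f) y)) \<longlongrightarrow> inner b (pd j' (pd i' f) x)) (nhds x)"
        using cont[of j' i'] by (auto simp: isCont_def tendsto_at_iff_tendsto_nhds intro: tendsto_intros)
      then show ?thesis using \<open>e > 0\<close> by (rule tendstoD)
    qed
    then have "eventually (\<lambda>y. dist (inner b (pd j (pd i f) y)) (inner b (pd j (pd i f) x)) < e \<and>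
        dist (inner b (pd i (pd j f) y)) (inner b (pd i (pd j f) x)) < e) (nhds x)"
      by (intro eventually_conj)
    then obtain d where d: "d > 0"
      "\<And>y. dist y x < d \<Longrightarrow> dist (inner b (pd j (pd i f) y)) (inner b (pd j (pd i f) x)) < e"
      "\<And>y. dist y x < d \<Longrightarrow> dist (inner b (pd i (pd j f) y)) (inner b (pd i (pd j f) x)) < e"
      unfolding eventually_nhds_metric by blast
    \<comment> \<open>The intermediate points lie within \<open>2 * h\<close> of \<open>x\<close>,
      which must stay below both \<open>d\<close> and \<open>r\<close>.\<close>
    define h where "h = min d r / 4"
    have h: "0 < h" "2 * h < r" "2 * h < d" using d r by (auto simp: h_def)
    from second_difference[OF f' h(1,2), of b i j] obtain y where y: "dist y x \<le> 2 * h"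
      "inner b (f (x + axis i (of_real h) + axis j (of_real h)) - f (x + axis i (of_real h))
       - f (x + axis j (of_real h)) + f x) = h * h * inner b (pd j (pd i f) y)" .
    from second_difference[OF f' h(1,2), of b j i] obtain z where z: "dist z x \<le> 2 * h"
      "inner b (f (x + axis j (of_real h) + axis i (of_real h)) - f (x + axis j (of_real h))
       - f (x + axis i (of_real h)) + f x) = h * h * inner b (pd i (pd j f) z)" .
    have "f (x + axis i (of_real h) + axis j (of_real h)) - f (x + axis i (of_real h))
       - f (x + axis j (of_real h)) + f x = f (x + axis j (of_real h) + axis i (of_real h)) - f (x + axis j (of_real h))
       - f (x + axis i (of_real h)) + f x"
      by (simp add: add.assoc add.commute[of "axis i (of_real h)"])
    with y z h have "inner b (pd j (pd i f) y) = inner b (pd i (pd j f) z)"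
      by simp
    moreover have "dist (inner b (pd j (pd i f) y)) (inner b (pd j (pd i f) x)) < e"
      using y(1) h by (intro d) auto
    moreover have "dist (inner b (pd i (pd j f) z)) (inner b (pd i (pd j f) x)) < e"
      using z(1) h by (intro d) auto
    ultimately show False
      unfolding dist_real_def e_def by argo
  qed
  then show ?thesis by simp
qed

section \<open>Power series\<close>

definition mpow :: "'k::scalar ^ 'm::finite \<Rightarrow> ('m \<Rightarrow> nat) \<Rightarrow> 'k" where
  "mpow z \<alpha> = (\<Prod>i\<in>UNIV. z $ i ^ \<alpha> i)"

definition polydisc :: "real \<Rightarrow> ('k::scalar ^ 'm::finite) set" where
  "polydisc \<rho> = {z. \<forall>i. norm (z $ i) \<le> \<rho>}"

text \<open>The expansion is about 0, and \<open>M\<close> bounds the weighted l1 norm of its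
  coefficients at radius \<rho>. This norm is submultiplicative, so bounds for products, powers and
  substitutions come with the expansions.\<close>

definition expands :: "real \<Rightarrow> real \<Rightarrow> ('k::scalar ^ 'm::finite \<Rightarrow> 'k) \<Rightarrow> bool" where
  "expands \<rho> M f \<longleftrightarrow> (\<exists>a. (\<lambda>\<alpha>. norm (a \<alpha>) * \<rho> ^ sum \<alpha> UNIV) summable_on UNIV \<and>
     (\<Sum>\<^sub>\<infinity>\<alpha>. norm (a \<alpha>) * \<rho> ^ sum \<alpha> UNIV) \<le> M \<and>
     (\<forall>z\<in>polydisc \<rho>. f z = (\<Sum>\<^sub>\<infinity>\<alpha>. a \<alpha> * mpow z \<alpha>)))"

lemma norm_mpow_le: "z \<in> polydisc \<rho> \<Longrightarrow> norm (mpow z \<alpha>) \<le> \<rho> ^ sum \<alpha> UNIV"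
  unfolding mpow_def polydisc_def prod_norm[symmetric] norm_power power_sum
  by (auto intro!: prod_mono power_mono)

lemma mpow_add: "mpow z (\<lambda>i. \<alpha> i + \<beta> i) = mpow z \<alpha> * mpow z \<beta>"
  by (simp add: mpow_def power_add prod.distrib)

lemma mpow_of_real: "mpow (\<chi> i. of_real r) \<alpha> = of_real (r ^ sum \<alpha> UNIV)"
  by (simp add: mpow_def power_sum)

text \<open>On the polydisc every monomial is dominated by its value at the corner (\<rho>, ...,
  \<rho>).\<close>

lemma mpow_term_summable:
  fixes c :: "'i \<Rightarrow> 'k::scalar" and m :: "'i \<Rightarrow> 'm::finite \<Rightarrow> nat"
  assumes "(\<lambda>k. norm (c k) * \<rho> ^ sum (m k) UNIV) summable_on I" "z \<in> polydisc \<rho>"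
  shows "(\<lambda>k. norm (c k * mpow z (m k))) summable_on I" "(\<lambda>k. c k * mpow z (m k)) summable_on I"
    and "norm (\<Sum>\<^sub>\<infinity>k\<in>I. c k * mpow z (m k)) \<le> (\<Sum>\<^sub>\<infinity>k\<in>I. norm (c k) * \<rho> ^ sum (m k) UNIV)"
proof -
  have le: "norm (c k * mpow z (m k)) \<le> norm (c k) * \<rho> ^ sum (m k) UNIV" for k
    using norm_mpow_le[OF assms(2)] by (simp add: norm_mult mult_left_mono)
  show 1: "(\<lambda>k. norm (c k * mpow z (m k))) summable_on I"
    by (rule summable_on_comparison_test[OF assms(1)]) (use le in auto)
  then show "(\<lambda>k. c k * mpow z (m k)) summable_on I"
    by (rule abs_summable_summable)
  have "norm (\<Sum>\<^sub>\<infinity>k\<in>I. c k * mpow z (m k)) \<le> (\<Sum>\<^sub>\<infinity>k\<in>I. norm (c k * mpow z (m k)))"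
    by (rule norm_infsum_bound[OF 1])
  also have "\<dots> \<le> (\<Sum>\<^sub>\<infinity>k\<in>I. norm (c k) * \<rho> ^ sum (m k) UNIV)"
    by (rule infsum_mono[OF 1 assms(1) le])
  finally show "norm (\<Sum>\<^sub>\<infinity>k\<in>I. c k * mpow z (m k)) \<le> (\<Sum>\<^sub>\<infinity>k\<in>I. norm (c k) * \<rho> ^ sum (m k) UNIV)" .
qed

lemma expands_bound:
  assumes "expands \<rho> M f" "z \<in> polydisc \<rho>"
  shows "norm (f z) \<le> M"
proof -
  obtain a where a: "(\<lambda>\<alpha>. norm (a \<alpha>) * \<rho> ^ sum \<alpha> UNIV) summable_on UNIV"
    "(\<Sum>\<^sub>\<infinity>\<alpha>. norm (a \<alpha>) * \<rho> ^ sum \<alpha> UNIV) \<le> M" "f z = (\<Sum>\<^sub>\<infinity>\<alpha>. a \<alpha> * mpow z \<alpha>)"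
    using assms unfolding expands_def by blast
  show ?thesis
    using mpow_term_summable(3)[OF a(1) assms(2)] a(2,3) by simp
qed

text \<open>
  The same exponent may occur infinitely often among the \<open>m k\<close>, so this covers sums and products of
  power series alike.
\<close>

lemma expands_family:
  fixes c :: "'i \<Rightarrow> 'k::scalar" and m :: "'i \<Rightarrow> 'm::finite \<Rightarrow> nat"
  assumes \<rho>: "\<rho> > 0"
    and s: "(\<lambda>k. norm (c k) * \<rho> ^ sum (m k) UNIV) summable_on I"
    and le: "(\<Sum>\<^sub>\<infinity>k\<in>I. norm (c k) * \<rho> ^ sum (m k) UNIV) \<le> M"
    and f: "\<And>z. z \<in> polydisc \<rho> \<Longrightarrow> f z = (\<Sum>\<^sub>\<infinity>k\<in>I. c k * mpow z (m k))"
  shows "expands \<rho> M f"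
proof -
  \<comment> \<open>The fibres of the exponent map. They partition \<open>I\<close>, so a sum over
    \<open>I\<close> is a sum over exponents of sums over fibres.\<close>
  define J where "J \<gamma> = {k\<in>I. m k = \<gamma>}" for \<gamma>
  have bij: "bij_betw snd (Sigma UNIV J) I"
    by (rule bij_betwI[where g = "\<lambda>k. (m k, k)"]) (auto simp: J_def)
  have fam: "(\<lambda>(\<gamma>, k). F k) summable_on Sigma UNIV J"
      "(\<Sum>\<^sub>\<infinity>k\<in>I. F k) = (\<Sum>\<^sub>\<infinity>\<gamma>. \<Sum>\<^sub>\<infinity>k\<in>J \<gamma>. F k)"
    if "F summable_on I" for F :: "'i \<Rightarrow> 'b::banach"
  proof -
    have eq: "(\<lambda>p. F (snd p)) = (\<lambda>(\<gamma>, k). F k)" by auto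
    show 1: "(\<lambda>(\<gamma>, k). F k) summable_on Sigma UNIV J"
      using summable_on_reindex_bij_betw[OF bij, of F] that by (simp add: eq)
    show "(\<Sum>\<^sub>\<infinity>k\<in>I. F k) = (\<Sum>\<^sub>\<infinity>\<gamma>. \<Sum>\<^sub>\<infinity>k\<in>J \<gamma>. F k)"
      using infsum_reindex_bij_betw[OF bij, of F] infsum_Sigma'_banach[OF 1] by (simp add: eq)
  qed
  define a where "a \<gamma> = (\<Sum>\<^sub>\<infinity>k\<in>J \<gamma>. c k)" for \<gamma>
  \<comment> \<open>Within a fibre the weight is one positive constant and can be divided
    out.\<close>
  have c: "(\<lambda>k. norm (c k)) summable_on J \<gamma>" for \<gamma>
  proof -
    have "(\<lambda>k. norm (c k) * \<rho> ^ sum (m k) UNIV) summable_on J \<gamma>"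
      by (rule summable_on_subset_banach[OF s]) (auto simp: J_def)
    then have "(\<lambda>k. norm (c k) * \<rho> ^ sum \<gamma> UNIV) summable_on J \<gamma>"
      by (rule summable_on_cong[THEN iffD1, rotated]) (auto simp: J_def)
    then show ?thesis
      using \<rho> by (subst (asm) summable_on_cmult_left') auto
  qed
  have le': "norm (a \<gamma>) * \<rho> ^ sum \<gamma> UNIV \<le> (\<Sum>\<^sub>\<infinity>k\<in>J \<gamma>. norm (c k) * \<rho> ^ sum (m k) UNIV)" for \<gamma>
  proof -
    have "norm (a \<gamma>) * \<rho> ^ sum \<gamma> UNIV \<le> (\<Sum>\<^sub>\<infinity>k\<in>J \<gamma>. norm (c k)) * \<rho> ^ sum \<gamma> UNIV"
      unfolding a_def using \<rho> by (intro mult_right_mono norm_infsum_bound c) auto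
    also have "\<dots> = (\<Sum>\<^sub>\<infinity>k\<in>J \<gamma>. norm (c k) * \<rho> ^ sum \<gamma> UNIV)"
      by (rule infsum_cmult_left'[symmetric])
    also have "\<dots> = (\<Sum>\<^sub>\<infinity>k\<in>J \<gamma>. norm (c k) * \<rho> ^ sum (m k) UNIV)"
      by (rule infsum_cong) (auto simp: J_def)
    finally show ?thesis .
  qed
  have sB: "(\<lambda>\<gamma>. \<Sum>\<^sub>\<infinity>k\<in>J \<gamma>. norm (c k) * \<rho> ^ sum (m k) UNIV) summable_on UNIV"
    by (rule summable_on_Sigma_banach[OF fam(1)[OF s]])
  have sa: "(\<lambda>\<gamma>. norm (a \<gamma>) * \<rho> ^ sum \<gamma> UNIV) summable_on UNIV"
    by (rule summable_on_comparison_test[OF sB]) (use le' \<rho> in auto)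
  have "(\<Sum>\<^sub>\<infinity>\<gamma>. norm (a \<gamma>) * \<rho> ^ sum \<gamma> UNIV) \<le> M"
    using infsum_mono[OF sa sB le'] le fam(2)[OF s] by simp
  moreover have "f z = (\<Sum>\<^sub>\<infinity>\<gamma>. a \<gamma> * mpow z \<gamma>)" if "z \<in> polydisc \<rho>" for z
  proof -
    have "f z = (\<Sum>\<^sub>\<infinity>\<gamma>. \<Sum>\<^sub>\<infinity>k\<in>J \<gamma>. c k * mpow z (m k))"
      using fam(2)[OF mpow_term_summable(2)[OF s that]] f[OF that] by simp
    also have "\<dots> = (\<Sum>\<^sub>\<infinity>\<gamma>. \<Sum>\<^sub>\<infinity>k\<in>J \<gamma>. c k * mpow z \<gamma>)"
      by (intro infsum_cong) (auto simp: J_def)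
    also have "\<dots> = (\<Sum>\<^sub>\<infinity>\<gamma>. a \<gamma> * mpow z \<gamma>)"
      unfolding a_def by (intro infsum_cong infsum_cmult_left abs_summable_summable[OF c])
    finally show ?thesis .
  qed
  ultimately show ?thesis
    unfolding expands_def using sa by blast
qed

lemma summable_on_Times_nonneg:
  fixes F :: "'i \<Rightarrow> 'j \<Rightarrow> real"
  assumes nonneg: "\<And>x y. F x y \<ge> 0" and "\<And>x. F x summable_on B x"
    and "(\<lambda>x. \<Sum>\<^sub>\<infinity>y\<in>B x. F x y) summable_on A"
  shows "(\<lambda>(x, y). F x y) summable_on Sigma A B"
proof -
  have "(\<lambda>p. norm ((\<lambda>(x, y). F x y) p)) summable_on Sigma A B"
    by (rule Infinite_Sum.abs_summable_on_Sigma_iff[THEN iffD2]) (simp add: assms infsum_nonneg)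
  then show ?thesis by (rule abs_summable_summable)
qed

lemma expands_const:
  assumes "\<rho> > 0"
  shows "expands \<rho> (norm b) (\<lambda>_. b)"
proof (rule expands_family[OF assms, where c = "\<lambda>_. b" and m = "\<lambda>_ _. 0" and I = "{0 :: nat}"])
  show "(\<lambda>k. norm b * \<rho> ^ sum (\<lambda>_. 0) UNIV) summable_on {0 :: nat}"
    by (rule summable_on_finite) simp
  show "(\<Sum>\<^sub>\<infinity>k\<in>{0 :: nat}. norm b * \<rho> ^ sum (\<lambda>_. 0) UNIV) \<le> norm b"
    by (subst infsum_finite) simp_all
  show "b = (\<Sum>\<^sub>\<infinity>k\<in>{0 :: nat}. b * mpow z (\<lambda>_. 0))" for z
    by (subst infsum_finite) (simp_all add: mpow_def)
qed

text \<open>The Cauchy product is written over pairs of exponents, where the majorants simply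
  multiply; collecting equal exponents is left to \<open>expands_family\<close>.\<close>

lemma expands_mult:
  fixes f g :: "'k::scalar ^ 'm::finite \<Rightarrow> 'k"
  assumes \<rho>: "\<rho> > 0" and "expands \<rho> M f" "expands \<rho> N g"
  shows "expands \<rho> (M * N) (\<lambda>z. f z * g z)"
proof -
  obtain a where a: "(\<lambda>\<alpha>. norm (a \<alpha>) * \<rho> ^ sum \<alpha> UNIV) summable_on UNIV"
    "(\<Sum>\<^sub>\<infinity>\<alpha>. norm (a \<alpha>) * \<rho> ^ sum \<alpha> UNIV) \<le> M" "\<And>z. z \<in> polydisc \<rho> \<Longrightarrow> f z = (\<Sum>\<^sub>\<infinity>\<alpha>. a \<alpha> * mpow z \<alpha>)"
    using assms(2) unfolding expands_def by blast
  obtain b where b: "(\<lambda>\<alpha>. norm (b \<alpha>) * \<rho> ^ sum \<alpha> UNIV) summable_on UNIV"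
    "(\<Sum>\<^sub>\<infinity>\<alpha>. norm (b \<alpha>) * \<rho> ^ sum \<alpha> UNIV) \<le> N" "\<And>z. z \<in> polydisc \<rho> \<Longrightarrow> g z = (\<Sum>\<^sub>\<infinity>\<alpha>. b \<alpha> * mpow z \<alpha>)"
    using assms(3) unfolding expands_def by blast
  define u v where "u \<alpha> = norm (a \<alpha>) * \<rho> ^ sum \<alpha> UNIV" and "v \<alpha> = norm (b \<alpha>) * \<rho> ^ sum \<alpha> UNIV" for \<alpha>
  have uv: "u \<alpha> \<ge> 0" "v \<alpha> \<ge> 0" for \<alpha> using \<rho> by (auto simp: u_def v_def)
  have suv: "(\<lambda>(\<alpha>, \<beta>). u \<alpha> * v \<beta>) summable_on (UNIV \<times> UNIV)"
  proof (rule summable_on_Times_nonneg)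
    show "u \<alpha> * v \<beta> \<ge> 0" for \<alpha> \<beta> using uv by simp
    show "(\<lambda>\<beta>. u \<alpha> * v \<beta>) summable_on UNIV" for \<alpha>
      using b(1) by (intro summable_on_cmult_right) (simp add: v_def)
    show "(\<lambda>\<alpha>. \<Sum>\<^sub>\<infinity>\<beta>. u \<alpha> * v \<beta>) summable_on UNIV"
      unfolding infsum_cmult_right' using a(1) by (intro summable_on_cmult_left) (simp add: u_def)
  qed
  have eq: "norm (case p of (\<alpha>, \<beta>) \<Rightarrow> a \<alpha> * b \<beta>) * \<rho> ^ sum (case p of (\<alpha>, \<beta>) \<Rightarrow> \<lambda>i. \<alpha> i + \<beta> i) UNIV =
      (case p of (\<alpha>, \<beta>) \<Rightarrow> u \<alpha> * v \<beta>)" for p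
    by (cases p) (simp add: u_def v_def norm_mult sum.distrib power_add mult_ac)
  show ?thesis
  proof (rule expands_family[OF \<rho>, where c = "\<lambda>(\<alpha>, \<beta>). a \<alpha> * b \<beta>" and m = "\<lambda>(\<alpha>, \<beta>) i. \<alpha> i + \<beta> i"
        and I = "UNIV \<times> UNIV"], unfold eq)
    show "(\<lambda>p. case p of (\<alpha>, \<beta>) \<Rightarrow> u \<alpha> * v \<beta>) summable_on (UNIV \<times> UNIV)" by (rule suv)
    have "(\<Sum>\<^sub>\<infinity>p\<in>UNIV \<times> UNIV. case p of (\<alpha>, \<beta>) \<Rightarrow> u \<alpha> * v \<beta>) = (\<Sum>\<^sub>\<infinity>\<alpha>. u \<alpha>) * (\<Sum>\<^sub>\<infinity>\<beta>. v \<beta>)"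
      by (subst infsum_Sigma'_banach[OF suv, symmetric]) (simp add: infsum_cmult_right' infsum_cmult_left')
    also have "\<dots> \<le> M * N"
      using a(2) b(2) uv infsum_nonneg[of UNIV u] infsum_nonneg[of UNIV v]
      by (intro mult_mono) (auto simp flip: u_def v_def)
    finally show "(\<Sum>\<^sub>\<infinity>p\<in>UNIV \<times> UNIV. case p of (\<alpha>, \<beta>) \<Rightarrow> u \<alpha> * v \<beta>) \<le> M * N" .
  next
    fix z :: "'k ^ 'm" assume z: "z \<in> polydisc \<rho>"
    have "(\<lambda>p. norm (case p of (\<alpha>, \<beta>) \<Rightarrow> (a \<alpha> * mpow z \<alpha>) * (b \<beta> * mpow z \<beta>))) summable_on (UNIV \<times> UNIV)"
    proof (rule summable_on_comparison_test[OF suv])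
      show "norm (case p of (\<alpha>, \<beta>) \<Rightarrow> (a \<alpha> * mpow z \<alpha>) * (b \<beta> * mpow z \<beta>)) \<le> (case p of (\<alpha>, \<beta>) \<Rightarrow> u \<alpha> * v \<beta>)" for p
        using norm_mpow_le[OF z] \<rho> by (cases p) (auto simp: u_def v_def norm_mult intro!: mult_mono mult_left_mono)
    qed auto
    then have "(\<lambda>p. case p of (\<alpha>, \<beta>) \<Rightarrow> (a \<alpha> * mpow z \<alpha>) * (b \<beta> * mpow z \<beta>)) summable_on (UNIV \<times> UNIV)"
      by (rule abs_summable_summable)
    then have "(\<Sum>\<^sub>\<infinity>\<alpha>. \<Sum>\<^sub>\<infinity>\<beta>. (a \<alpha> * mpow z \<alpha>) * (b \<beta> * mpow z \<beta>)) =
        (\<Sum>\<^sub>\<infinity>p\<in>UNIV \<times> UNIV. case p of (\<alpha>, \<beta>) \<Rightarrow> (a \<alpha> * mpow z \<alpha>) * (b \<beta> * mpow z \<beta>))"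
      by (rule infsum_Sigma'_banach)
    moreover have "(\<Sum>\<^sub>\<infinity>\<alpha>. \<Sum>\<^sub>\<infinity>\<beta>. (a \<alpha> * mpow z \<alpha>) * (b \<beta> * mpow z \<beta>)) = f z * g z"
      using a(3)[OF z] b(3)[OF z] by (simp add: infsum_cmult_right' infsum_cmult_left')
    ultimately show "f z * g z = (\<Sum>\<^sub>\<infinity>p\<in>UNIV \<times> UNIV. (case p of (\<alpha>, \<beta>) \<Rightarrow> a \<alpha> * b \<beta>) *
        mpow z (case p of (\<alpha>, \<beta>) \<Rightarrow> \<lambda>i. \<alpha> i + \<beta> i))"
      by (simp add: case_prod_unfold mpow_add mult_ac)
  qed
qed

lemma expands_power: "\<rho> > 0 \<Longrightarrow> expands \<rho> M f \<Longrightarrow> expands \<rho> (M ^ n) (\<lambda>z. f z ^ n)"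
proof (induction n)
  case 0
  then show ?case using expands_const[of \<rho> 1] by simp
next
  case (Suc n)
  then show ?case using expands_mult[of \<rho> M f "M ^ n" "\<lambda>z. f z ^ n"] by simp
qed

lemma expands_prod:
  "\<rho> > 0 \<Longrightarrow> (\<And>j. j \<in> S \<Longrightarrow> expands \<rho> (M j) (f j)) \<Longrightarrow> expands \<rho> (\<Prod>j\<in>S. M j) (\<lambda>z. \<Prod>j\<in>S. f j z)"
proof (induction S rule: infinite_finite_induct)
  case (insert x F)
  then show ?case using expands_mult[of \<rho> "M x" "f x" "\<Prod>j\<in>F. M j" "\<lambda>z. \<Prod>j\<in>F. f j z"] by simp
qed (use expands_const[of \<rho> 1] in auto)

text \<open>Summability of the bounds \<open>M j\<close> makes the double series over
  \<open>j\<close> and the exponents absolutely convergent, so it may be regrouped by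
  exponents.\<close>

lemma expands_infsum:
  fixes f :: "'j \<Rightarrow> 'k::scalar ^ 'm::finite \<Rightarrow> 'k"
  assumes \<rho>: "\<rho> > 0" and f: "\<And>j. expands \<rho> (M j) (f j)" and M: "M summable_on UNIV"
  shows "expands \<rho> (\<Sum>\<^sub>\<infinity>j. M j) (\<lambda>z. \<Sum>\<^sub>\<infinity>j. f j z)"
proof -
  have "\<forall>j. \<exists>a. (\<lambda>\<alpha>. norm (a \<alpha>) * \<rho> ^ sum \<alpha> UNIV) summable_on UNIV \<and>
     (\<Sum>\<^sub>\<infinity>\<alpha>. norm (a \<alpha>) * \<rho> ^ sum \<alpha> UNIV) \<le> M j \<and>
     (\<forall>z\<in>polydisc \<rho>. f j z = (\<Sum>\<^sub>\<infinity>\<alpha>. a \<alpha> * mpow z \<alpha>))"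
    using f by (simp add: expands_def)
  from choice[OF this]
  obtain a where a: "\<And>j. (\<lambda>\<alpha>. norm (a j \<alpha>) * \<rho> ^ sum \<alpha> UNIV) summable_on UNIV"
    "\<And>j. (\<Sum>\<^sub>\<infinity>\<alpha>. norm (a j \<alpha>) * \<rho> ^ sum \<alpha> UNIV) \<le> M j"
    "\<And>j z. z \<in> polydisc \<rho> \<Longrightarrow> f j z = (\<Sum>\<^sub>\<infinity>\<alpha>. a j \<alpha> * mpow z \<alpha>)"
    by blast
  have nonneg: "(\<Sum>\<^sub>\<infinity>\<alpha>. norm (a j \<alpha>) * \<rho> ^ sum \<alpha> UNIV) \<ge> 0" for j
    using \<rho> by (intro infsum_nonneg) auto
  have sM: "(\<lambda>j. \<Sum>\<^sub>\<infinity>\<alpha>. norm (a j \<alpha>) * \<rho> ^ sum \<alpha> UNIV) summable_on UNIV"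
    by (rule summable_on_comparison_test[OF M]) (use a(2) nonneg in auto)
  have s: "(\<lambda>(j, \<alpha>). norm (a j \<alpha>) * \<rho> ^ sum \<alpha> UNIV) summable_on (UNIV \<times> UNIV)"
    by (rule summable_on_Times_nonneg[OF _ a(1) sM]) (use \<rho> in simp)
  show ?thesis
  proof (rule expands_family[OF \<rho>, where c = "\<lambda>(j, \<alpha>). a j \<alpha>" and m = snd and I = "UNIV \<times> UNIV"])
    show 1: "(\<lambda>p. norm (case p of (j, \<alpha>) \<Rightarrow> a j \<alpha>) * \<rho> ^ sum (snd p) UNIV) summable_on (UNIV \<times> UNIV)"
      using s by (simp add: case_prod_unfold)
    have "(\<Sum>\<^sub>\<infinity>p\<in>UNIV \<times> UNIV. norm (case p of (j, \<alpha>) \<Rightarrow> a j \<alpha>) * \<rho> ^ sum (snd p) UNIV) =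
        (\<Sum>\<^sub>\<infinity>j. \<Sum>\<^sub>\<infinity>\<alpha>. norm (a j \<alpha>) * \<rho> ^ sum \<alpha> UNIV)"
      using infsum_Sigma'_banach[OF s] by (simp add: case_prod_unfold)
    also have "\<dots> \<le> (\<Sum>\<^sub>\<infinity>j. M j)"
      by (rule infsum_mono[OF sM M a(2)])
    finally show "(\<Sum>\<^sub>\<infinity>p\<in>UNIV \<times> UNIV. norm (case p of (j, \<alpha>) \<Rightarrow> a j \<alpha>) * \<rho> ^ sum (snd p) UNIV) \<le> (\<Sum>\<^sub>\<infinity>j. M j)" .
    fix z :: "'k ^ 'm" assume z: "z \<in> polydisc \<rho>"
    have "(\<lambda>(j, \<alpha>). a j \<alpha> * mpow z \<alpha>) summable_on (UNIV \<times> UNIV)"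
      using mpow_term_summable(2)[OF 1 z] by (simp add: case_prod_unfold)
    from infsum_Sigma'_banach[OF this]
    show "(\<Sum>\<^sub>\<infinity>j. f j z) = (\<Sum>\<^sub>\<infinity>p\<in>UNIV \<times> UNIV. (case p of (j, \<alpha>) \<Rightarrow> a j \<alpha>) * mpow z (snd p))"
      by (simp add: a(3)[OF z] case_prod_unfold)
  qed
qed

definition power_series_on :: "'k::scalar ^ 'm::finite \<Rightarrow> real \<Rightarrow> ('k ^ 'm \<Rightarrow> 'k) \<Rightarrow> (('m \<Rightarrow> nat) \<Rightarrow> 'k) \<Rightarrow> bool" where
  "power_series_on p r f a \<longleftrightarrow> (\<forall>x\<in>ball p r. ((\<lambda>\<alpha>. a \<alpha> * mpow (x - p) \<alpha>) has_sum f x) UNIV)"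

lemma cplx_0 [simp]: "cplx 0 = 0"
  using cplx_add[of 0 0] by simp

lemma bounded_linear_cplx: "bounded_linear cplx"
  by (rule bounded_linear_intro[where K = 1]) (simp_all add: cplx_add cplx_scaleR norm_cplx)

text \<open>The norm-preserving \<open>cplx\<close> carries the question to the complex numbers,
  where unconditional and absolute convergence agree. Thus the \<open>has_sum\<close> in the
  definition of analyticity yields majorants.\<close>

lemma scalar_summable_abs:
  fixes f :: "'i \<Rightarrow> 'k::scalar"
  assumes "f summable_on I"
  shows "(\<lambda>x. norm (f x)) summable_on I"
proof -
  have "(\<lambda>x. cplx (f x)) summable_on I"
    using summable_on_bounded_linear[OF bounded_linear_cplx assms] by (simp add: o_def)
  then show ?thesis
    by (simp add: summable_on_iff_abs_summable_on_complex norm_cplx)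
qed

lemma polydisc_ball:
  fixes p :: "'k::scalar ^ 'm::finite"
  assumes "z \<in> polydisc \<rho>" "real CARD('m) * \<rho> < r"
  shows "p + z \<in> ball p r"
proof -
  have "norm z \<le> (\<Sum>i\<in>UNIV. norm (z $ i))"
    unfolding norm_vec_def by (rule L2_set_le_sum) simp
  also have "\<dots> \<le> (\<Sum>i\<in>(UNIV::'m set). \<rho>)"
    using assms(1) by (intro sum_mono) (auto simp: polydisc_def)
  finally show ?thesis using assms(2) by (simp add: dist_norm)
qed

text \<open>Evaluate at the corner of the polydisc: there each monomial is a power of \<rho>, and
  convergence is absolute.\<close>

lemma power_series_majorant:
  fixes p :: "'k::scalar ^ 'm::finite"
  assumes "power_series_on p r f a" "0 \<le> \<rho>" "real CARD('m) * \<rho> < r"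
  shows "(\<lambda>\<alpha>. norm (a \<alpha>) * \<rho> ^ sum \<alpha> UNIV) summable_on UNIV"
proof -
  have "(\<chi> i. of_real \<rho>) \<in> (polydisc \<rho> :: ('k ^ 'm) set)"
    using assms(2) by (simp add: polydisc_def)
  from polydisc_ball[OF this assms(3), of p]
  have "((\<lambda>\<alpha>. a \<alpha> * mpow (\<chi> i. of_real \<rho>) \<alpha>) has_sum f (p + (\<chi> i. of_real \<rho>))) UNIV"
    using assms(1) unfolding power_series_on_def by fastforce
  then have "(\<lambda>\<alpha>. a \<alpha> * mpow (\<chi> i. of_real \<rho>) \<alpha>) summable_on UNIV"
    by (rule has_sum_imp_summable)
  then have "(\<lambda>\<alpha>. norm (a \<alpha> * mpow (\<chi> i. of_real \<rho>) \<alpha>)) summable_on UNIV"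
    by (rule scalar_summable_abs)
  then show ?thesis
    using assms(2) by (simp add: mpow_of_real norm_mult norm_power)
qed

text \<open>Since the constant coefficient vanishes, the majorant tends to zero linearly in the radius.\<close>

lemma power_series_small:
  fixes p :: "'k::scalar ^ 'm::finite"
  assumes ps: "power_series_on p r f a" and r: "r > 0" and f: "f p = 0" and \<sigma>: "\<sigma> > 0"
  shows "eventually (\<lambda>\<rho>. expands \<rho> \<sigma> (\<lambda>z. f (p + z))) (at_right 0)"
proof -
  \<comment> \<open>The factor 2 puts the closed polydisc strictly inside the ball, whose radius
    bounds the sum of the coordinate norms.\<close>
  define \<rho>1 where "\<rho>1 = r / (2 * real CARD('m))"
  have \<rho>1: "\<rho>1 > 0" "real CARD('m) * \<rho>1 < r" using r by (auto simp: \<rho>1_def)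
  have s1: "(\<lambda>\<alpha>. norm (a \<alpha>) * \<rho>1 ^ sum \<alpha> UNIV) summable_on UNIV"
    using power_series_majorant[OF ps] \<rho>1 by simp
  define A where "A = (\<Sum>\<^sub>\<infinity>\<alpha>. norm (a \<alpha>) * \<rho>1 ^ sum \<alpha> UNIV)"
  have "A \<ge> 0" unfolding A_def using \<rho>1 by (intro infsum_nonneg) auto
  \<comment> \<open>At the centre all other monomials vanish, so the constant coefficient is the
    value of \<open>f\<close> there.\<close>
  have a0: "a (\<lambda>_. 0) = 0"
  proof -
    have "((\<lambda>\<alpha>. a \<alpha> * mpow (0 :: 'k ^ 'm) \<alpha>) has_sum 0) UNIV"
      using ps[unfolded power_series_on_def, rule_format, of p] r f by simp
    moreover have "a \<alpha> * mpow (0 :: 'k ^ 'm) \<alpha> = 0" if "\<alpha> \<noteq> (\<lambda>_. 0)" for \<alpha>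
      using that by (auto simp: mpow_def fun_eq_iff)
    then have "((\<lambda>\<alpha>. a \<alpha> * mpow (0 :: 'k ^ 'm) \<alpha>) has_sum 0) UNIV =
        ((\<lambda>\<alpha>. a \<alpha> * mpow (0 :: 'k ^ 'm) \<alpha>) has_sum 0) {\<lambda>_. 0}"
      by (intro has_sum_cong_neutral) auto
    ultimately have "((\<lambda>\<alpha>. a \<alpha> * mpow (0 :: 'k ^ 'm) \<alpha>) has_sum 0) {\<lambda>_. 0}"
      by simp
    moreover have "((\<lambda>\<alpha>. a \<alpha> * mpow (0 :: 'k ^ 'm) \<alpha>) has_sum a (\<lambda>_. 0)) {\<lambda>_. 0}"
      by (rule has_sum_finiteI) (auto simp: mpow_def)
    ultimately show ?thesis by (metis has_sum_unique)
  qed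
  \<comment> \<open>For a vanishing constant term the majorant at \<rho> is at most \<rho>/\<rho>1
    times \<open>A\<close>, and the second bound makes this at most \<sigma>; \<open>A + 1\<close>
    avoids a division by zero.\<close>
  define \<rho>0 where "\<rho>0 = min \<rho>1 (\<rho>1 * \<sigma> / (A + 1))"
  have "\<rho>0 > 0" using \<rho>1 \<sigma> \<open>A \<ge> 0\<close> by (simp add: \<rho>0_def)
  have "expands \<rho> \<sigma> (\<lambda>z. f (p + z))" if \<rho>: "0 < \<rho>" "\<rho> < \<rho>0" for \<rho>
  proof -
    have \<rho>_less: "\<rho> < \<rho>1" "\<rho> * (A + 1) < \<rho>1 * \<sigma>"
      using \<rho> \<open>A \<ge> 0\<close> by (auto simp: \<rho>0_def pos_less_divide_eq)
    have "real CARD('m) * \<rho> \<le> real CARD('m) * \<rho>1" using \<rho>_less by (intro mult_left_mono) auto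
    then have \<rho>r: "real CARD('m) * \<rho> < r" using \<rho>1 by linarith
    have le: "norm (a \<alpha>) * \<rho> ^ sum \<alpha> UNIV \<le> (\<rho> / \<rho>1) * (norm (a \<alpha>) * \<rho>1 ^ sum \<alpha> UNIV)" for \<alpha>
    proof (cases "\<alpha> = (\<lambda>_. 0)")
      case True
      then show ?thesis by (simp add: a0)
    next
      case False
      then have "sum \<alpha> UNIV \<noteq> 0" by (auto simp: fun_eq_iff)
      then obtain n where n: "sum \<alpha> UNIV = Suc n" by (cases "sum \<alpha> UNIV") auto
      have "\<rho> ^ Suc n \<le> (\<rho> / \<rho>1) * \<rho>1 ^ Suc n"
        using \<rho> \<rho>_less \<rho>1 by (auto intro!: mult_left_mono power_mono)
      then have "norm (a \<alpha>) * \<rho> ^ Suc n \<le> norm (a \<alpha>) * ((\<rho> / \<rho>1) * \<rho>1 ^ Suc n)"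
        by (intro mult_left_mono) auto
      then show ?thesis by (simp only: n mult_ac)
    qed
    have s: "(\<lambda>\<alpha>. norm (a \<alpha>) * \<rho> ^ sum \<alpha> UNIV) summable_on UNIV"
      using power_series_majorant[OF ps] \<rho> \<rho>r by simp
    have "(\<Sum>\<^sub>\<infinity>\<alpha>. norm (a \<alpha>) * \<rho> ^ sum \<alpha> UNIV) \<le> (\<Sum>\<^sub>\<infinity>\<alpha>. (\<rho> / \<rho>1) * (norm (a \<alpha>) * \<rho>1 ^ sum \<alpha> UNIV))"
      by (rule infsum_mono[OF s summable_on_cmult_right[OF s1] le])
    also have "\<dots> = (\<rho> / \<rho>1) * A" unfolding A_def by (rule infsum_cmult_right')
    also have "\<dots> \<le> \<sigma>"
      using \<rho> \<rho>_less \<rho>1 \<open>A \<ge> 0\<close> by (simp add: divide_simps algebra_simps)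
    finally have le\<sigma>: "(\<Sum>\<^sub>\<infinity>\<alpha>. norm (a \<alpha>) * \<rho> ^ sum \<alpha> UNIV) \<le> \<sigma>" .
    have "f (p + z) = (\<Sum>\<^sub>\<infinity>\<alpha>. a \<alpha> * mpow z \<alpha>)" if "z \<in> polydisc \<rho>" for z
      using ps[unfolded power_series_on_def, rule_format, OF polydisc_ball[OF that \<rho>r]]
      by (simp add: infsumI)
    then show ?thesis
      unfolding expands_def using s le\<sigma> by blast
  qed
  then show ?thesis
    using \<open>\<rho>0 > 0\<close> unfolding eventually_at_right_field by blast
qed

text \<open>
  Substituting power series whose majorants are at most \<open>\<sigma>\<close> into one whose majorant converges at
  \<open>(\<sigma>, \<dots>, \<sigma>)\<close> gives an absolutely convergent series of power series.
\<close>

lemma power_series_compose: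
  fixes F :: "'k::scalar ^ 'n::finite \<Rightarrow> 'k" and G :: "'k ^ 'm::finite \<Rightarrow> 'k ^ 'n"
  assumes F: "power_series_on (G p) R F b" "R > 0"
    and G: "\<And>c. \<exists>r>0. \<exists>a. power_series_on p r (\<lambda>x. G x $ c) a"
  shows "\<exists>r>0. \<exists>a. power_series_on p r (\<lambda>x. F (G x)) a"
proof -
  define \<sigma> where "\<sigma> = R / (2 * real CARD('n))"
  have \<sigma>: "\<sigma> > 0" "real CARD('n) * \<sigma> < R" using F(2) by (auto simp: \<sigma>_def)
  have "eventually (\<lambda>\<rho>. expands \<rho> \<sigma> (\<lambda>z. G (p + z) $ c - G p $ c)) (at_right 0)" for c
  proof -
    obtain r a where r: "r > 0" and a: "power_series_on p r (\<lambda>x. G x $ c) a" using G by blast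
    \<comment> \<open>Removing the constant term lets \<open>power_series_small\<close>
      apply.\<close>
    define a' where "a' \<alpha> = a \<alpha> - (if \<alpha> = (\<lambda>_. 0) then G p $ c else 0)" for \<alpha>
    have "power_series_on p r (\<lambda>x. G x $ c - G p $ c) a'"
      unfolding power_series_on_def
    proof
      fix x assume "x \<in> ball p r"
      then have 1: "((\<lambda>\<alpha>. a \<alpha> * mpow (x - p) \<alpha>) has_sum G x $ c) UNIV"
        using a by (simp add: power_series_on_def)
      have "((\<lambda>\<alpha>. (if \<alpha> = (\<lambda>_. 0) then G p $ c else 0) * mpow (x - p) \<alpha>) has_sum G p $ c) {\<lambda>_. 0}"
        by (rule has_sum_finiteI) (auto simp: mpow_def)
      then have "((\<lambda>\<alpha>. (if \<alpha> = (\<lambda>_. 0) then G p $ c else 0) * mpow (x - p) \<alpha>) has_sum G p $ c) UNIV"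
        by (rule has_sum_cong_neutral[THEN iffD1, rotated -1]) auto
      then have "((\<lambda>\<alpha>. - ((if \<alpha> = (\<lambda>_. 0) then G p $ c else 0) * mpow (x - p) \<alpha>)) has_sum - (G p $ c)) UNIV"
        by (simp add: has_sum_uminus)
      from has_sum_add[OF 1 this]
      show "((\<lambda>\<alpha>. a' \<alpha> * mpow (x - p) \<alpha>) has_sum (G x $ c - G p $ c)) UNIV"
        by (simp add: a'_def left_diff_distrib)
    qed
    from power_series_small[OF this r _ \<sigma>(1)] show ?thesis by simp
  qed
  \<comment> \<open>There are finitely many coordinates, so one radius serves all of them.\<close>
  then have "eventually (\<lambda>\<rho>. \<forall>c. expands \<rho> \<sigma> (\<lambda>z. G (p + z) $ c - G p $ c)) (at_right 0)"
    by (rule eventually_all_finite)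
  moreover have "eventually (\<lambda>\<rho>::real. \<rho> > 0) (at_right 0)"
    by (rule eventually_at_right_less)
  ultimately have "eventually (\<lambda>\<rho>. (\<forall>c. expands \<rho> \<sigma> (\<lambda>z. G (p + z) $ c - G p $ c)) \<and> \<rho> > 0) (at_right 0)"
    by (rule eventually_conj)
  from eventually_happens[OF this] obtain \<rho> where \<rho>: "\<rho> > 0" and ex: "\<And>c. expands \<rho> \<sigma> (\<lambda>z. G (p + z) $ c - G p $ c)"
    by auto
  have mono: "expands \<rho> (\<sigma> ^ sum \<beta> UNIV) (\<lambda>z. mpow (G (p + z) - G p) \<beta>)" for \<beta>
    unfolding mpow_def power_sum vector_minus_component by (intro expands_prod expands_power \<rho> ex)
  have "expands \<rho> (norm (b \<beta>) * \<sigma> ^ sum \<beta> UNIV) (\<lambda>z. b \<beta> * mpow (G (p + z) - G p) \<beta>)" for \<beta>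
    by (rule expands_mult[OF \<rho> expands_const[OF \<rho>] mono])
  from expands_infsum[OF \<rho> this power_series_majorant[OF F(1) less_imp_le[OF \<sigma>(1)] \<sigma>(2)]]
  obtain a where a: "(\<lambda>\<alpha>. norm (a \<alpha>) * \<rho> ^ sum \<alpha> UNIV) summable_on UNIV"
    "\<And>z. z \<in> polydisc \<rho> \<Longrightarrow> (\<Sum>\<^sub>\<infinity>\<beta>. b \<beta> * mpow (G (p + z) - G p) \<beta>) = (\<Sum>\<^sub>\<infinity>\<alpha>. a \<alpha> * mpow z \<alpha>)"
    unfolding expands_def by blast
  have "power_series_on p \<rho> (\<lambda>x. F (G x)) a"
    unfolding power_series_on_def
  proof
    fix x assume x: "x \<in> ball p \<rho>"
    define z where "z = x - p"
    have z: "z \<in> polydisc \<rho>"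
      using x Finite_Cartesian_Product.norm_nth_le[of z] by (auto simp: polydisc_def z_def dist_norm norm_minus_commute intro: order_trans less_imp_le)
    \<comment> \<open>A bound on the majorants also bounds the values, which keeps
      \<open>G x\<close> in the ball where \<open>F\<close> is expanded.\<close>
    have "G x - G p \<in> polydisc \<sigma>"
      using expands_bound[OF ex z] by (simp add: polydisc_def z_def)
    from polydisc_ball[OF this \<sigma>(2), of "G p"] have "G x \<in> ball (G p) R" by simp
    with F(1) have "((\<lambda>\<beta>. b \<beta> * mpow (G x - G p) \<beta>) has_sum F (G x)) UNIV"
      unfolding power_series_on_def by (rule bspec)
    then have "F (G x) = (\<Sum>\<^sub>\<infinity>\<beta>. b \<beta> * mpow (G x - G p) \<beta>)"
      by (rule infsumI[symmetric])
    also have "\<dots> = (\<Sum>\<^sub>\<infinity>\<alpha>. a \<alpha> * mpow z \<alpha>)"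
      using a(2)[OF z] by (simp add: z_def)
    finally have eq: "F (G x) = (\<Sum>\<^sub>\<infinity>\<alpha>. a \<alpha> * mpow z \<alpha>)" .
    show "((\<lambda>\<alpha>. a \<alpha> * mpow (x - p) \<alpha>) has_sum F (G x)) UNIV"
      unfolding eq z_def[symmetric] by (rule has_sum_infsum[OF mpow_term_summable(2)[OF a(1) z]])
  qed
  then show ?thesis using \<rho> by blast
qed

section \<open>Regular functions and charts\<close>

lemma analytic_fun_iff:
  "analytic_fun S f \<longleftrightarrow> smooth_fun S f \<and> (\<forall>p\<in>S. \<exists>r>0. \<exists>a. power_series_on p r f a)"
  unfolding analytic_fun_def power_series_on_def mpow_def vector_minus_component ..

lemma regular_C_k: "regular cat S f \<Longrightarrow> C_k n S f"
  by (cases cat) (auto simp: regular_def analytic_fun_def smooth_fun_def)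

lemma regular_subset: "regular cat S f \<Longrightarrow> T \<subseteq> S \<Longrightarrow> regular cat T f"
  by (cases cat) (auto simp: regular_def analytic_fun_def smooth_fun_def intro: C_k_subset)

lemma regular_compose:
  fixes F :: "'k::scalar ^ 'n::finite \<Rightarrow> 'k" and G :: "'k ^ 'm::finite \<Rightarrow> 'k ^ 'n"
  assumes S: "open S" and T: "open T" and GT: "G ` S \<subseteq> T"
    and F: "regular cat T F" and G: "\<And>c. regular cat S (\<lambda>x. G x $ c)"
  shows "regular cat S (\<lambda>x. F (G x))"
proof -
  have smooth: "smooth_fun S (\<lambda>x. F (G x))"
    unfolding smooth_fun_def
    using C_k_compose[OF S T GT regular_C_k[OF F] regular_C_k[OF G]] by blast
  show ?thesis
  proof (cases cat)
    case C_infinity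
    then show ?thesis using smooth by (simp add: regular_def)
  next
    case C_omega
    have "\<exists>r>0. \<exists>a. power_series_on p r (\<lambda>x. F (G x)) a" if p: "p \<in> S" for p
    proof -
      have "analytic_fun T F" "G p \<in> T"
        using F GT p by (auto simp: C_omega regular_def)
      then obtain R b where "power_series_on (G p) R F b" "R > 0"
        unfolding analytic_fun_iff by blast
      moreover have "\<exists>r>0. \<exists>a. power_series_on p r (\<lambda>x. G x $ c) a" for c
        using G[of c] p unfolding C_omega regular_def by (auto simp: analytic_fun_iff)
      ultimately show ?thesis by (rule power_series_compose)
    qed
    then show ?thesis
      using smooth C_omega by (simp add: regular_def analytic_fun_iff)
  qed
qed

lemma power_series_on_cong:
  assumes "power_series_on p r f a" "r > 0" "open S" "p \<in> S" "\<And>x. x \<in> S \<Longrightarrow> f x = g x"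
  shows "\<exists>r>0. \<exists>a. power_series_on p r g a"
proof -
  obtain e where e: "e > 0" "ball p e \<subseteq> S" using assms(3,4) open_contains_ball by blast
  have "power_series_on p (min r e) g a"
    unfolding power_series_on_def
  proof
    fix x assume x: "x \<in> ball p (min r e)"
    then have "f x = g x" using e by (intro assms(5)) auto
    moreover have "x \<in> ball p r" using x by simp
    ultimately show "((\<lambda>\<alpha>. a \<alpha> * mpow (x - p) \<alpha>) has_sum g x) UNIV"
      using assms(1) unfolding power_series_on_def by metis
  qed
  then show ?thesis using e assms(2) by (intro exI[of _ "min r e"]) auto
qed

text \<open>Both regularity classes are conditions near each point; in the analytic case it suffices
  to shrink the radius of convergence. This glues composites that can be written in charts only
  locally.\<close>

lemma regular_local:
  assumes "\<And>x. x \<in> S \<Longrightarrow> \<exists>T g. open T \<and> x \<in> T \<and> regular cat T g \<and> (\<forall>y\<in>T. f y = g y)"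
  shows "regular cat S f"
proof -
  have smooth: "smooth_fun S f"
    unfolding smooth_fun_def
  proof (intro allI C_k_local)
    fix n x assume "x \<in> S"
    then obtain T g where "open T" "x \<in> T" "regular cat T g" "\<forall>y\<in>T. f y = g y"
      using assms by blast
    then show "\<exists>T. open T \<and> x \<in> T \<and> C_k n T f"
      by (intro exI[of _ T]) (auto intro: C_k_congI regular_C_k)
  qed
  show ?thesis
  proof (cases cat)
    case C_infinity
    then show ?thesis using smooth by (simp add: regular_def)
  next
    case C_omega
    have "\<exists>r>0. \<exists>a. power_series_on x r f a" if x: "x \<in> S" for x
    proof -
      obtain T g where T: "open T" "x \<in> T" "regular cat T g" "\<And>y. y \<in> T \<Longrightarrow> g y = f y"
        using assms[OF x] by metis
      then obtain r a where "power_series_on x r g a" "r > 0"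
        unfolding C_omega regular_def by (auto simp: analytic_fun_iff)
      then show ?thesis by (rule power_series_on_cong[OF _ _ T(1,2,4)])
    qed
    then show ?thesis
      using smooth C_omega by (simp add: regular_def analytic_fun_iff)
  qed
qed

section \<open>Charts, coordinate derivatives and maps between manifolds\<close>

lemma manifold_open_dom: "manifold cat A \<Longrightarrow> C \<in> A \<Longrightarrow> open (dom C)"
  by (simp add: manifold_def)

lemma cinv_crd [simp]: "manifold cat A \<Longrightarrow> C \<in> A \<Longrightarrow> p \<in> dom C \<Longrightarrow> cinv C (crd C p) = p"
  by (auto simp: manifold_def homeomorphism_def)

lemma open_crd_image:
  assumes "manifold cat A" "C \<in> A" "open U"
  shows "open (crd C ` (U \<inter> dom C))"
proof -
  have h: "homeomorphism (dom C) (crd C ` dom C) (crd C) (cinv C)"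
    and o: "open (dom C)" "open (crd C ` dom C)"
    using assms by (auto simp: manifold_def)
  have "openin (top_of_set (dom C)) (U \<inter> dom C)"
    using assms(3) by (auto simp: openin_open)
  then have "openin (top_of_set (crd C ` dom C)) (crd C ` (U \<inter> dom C))"
    by (rule homeomorphism_imp_open_map[OF h])
  then show ?thesis using o(2) openin_open_eq by blast
qed

definition has_cd :: "('a, 'k::scalar, 'm::finite) chart \<Rightarrow> 'm \<Rightarrow> ('a \<Rightarrow> 'k) \<Rightarrow> 'k \<Rightarrow> 'a \<Rightarrow> bool" where
  "has_cd C i f d p \<longleftrightarrow> has_pd i (\<lambda>x. f (cinv C x)) d (crd C p)"

text \<open>A property of germs implied by both regularity classes, so that calculus at a point does
  not carry domains along. One neighbourhood serves all orders of differentiation.\<close>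

definition smooth_at :: "('a, 'k::scalar, 'm::finite) chart \<Rightarrow> 'a \<Rightarrow> ('a \<Rightarrow> 'k) \<Rightarrow> bool" where
  "smooth_at C p f \<longleftrightarrow> (\<exists>S. open S \<and> crd C p \<in> S \<and> (\<forall>n. C_k n S (\<lambda>x. f (cinv C x))))"

lemma cd_eqI: "has_cd C i f d p \<Longrightarrow> cd C i f p = d"
  unfolding has_cd_def cd_def by (rule pd_eqI)

lemma smooth_at_has_cd: "smooth_at C p f \<Longrightarrow> has_cd C i f (cd C i f p) p"
  unfolding smooth_at_def has_cd_def cd_def using C_k_has_pd by blast

lemma has_cd_const: "has_cd C i (\<lambda>_. c) 0 p"
  by (simp add: has_cd_def has_pd_const)

lemma has_cd_sum:
  "(\<And>c. c \<in> I \<Longrightarrow> has_cd C i (f c) (a c) p) \<Longrightarrow> has_cd C i (\<lambda>q. \<Sum>c\<in>I. f c q) (\<Sum>c\<in>I. a c) p"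
  unfolding has_cd_def by (rule has_pd_sum)

lemma has_cd_mult:
  assumes "manifold cat A" "C \<in> A" "p \<in> dom C" "has_cd C i f a p" "has_cd C i g b p"
  shows "has_cd C i (\<lambda>q. f q * g q) (a * g p + f p * b) p"
  using has_pd_mult[OF assms(4,5)[unfolded has_cd_def]] assms(1-3) by (simp add: has_cd_def)

lemma has_cd_cong:
  assumes "manifold cat A" "C \<in> A" "open U" "p \<in> U \<inter> dom C" "\<And>q. q \<in> U \<inter> dom C \<Longrightarrow> f q = g q"
  shows "has_cd C i f d p \<longleftrightarrow> has_cd C i g d p"
  unfolding has_cd_def
  by (rule has_pd_cong[OF open_crd_image[OF assms(1-3)]]) (use assms in auto)

lemma smooth_at_cd:
  assumes "manifold cat A" "C \<in> A" "p \<in> dom C" "smooth_at C p f"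
  shows "smooth_at C p (cd C i f)"
proof -
  obtain S where S: "open S" "crd C p \<in> S" "\<And>n. C_k n S (\<lambda>x. f (cinv C x))"
    using assms(4) unfolding smooth_at_def by blast
  \<comment> \<open>The field \<open>cd C i f\<close> is a partial derivative in coordinates only
    over the image of the chart, so the neighbourhood is cut down to it.\<close>
  define T where "T = S \<inter> crd C ` (UNIV \<inter> dom C)"
  have T: "open T" "crd C p \<in> T"
    using S assms open_crd_image[OF assms(1,2) open_UNIV] by (auto simp: T_def)
  have "C_k n T (\<lambda>x. cd C i f (cinv C x))" for n
  proof (rule C_k_congI[OF T(1)])
    have "C_k n S (pd i (\<lambda>x. f (cinv C x)))" using S(3)[of "Suc n"] by simp
    then show "C_k n T (pd i (\<lambda>x. f (cinv C x)))" by (rule C_k_subset) (simp add: T_def)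
    show "cd C i f (cinv C x) = pd i (\<lambda>x. f (cinv C x)) x" if "x \<in> T" for x
      using that assms(1,2) by (auto simp: T_def cd_def)
  qed
  then show ?thesis using T unfolding smooth_at_def by blast
qed

lemma cd_commute:
  assumes "manifold cat A" "C \<in> A" "p \<in> dom C" "smooth_at C p f"
  shows "cd C i (cd C j f) p = cd C j (cd C i f) p"
proof -
  obtain S where S: "open S" "crd C p \<in> S" "\<And>n. C_k n S (\<lambda>x. f (cinv C x))"
    using assms(4) unfolding smooth_at_def by blast
  have "cd C i (cd C j f) p = pd i (pd j (\<lambda>x. f (cinv C x))) (crd C p)" for i j
    unfolding cd_def[of C i]
    by (rule pd_cong[OF open_crd_image[OF assms(1,2) open_UNIV]]) (use assms in \<open>auto simp: cd_def\<close>)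
  then show ?thesis using pd_commute[OF S(1) S(3) S(2)] by simp
qed

lemma regular_on_smooth_at:
  assumes "manifold cat A" "C \<in> A" "regular_on cat A U f" "open U" "p \<in> U" "p \<in> dom C"
  shows "smooth_at C p f"
proof -
  have "regular cat (crd C ` (U \<inter> dom C)) (\<lambda>x. f (cinv C x))"
    using assms by (simp add: regular_on_def)
  then show ?thesis
    unfolding smooth_at_def using assms open_crd_image[OF assms(1,2,4)] regular_C_k by blast
qed

lemma regular_map_open_preimage:
  assumes "manifold cat A" "regular_map cat A B \<phi>" "open U" "open W" "U \<subseteq> carrier A"
  shows "open {p\<in>U. \<phi> p \<in> W}"
proof -
  have "continuous_on U \<phi>"
    using assms by (auto simp: regular_map_def intro: continuous_on_subset)
  then have "open (\<phi> -` W \<inter> U)"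
    using assms(3,4) by (simp add: continuous_on_open_vimage)
  moreover have "\<phi> -` W \<inter> U = {p\<in>U. \<phi> p \<in> W}" by auto
  ultimately show ?thesis by simp
qed

lemma open_chart_preimage:
  assumes "manifold cat A" "regular_map cat A B \<phi>" "C \<in> A" "open W"
  shows "open {p\<in>dom C. \<phi> p \<in> W}"
  using assms by (intro regular_map_open_preimage) (auto simp: carrier_def intro: manifold_open_dom)

lemma regular_map_smooth_at:
  assumes "manifold cat A" "manifold cat B" "regular_map cat A B \<phi>" "C \<in> A" "C' \<in> B"
    "p \<in> dom C" "\<phi> p \<in> dom C'"
  shows "smooth_at C p (\<lambda>q. crd C' (\<phi> q) $ a)"
proof -
  have "open (crd C ` ({p\<in>dom C. \<phi> p \<in> dom C'} \<inter> dom C))"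
    by (intro open_crd_image[OF assms(1,4)] open_chart_preimage[OF assms(1,3,4)] manifold_open_dom[OF assms(2,5)])
  then have "open (crd C ` {p\<in>dom C. \<phi> p \<in> dom C'})"
    by (simp add: Int_absorb2 Collect_restrict)
  moreover have "regular cat (crd C ` {p\<in>dom C. \<phi> p \<in> dom C'}) (\<lambda>x. crd C' (\<phi> (cinv C x)) $ a)"
    using assms by (simp add: regular_map_def)
  ultimately show ?thesis
    unfolding smooth_at_def using assms regular_C_k by blast
qed

lemma has_cd_compose:
  assumes "manifold cat A" "manifold cat B" "regular_map cat A B \<phi>" "C \<in> A" "C' \<in> B"
    "p \<in> dom C" "\<phi> p \<in> dom C'" "smooth_at C' (\<phi> p) f"
  shows "has_cd C i (\<lambda>q. f (\<phi> q)) (\<Sum>b\<in>UNIV. cd C' b f (\<phi> p) * dmap C C' \<phi> p $ b $ i) p"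
proof -
  obtain S where S: "open S" "crd C' (\<phi> p) \<in> S" "\<And>n. C_k n S (\<lambda>x. f (cinv C' x))"
    using assms(8) unfolding smooth_at_def by blast
  define G where "G x = crd C' (\<phi> (cinv C x))" for x
  have "has_pd i (\<lambda>x. G x $ b) (dmap C C' \<phi> p $ b $ i) (crd C p)" for b
    using smooth_at_has_cd[OF regular_map_smooth_at[OF assms(1-7)], of i b]
    by (simp add: has_cd_def G_def dmap_def)
  from has_pd_compose[of S "\<lambda>x. f (cinv C' x)" G "crd C p", OF S(1) S(3) _ this]
  have "has_pd i (\<lambda>x. f (cinv C' (G x))) (\<Sum>b\<in>UNIV. cd C' b f (\<phi> p) * dmap C C' \<phi> p $ b $ i) (crd C p)"
    using S(2) assms by (simp add: G_def cd_def)
  then have "has_cd C i (\<lambda>q. f (cinv C' (crd C' (\<phi> q)))) (\<Sum>b\<in>UNIV. cd C' b f (\<phi> p) * dmap C C' \<phi> p $ b $ i) p"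
    by (simp add: has_cd_def G_def)
  \<comment> \<open>Going through the target chart and back is the identity only where \<phi> lands
    in \<open>dom C'\<close>, an open condition that holds at \<open>p\<close>.\<close>
  then show ?thesis
    by (subst has_cd_cong[OF assms(1,4) open_chart_preimage[OF assms(1,3,4) manifold_open_dom[OF assms(2,5)]]])
       (use assms in auto)
qed

text \<open>Around each point, \<phi> stays in one chart of the target; there the function is a
  composite of coordinate expressions, and the pieces are glued by
  \<open>regular_local\<close>.\<close>

lemma regular_on_compose:
  assumes "manifold cat A" "manifold cat B" "regular_map cat A B \<phi>"
    "regular_on cat B V f" "open V" "V \<subseteq> carrier B"
  shows "regular_on cat A {p\<in>carrier A. \<phi> p \<in> V} (\<lambda>p. f (\<phi> p))"
  unfolding regular_on_def
proof (intro ballI regular_local)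
  fix C x assume C: "C \<in> A" and "x \<in> crd C ` ({p\<in>carrier A. \<phi> p \<in> V} \<inter> dom C)"
  then obtain p where p: "p \<in> dom C" "\<phi> p \<in> V" "x = crd C p" by auto
  obtain C' where C': "C' \<in> B" "\<phi> p \<in> dom C'"
    using p assms(6) by (auto simp: carrier_def)
  define W where "W = V \<inter> dom C'"
  have W: "open W" unfolding W_def using assms(2,5) C' by (intro open_Int manifold_open_dom)
  define T where "T = crd C ` ({p\<in>dom C. \<phi> p \<in> W} \<inter> dom C)"
  have T: "open T"
    unfolding T_def by (intro open_crd_image[OF assms(1) C] open_chart_preimage[OF assms(1,3) C W])
  have W': "open (crd C' ` W)" unfolding W_def by (rule open_crd_image[OF assms(2) C'(1) assms(5)])
  define G where "G y = crd C' (\<phi> (cinv C y))" for y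
  have "regular cat T (\<lambda>y. f (cinv C' (G y)))"
  proof (rule regular_compose[OF T W'])
    show "G ` T \<subseteq> crd C' ` W" using assms(1) C by (auto simp: T_def G_def)
    show "regular cat (crd C' ` W) (\<lambda>y. f (cinv C' y))"
      using assms(4) C' by (simp add: regular_on_def W_def)
    have "regular cat (crd C ` {p\<in>dom C. \<phi> p \<in> dom C'}) (\<lambda>y. G y $ c)" for c
      using assms(3) C C' by (simp add: regular_map_def G_def)
    then show "regular cat T (\<lambda>y. G y $ c)" for c
      by (rule regular_subset) (auto simp: T_def W_def)
  qed
  moreover have "f (\<phi> (cinv C y)) = f (cinv C' (G y))" if "y \<in> T" for y
    using that assms(1,2) C C' by (auto simp: T_def G_def W_def)
  moreover have "x \<in> T" using p C' by (auto simp: T_def W_def)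
  ultimately show "\<exists>T g. open T \<and> x \<in> T \<and> regular cat T g \<and> (\<forall>y\<in>T. f (\<phi> (cinv C y)) = g y)"
    using T by blast
qed

section \<open>Hermitian linear algebra\<close>

lemma matrix_minus_left: "(- A) ** B = - (A ** (B :: 'a::comm_ring_1 ^ _ ^ _))"
  by (simp add: vec_eq_iff matrix_matrix_mult_def sum_negf)

lemma matrix_minus_right: "A ** (- B) = - (A ** (B :: 'a::comm_ring_1 ^ _ ^ _))"
  by (simp add: vec_eq_iff matrix_matrix_mult_def sum_negf)

lemma matrix_diff_ldistrib: "A ** (B - C) = A ** B - A ** (C :: 'a::comm_ring_1 ^ _ ^ _)"
  by (simp add: vec_eq_iff matrix_matrix_mult_def sum_subtractf right_diff_distrib)

lemma matrix_diff_rdistrib: "(A - B) ** C = A ** C - B ** (C :: 'a::comm_ring_1 ^ _ ^ _)"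
  by (simp add: vec_eq_iff matrix_matrix_mult_def sum_subtractf left_diff_distrib)

lemma matrix_add_rdistrib: "(A + B) ** C = A ** C + B ** (C :: 'a::comm_ring_1 ^ _ ^ _)"
  by (simp add: vec_eq_iff matrix_matrix_mult_def sum.distrib distrib_right)

lemma transpose_add: "transpose (A + B) = transpose A + transpose (B :: 'a::comm_ring_1 ^ _ ^ _)"
  by (simp add: vec_eq_iff transpose_def)

lemma transpose_minus: "transpose (- A) = - transpose (A :: 'a::comm_ring_1 ^ _ ^ _)"
  by (simp add: vec_eq_iff transpose_def)

lemma transpose_diff: "transpose (A - B) = transpose A - transpose (B :: 'a::comm_ring_1 ^ _ ^ _)"
  by (simp add: vec_eq_iff transpose_def)

text \<open>Scalar factors are written as \<open>mat c ** A\<close>, so that they take part in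
  identities of the matrix ring.\<close>

lemma mat_mult_nth: "(mat c ** A) $ i $ j = c * (A :: 'a::comm_ring_1 ^ 'n ^ 'm::finite) $ i $ j"
proof -
  have "(\<Sum>k\<in>UNIV. (if i = k then c else 0) * A $ k $ j) = (\<Sum>k\<in>UNIV. if i = k then c * A $ k $ j else 0)"
    by (intro sum.cong) auto
  then show ?thesis by (simp add: matrix_matrix_mult_def mat_def)
qed

lemma matrix_mult_mat_left_commute:
  "A ** (mat c ** B) = mat c ** (A ** (B :: 'a::comm_ring_1 ^ 'n ^ 'm::finite))"
proof -
  have "(A ** (mat c ** B)) $ i $ j = (mat c ** (A ** B)) $ i $ j" for i j
    unfolding mat_mult_nth
    by (subst (1 2) matrix_matrix_mult_def) (simp add: mat_mult_nth sum_distrib_left mult_ac)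
  then show ?thesis by (simp add: vec_eq_iff)
qed

lemmas matrix_ring_simps =
  matrix_minus_left matrix_minus_right matrix_diff_ldistrib matrix_diff_rdistrib
  matrix_add_ldistrib matrix_add_rdistrib transpose_add transpose_minus transpose_diff
  matrix_transpose_mul matrix_mul_assoc

section \<open>Bilinear forms, inverse metrics and parity of the dimension\<close>

lemma bil_axis: "bil G (axis i 1) (axis j 1) = G $ i $ j"
proof -
  have "(\<Sum>b\<in>UNIV. G $ a $ b * axis i 1 $ a * axis j 1 $ b) = (if a = i then G $ a $ j else 0)" for a
  proof -
    have "(\<Sum>b\<in>UNIV. G $ a $ b * axis i 1 $ a * axis j 1 $ b) = (\<Sum>b\<in>UNIV. if b = j then G $ a $ j * axis i 1 $ a else 0)"
      by (intro sum.cong) (auto simp: axis_def)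
    then show ?thesis by (simp add: axis_def)
  qed
  then show ?thesis by (simp add: bil_def)
qed

lemma bil_matrix_vector: "bil G v w = (\<Sum>i\<in>UNIV. v $ i * (G *v w) $ i)"
  by (simp add: bil_def matrix_vector_mult_def sum_distrib_left mult_ac)

lemma bil_transpose: "bil (transpose G) v w = bil G w v"
  unfolding bil_def by (subst sum.swap) (simp add: transpose_def mult_ac)

lemma bil_mult_right: "bil G v (B *v w) = bil (G ** B) v w"
  by (simp add: bil_matrix_vector matrix_vector_mul_assoc)

lemma bil_mult_left: "bil G (A *v v) w = bil (transpose A ** G) v w"
  by (metis bil_transpose bil_mult_right matrix_transpose_mul transpose_transpose)

lemma bil_eq_iff: "G = H \<longleftrightarrow> (\<forall>v w. bil G v w = bil H v w)"
  by (metis (no_types) bil_axis vec_eq_iff)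

lemma matrix_inv_inverse:
  assumes "invertible (A :: 'a::semiring_1 ^ 'n ^ 'n)"
  shows matrix_inv_right: "A ** matrix_inv A = mat 1" and matrix_inv_left: "matrix_inv A ** A = mat 1"
proof -
  have "\<exists>B. A ** B = mat 1 \<and> B ** A = mat 1" using assms by (simp add: invertible_def)
  from someI_ex[OF this] show "A ** matrix_inv A = mat 1" "matrix_inv A ** A = mat 1"
    by (simp_all add: matrix_inv_def)
qed

lemma invertible_transpose:
  fixes A :: "'a::comm_ring_1 ^ 'n ^ 'n"
  assumes "invertible A"
  shows "invertible (transpose A)"
proof -
  obtain B where "A ** B = mat 1" "B ** A = mat 1" using assms unfolding invertible_def by blast
  then have "transpose A ** transpose B = mat 1" "transpose B ** transpose A = mat 1"
    by (simp_all flip: matrix_transpose_mul)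
  then show ?thesis unfolding invertible_def by blast
qed

lemma eq_uminus_imp_zero:
  fixes x :: "'a::field_char_0"
  assumes "x = - x"
  shows "x = 0"
proof -
  have "x + x = 0" using assms by (simp only: eq_neg_iff_add_eq_0)
  then have "2 * x = 0" by (simp only: mult_2)
  then show ?thesis by simp
qed

text \<open>Invariance and \<open>J ** J = - mat 1\<close> make \<open>J\<close> anti-self-adjoint,
  that is \<open>transpose J ** G = - (G ** J)\<close>. Multiplying by the inverse of
  \<open>G\<close> on both sides moves this relation to the inverse metric.\<close>

lemma matrix_inv_transform:
  fixes G :: "'a::field ^ 'n::finite ^ 'n"
  assumes "invertible G" "transpose J ** G ** J = G" "J ** J = - mat 1"
  shows "J ** matrix_inv G ** transpose J = matrix_inv G"
proof -
  define H where "H = matrix_inv G"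
  have H: "H ** G = mat 1" "G ** H = mat 1"
    using assms(1) by (simp_all add: H_def matrix_inv_left matrix_inv_right)
  have J': "transpose J ** transpose J = - mat 1"
    using arg_cong[OF assms(3), of transpose] by (simp add: matrix_transpose_mul transpose_minus)
  have "transpose J ** G = - (G ** J)"
    using arg_cong[OF assms(2), of "\<lambda>M. M ** J"] assms(3)
    by (simp add: matrix_minus_right flip: matrix_mul_assoc) (metis minus_minus)
  then have "H ** (transpose J ** G) ** H = H ** (- (G ** J)) ** H" by simp
  then have *: "H ** transpose J = - (J ** H)"
    using H by (simp add: matrix_minus_right matrix_minus_left matrix_mul_assoc)
       (simp add: H flip: matrix_mul_assoc)
  have "J ** H ** transpose J = J ** (- (J ** H))"
    using * by (simp flip: matrix_mul_assoc)
  also have "\<dots> = H"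
    using assms(3) by (simp add: matrix_minus_right matrix_mul_assoc matrix_minus_left)
  finally show ?thesis by (simp add: H_def)
qed

lemma matrix_inv_symmetric:
  fixes G :: "'a::field ^ 'n::finite ^ 'n"
  assumes "invertible G" "transpose G = G"
  shows "transpose (matrix_inv G) = matrix_inv G"
proof -
  have "transpose (matrix_inv G) ** G = mat 1"
    using arg_cong[OF matrix_inv_right[OF assms(1)], of transpose] assms(2)
    by (simp add: matrix_transpose_mul)
  then have "transpose (matrix_inv G) ** G ** matrix_inv G = matrix_inv G" by simp
  then show ?thesis
    using matrix_inv_right[OF assms(1)] by (simp flip: matrix_mul_assoc)
qed

lemma skew_nth: "transpose W = - W \<Longrightarrow> W $ j $ i = - (W :: 'a::ab_group_add ^ 'n ^ 'n) $ i $ j"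
  by (drule arg_cong[where f = "\<lambda>M. M $ i $ j"]) (simp add: transpose_def)

text \<open>A determinant is unchanged by transposition, but \<open>- W\<close> has determinant
  \<open>- det W\<close> in odd dimension.\<close>

lemma skew_invertible_even:
  fixes W :: "'a::field_char_0 ^ 'n::finite ^ 'n"
  assumes "invertible W" "transpose W = - W"
  shows "even CARD('n)"
proof (rule ccontr)
  assume odd: "odd CARD('n)"
  have "det (- mat 1 :: 'a ^ 'n ^ 'n) = (\<Prod>i\<in>(UNIV :: 'n set). - 1)"
    by (subst det_diagonal) (simp_all add: mat_def)
  then have "det (- W) = - det W"
    using det_mul[of "- mat 1" W] odd by (simp add: matrix_minus_left)
  then have "det W = - det W"
    using det_transpose[of W] assms(2) by simp
  then have "det W = 0" by (rule eq_uminus_imp_zero)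
  then show False using assms(1) by (simp add: invertible_det_nz)
qed

text \<open>\<open>transpose J ** G\<close> is the matrix of the Kaehler form, and
  anti-self-adjointness of \<open>J\<close> is exactly its skewness.\<close>

lemma hermitian_skew:
  fixes G J :: "'a::field ^ 'n::finite ^ 'n"
  assumes "transpose G = G" "transpose J ** G ** J = G" "J ** J = - mat 1"
  shows "transpose (transpose J ** G) = - (transpose J ** G)"
proof -
  have "G ** J = - (transpose J ** G)"
    using arg_cong[OF assms(2), of "\<lambda>M. M ** J"] assms(3)
    by (simp add: matrix_minus_right flip: matrix_mul_assoc)
  then show ?thesis using assms(1) by (simp add: matrix_transpose_mul)
qed

lemma hermitian_even_dim:
  fixes G J :: "'a::field_char_0 ^ 'n::finite ^ 'n"
  assumes "invertible G" "transpose G = G" "transpose J ** G ** J = G" "J ** J = - mat 1"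
  shows "even CARD('n)"
proof -
  have "J ** (- J) = mat 1" "(- J) ** J = mat 1"
    using assms(4) by (simp_all add: matrix_minus_left matrix_minus_right)
  then have "invertible J" unfolding invertible_def by blast
  then have "invertible (transpose J ** G)"
    using assms(1) by (intro invertible_mult) (simp_all add: invertible_transpose)
  then show ?thesis
    using hermitian_skew[OF assms(2-4)] by (rule skew_invertible_even)
qed

text \<open>In dimension two, skew forms are multiples of each other.\<close>

lemma anticommuting_skew_dim2:
  fixes G J E :: "'a::field_char_0 ^ 'n::finite ^ 'n"
  assumes card: "CARD('n) = 2"
    and G: "invertible G" "transpose G = G" and J: "transpose J ** G ** J = G" "J ** J = - mat 1"
    and EJ: "E ** J + J ** E = 0" and skew: "transpose (transpose E ** G) = - (transpose E ** G)"
  shows "E = 0"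
proof -
  define W V where "W = transpose J ** G" and "V = transpose E ** G"
  obtain u v :: 'n where uv: "u \<noteq> v" "UNIV = {u, v}"
    using card by (auto simp: card_2_iff)
  have "transpose W = - W" "transpose V = - V"
    using hermitian_skew[OF G(2) J] skew by (simp_all only: W_def V_def)
  note W = skew_nth[OF this(1)] and V = skew_nth[OF this(2)]
  have diag: "W $ i $ i = 0" "V $ i $ i = 0" for i
    by (rule eq_uminus_imp_zero, rule W, rule eq_uminus_imp_zero, rule V)
  have inv: "G ** matrix_inv G = mat 1" using matrix_inv_right[OF G(1)] .
  have "W \<noteq> 0"
  proof
    assume "W = 0"
    then have "transpose J ** (G ** matrix_inv G) = 0" by (simp add: W_def matrix_mul_assoc)
    then have "transpose J = 0" by (simp add: inv)
    then have "J = 0" by (simp add: vec_eq_iff transpose_def)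
    then have "(J ** J) $ u $ u = 0" by (simp add: matrix_matrix_mult_def)
    then show False by (simp add: J(2) mat_def)
  qed
  have all: "(\<forall>i. P i) \<longleftrightarrow> P u \<and> P v" for P
  proof -
    have "(\<forall>i. P i) \<longleftrightarrow> (\<forall>i\<in>{u, v}. P i)" unfolding uv(2)[symmetric] by simp
    then show ?thesis by simp
  qed
  have Wuv: "W $ u $ v \<noteq> 0"
    using \<open>W \<noteq> 0\<close> W[of u v] diag by (auto simp: vec_eq_iff all)
  \<comment> \<open>In dimension two a skew matrix has a single independent entry, so the ratio at
    (u, v) relates the whole matrices.\<close>
  define s where "s = V $ u $ v / W $ u $ v"
  have "V = mat s ** W"
    using Wuv W[of u v] V[of u v] by (simp add: vec_eq_iff all mat_mult_nth diag s_def)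
  then have "transpose E ** (G ** matrix_inv G) = mat s ** transpose J ** (G ** matrix_inv G)"
    by (simp add: W_def V_def matrix_mul_assoc)
  then have "transpose E = mat s ** transpose J" by (simp add: inv)
  then have "E = J ** mat s" by (metis matrix_transpose_mul transpose_mat transpose_transpose)
  also have "\<dots> = mat s ** J" using matrix_mult_mat_left_commute[of J s "mat 1"] by simp
  finally have E: "E = mat s ** J" .
  \<comment> \<open>A multiple of \<open>J\<close> commutes with \<open>J\<close>, so anticommuting
    leaves twice \<open>s\<close> times the square of \<open>J\<close>, which is invertible.\<close>
  have "mat s ** J ** J + mat s ** J ** J = 0"
    using EJ unfolding E matrix_mul_assoc[symmetric] matrix_mult_mat_left_commute .
  then have "mat s ** (J ** J) + mat s ** (J ** J) = 0" by (simp add: matrix_mul_assoc)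
  then have "- mat s + - mat s = (0 :: 'a ^ 'n ^ 'n)" by (simp add: J(2) matrix_minus_right)
  then have "(- mat s + - mat s :: 'a ^ 'n ^ 'n) $ u $ u = 0" by simp
  then have "- s + - s = 0" by (simp add: mat_def)
  then have "- s = - (- s)" by (simp only: eq_neg_iff_add_eq_0)
  then have "- s = 0" by (rule eq_uminus_imp_zero)
  then have "s = 0" by simp
  then show ?thesis by (simp add: E vec_eq_iff mat_mult_nth)
qed

text \<open>
  \<open>t X Y Z\<close> stands for \<open>g((D\<^sub>X J) Y, Z)\<close>. The hypothesis on \<open>\<Omega>\<close> says that its mixed components vanish.
  The sum \<open>S X Y Z = t X Y Z + t (J X) (J Y) Z\<close> then has vanishing cyclic sum; replacing \<open>Y, Z\<close> by
  \<open>J Y, J Z\<close> changes only the sign of \<open>S X Y Z\<close> in it.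
\<close>

lemma quasi_kaehler_algebra:
  fixes t :: "'v \<Rightarrow> 'v \<Rightarrow> 'v \<Rightarrow> 'a::field_char_0" and J :: "'v \<Rightarrow> 'v"
  assumes skew: "\<And>X Y Z. t X Z Y = - t X Y Z"
    and J: "\<And>X Y Z. t X (J Y) (J Z) = - t X Y Z"
    and JJ: "\<And>X Y Z. t (J (J X)) Y Z = - t X Y Z" "\<And>X Y Z. t X (J (J Y)) Z = - t X Y Z"
    and \<Omega>: "\<And>X Y Z. \<Omega> X Y Z = t X Y Z + t Y Z X + t Z X Y"
    and mixed: "\<And>X Y Z. 3 * \<Omega> X Y Z + \<Omega> (J X) (J Y) Z + \<Omega> (J X) Y (J Z) + \<Omega> X (J Y) (J Z) = 0"
  shows "t (J X) (J Y) Z = - t X Y Z"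
proof -
  \<comment> \<open>Put \<open>J Y\<close> for \<open>Y\<close> in the sign rule and cancel the
    double \<open>J\<close>: a single \<open>J\<close> slides between the last two slots.\<close>
  have move: "t X Y (J Z) = t X (J Y) Z" for X Y Z
    using J[of X "J Y" Z] JJ(2)[of X Y "J Z"] by simp
  define S where "S X Y Z = t X Y Z + t (J X) (J Y) Z" for X Y Z
  have cyc: "S X Y Z + S Y Z X + S Z X Y = 0" for X Y Z
  proof -
    have o: "\<Omega> (J X) (J Y) Z = t (J X) (J Y) Z + t (J Y) (J Z) X - t Z X Y"
      "\<Omega> (J X) Y (J Z) = t (J X) (J Y) Z - t Y Z X + t (J Z) (J X) Y"
      "\<Omega> X (J Y) (J Z) = - t X Y Z + t (J Y) (J Z) X + t (J Z) (J X) Y"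
      by (simp_all add: \<Omega> J JJ move)
    have "3 * \<Omega> X Y Z + \<Omega> (J X) (J Y) Z + \<Omega> (J X) Y (J Z) + \<Omega> X (J Y) (J Z) =
        2 * (S X Y Z + S Y Z X + S Z X Y)"
      unfolding o \<Omega>[of X Y Z] S_def by (simp add: algebra_simps)
    then have "2 * (S X Y Z + S Y Z X + S Z X Y) = 0"
      using mixed[of X Y Z] by simp
    then show ?thesis unfolding mult_eq_0_iff by simp
  qed
  have "S X (J Y) (J Z) = - S X Y Z"
    by (simp add: S_def J JJ move)
  moreover have "S (J Y) (J Z) X = S Y Z X"
    by (simp add: S_def JJ)
  moreover have "S (J Z) X (J Y) = S Z X Y"
    by (simp add: S_def JJ move)
  ultimately have "- S X Y Z + S Y Z X + S Z X Y = 0"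
    using cyc[of X "J Y" "J Z"] by simp
  moreover have "2 * S X Y Z = (S X Y Z + S Y Z X + S Z X Y) - (- S X Y Z + S Y Z X + S Z X Y)"
    by (simp add: algebra_simps)
  ultimately have "2 * S X Y Z = 0" unfolding cyc by simp
  then have "S X Y Z = 0" unfolding mult_eq_0_iff by simp
  then show ?thesis by (simp add: S_def eq_neg_iff_add_eq_0 add.commute)
qed

lemma trace_skew_zero:
  fixes b :: "'n::finite \<Rightarrow> 'n \<Rightarrow> 'a::field_char_0"
  assumes "\<And>i j. b i j = b j i" "transpose S = - S"
  shows "(\<Sum>i\<in>UNIV. \<Sum>j\<in>UNIV. S $ i $ j * b i j) = 0"
proof -
  note S = skew_nth[OF assms(2)]
  have "(\<Sum>i\<in>UNIV. \<Sum>j\<in>UNIV. S $ i $ j * b i j) = (\<Sum>i\<in>UNIV. \<Sum>j\<in>UNIV. S $ j $ i * b j i)"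
    by (rule sum.swap)
  also have "\<dots> = (\<Sum>i\<in>UNIV. \<Sum>j\<in>UNIV. - (S $ i $ j * b i j))"
    by (intro sum.cong refl) (metis S assms(1) mult_minus_left)
  finally show ?thesis
    unfolding sum_negf by (rule eq_uminus_imp_zero)
qed

lemma sum_swap3:
  "(\<Sum>a\<in>A. \<Sum>b\<in>B. \<Sum>c\<in>C. f a b c) = (\<Sum>b\<in>B. \<Sum>c\<in>C. \<Sum>a\<in>A. f a b c)"
  by (subst sum.swap, rule sum.cong[OF refl], rule sum.swap)

lemma sum_swap4:
  "(\<Sum>a\<in>A. \<Sum>b\<in>B. \<Sum>c\<in>C. \<Sum>d\<in>D. f a b c d) =
   (\<Sum>c\<in>C. \<Sum>d\<in>D. \<Sum>a\<in>A. \<Sum>b\<in>B. f a b c d)"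
  by (rule trans[OF sum.cong[OF refl sum_swap3] sum_swap3])

text \<open>With \<open>E\<close> for D J, the hypothesis is the quasi-Kaehler identity on
  coordinate vectors, \<open>l\<close> being the component of the result. Writing \<open>Q\<close>
  as \<open>J ** Q ** transpose J\<close> shifts both factors \<open>J\<close> onto
  \<open>E\<close>, which changes the sign of the contraction.\<close>

lemma trace_quasi_kaehler_zero:
  fixes E :: "'n::finite \<Rightarrow> 'a::field_char_0 ^ 'n ^ 'n"
  assumes E: "\<And>i l j. (\<Sum>a\<in>UNIV. \<Sum>b\<in>UNIV. J $ a $ i * J $ b $ j * E a $ l $ b) = - E i $ l $ j"
    and Q: "J ** Q ** transpose J = Q"
  shows "(\<Sum>i\<in>UNIV. \<Sum>j\<in>UNIV. Q $ i $ j * E i $ l $ j) = 0"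
proof -
  have Q': "Q $ a $ b = (\<Sum>j\<in>UNIV. \<Sum>i\<in>UNIV. J $ a $ i * Q $ i $ j * J $ b $ j)" for a b
    using arg_cong[OF Q, of "\<lambda>M. M $ a $ b"]
    by (simp add: matrix_matrix_mult_def transpose_def sum_distrib_right)
  have Q'': "Q $ a $ b * E a $ l $ b =
      (\<Sum>j\<in>UNIV. \<Sum>i\<in>UNIV. Q $ i $ j * (J $ a $ i * J $ b $ j * E a $ l $ b))" for a b
    by (subst Q') (simp add: sum_distrib_right sum_distrib_left mult_ac)
  have "(\<Sum>a\<in>UNIV. \<Sum>b\<in>UNIV. Q $ a $ b * E a $ l $ b) =
      (\<Sum>a\<in>UNIV. \<Sum>b\<in>UNIV. \<Sum>j\<in>UNIV. \<Sum>i\<in>UNIV. Q $ i $ j * (J $ a $ i * J $ b $ j * E a $ l $ b))"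
    by (intro sum.cong refl) (rule Q'')
  also have "\<dots> = (\<Sum>j\<in>UNIV. \<Sum>i\<in>UNIV. \<Sum>a\<in>UNIV. \<Sum>b\<in>UNIV. Q $ i $ j * (J $ a $ i * J $ b $ j * E a $ l $ b))"
    by (rule sum_swap4)
  also have "\<dots> = (\<Sum>i\<in>UNIV. \<Sum>j\<in>UNIV. \<Sum>a\<in>UNIV. \<Sum>b\<in>UNIV. Q $ i $ j * (J $ a $ i * J $ b $ j * E a $ l $ b))"
    by (rule sum.swap)
  also have "\<dots> = (\<Sum>i\<in>UNIV. \<Sum>j\<in>UNIV. - (Q $ i $ j * E i $ l $ j))"
    by (simp add: E flip: sum_distrib_left)
  finally show ?thesis
    unfolding sum_negf by (rule eq_uminus_imp_zero)
qed

section \<open>Trilinear forms over K and their complexified type components\<close>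

definition tri :: "'k::scalar ^ 'm::finite ^ 'm ^ 'm \<Rightarrow> 'k ^ 'm \<Rightarrow> 'k ^ 'm \<Rightarrow> 'k ^ 'm \<Rightarrow> 'k" where
  "tri \<Omega> X Y Z = (\<Sum>i\<in>UNIV. \<Sum>j\<in>UNIV. \<Sum>k\<in>UNIV. \<Omega> $ i $ j $ k * X $ i * Y $ j * Z $ k)"

definition cvec :: "'k::scalar ^ 'm \<Rightarrow> complex ^ 'm" where
  "cvec X = (\<chi> i. cplx (X $ i))"

lemma cplx_sum: "cplx (\<Sum>i\<in>I. f i) = (\<Sum>i\<in>I. cplx (f i))"
  by (induction I rule: infinite_finite_induct) (auto simp: cplx_add)

lemma cplx_eq_0_iff: "cplx x = 0 \<longleftrightarrow> x = 0"
  by (metis norm_cplx norm_eq_zero)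

lemma eval3_cvec: "eval3 \<Omega> (cvec X) (cvec Y) (cvec Z) = cplx (tri \<Omega> X Y Z)"
  by (simp add: eval3_def tri_def cvec_def cplx_sum cplx_mult)

lemma eval3_add:
  "eval3 \<Omega> (X + X') Y Z = eval3 \<Omega> X Y Z + eval3 \<Omega> X' Y Z"
  "eval3 \<Omega> X (Y + Y') Z = eval3 \<Omega> X Y Z + eval3 \<Omega> X Y' Z"
  "eval3 \<Omega> X Y (Z + Z') = eval3 \<Omega> X Y Z + eval3 \<Omega> X Y Z'"
  by (simp_all add: eval3_def algebra_simps sum.distrib)

lemma eval3_scale:
  "eval3 \<Omega> (c *s X) Y Z = c * eval3 \<Omega> X Y Z"
  "eval3 \<Omega> X (c *s Y) Z = c * eval3 \<Omega> X Y Z"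
  "eval3 \<Omega> X Y (c *s Z) = c * eval3 \<Omega> X Y Z"
  by (simp_all add: eval3_def sum_distrib_left mult_ac)

lemma type_proj_cvec:
  "type_proj J e (cvec X) = (1/2) *s (cvec X + (if e then - \<i> else \<i>) *s cvec (J *v X))"
proof -
  have "(\<chi> i j. cplx (J $ i $ j)) *v cvec X = cvec (J *v X)"
    by (simp add: vec_eq_iff matrix_vector_mult_def cvec_def cplx_sum cplx_mult)
  then show ?thesis by (simp add: type_proj_def Let_def vec_eq_iff)
qed

lemma eval3_expand:
  "eval3 \<Omega> ((1/2) *s (X + u *s X')) ((1/2) *s (Y + v *s Y')) ((1/2) *s (Z + w *s Z')) =
   (eval3 \<Omega> X Y Z + u * eval3 \<Omega> X' Y Z + v * eval3 \<Omega> X Y' Z + w * eval3 \<Omega> X Y Z' +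
    u * v * eval3 \<Omega> X' Y' Z + u * w * eval3 \<Omega> X' Y Z' + v * w * eval3 \<Omega> X Y' Z' +
    u * v * w * eval3 \<Omega> X' Y' Z') / 8"
  by (simp add: eval3_add eval3_scale algebra_simps add_divide_distrib)

text \<open>Each of the six mixed patterns contributes 1/8. Terms with an odd number of factors \<i>
  cancel between a pattern and its opposite. A pair of slots has equal types in two patterns (factor
  -1) and different types in four (factor 1), hence the coefficients 6/8 = 3/4 and 2/8 =
  1/4.\<close>

lemma mixed_component:
  "type_component J (1, 2) \<Omega> (cvec X) (cvec Y) (cvec Z) +
   type_component J (2, 1) \<Omega> (cvec X) (cvec Y) (cvec Z) =
   (3 * cplx (tri \<Omega> X Y Z) + cplx (tri \<Omega> (J *v X) (J *v Y) Z) +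
    cplx (tri \<Omega> (J *v X) Y (J *v Z)) + cplx (tri \<Omega> X (J *v Y) (J *v Z))) / 4"
proof -
  have 1: "{(e1, e2, e3). (1::nat, 2::nat) = (of_bool e1 + of_bool e2 + of_bool e3,
        of_bool (\<not> e1) + of_bool (\<not> e2) + of_bool (\<not> e3))} =
      {(True, False, False), (False, True, False), (False, False, True)}" (is "?L = ?R")
  proof (rule set_eqI)
    fix e :: "bool \<times> bool \<times> bool"
    obtain e1 e2 e3 where "e = (e1, e2, e3)" by (cases e)
    then show "e \<in> ?L \<longleftrightarrow> e \<in> ?R" by (cases e1; cases e2; cases e3) simp_all
  qed
  have 2: "{(e1, e2, e3). (2::nat, 1::nat) = (of_bool e1 + of_bool e2 + of_bool e3,
        of_bool (\<not> e1) + of_bool (\<not> e2) + of_bool (\<not> e3))} =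
      {(False, True, True), (True, False, True), (True, True, False)}" (is "?L = ?R")
  proof (rule set_eqI)
    fix e :: "bool \<times> bool \<times> bool"
    obtain e1 e2 e3 where "e = (e1, e2, e3)" by (cases e)
    then show "e \<in> ?L \<longleftrightarrow> e \<in> ?R" by (cases e1; cases e2; cases e3) simp_all
  qed
  have s: "(\<Sum>(e1, e2, e3)\<in>{(True, False, False), (False, True, False), (False, False, True)}. f e1 e2 e3) =
      f True False False + f False True False + f False False True"
    "(\<Sum>(e1, e2, e3)\<in>{(False, True, True), (True, False, True), (True, True, False)}. f e1 e2 e3) =
      f False True True + f True False True + f True True False" for f :: "bool \<Rightarrow> bool \<Rightarrow> bool \<Rightarrow> complex"
    by (simp_all add: add_ac)
  show ?thesis
    unfolding type_component_def 1 2 s type_proj_cvec eval3_expand eval3_cvec if_True if_False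
    by (simp add: field_simps)
qed

section \<open>Weyl connections and holomorphic maps in charts\<close>

lemma matrix_eqI: "(\<And>i j. A $ i $ j = B $ i $ j) \<Longrightarrow> A = (B :: 'a ^ 'n ^ 'm)"
  by (simp add: vec_eq_iff)

lemma matrix_vector_mult_minus: "(- A) *v x = - (A *v (x :: 'a::comm_ring_1 ^ 'n))"
  by (simp add: vec_eq_iff matrix_vector_mult_def sum_negf)

lemma kaehler_form_eq: "kaehler_form g J C q = transpose (J C q) ** g C q"
  by (rule matrix_eqI) (simp add: kaehler_form_def bil_mult_left bil_axis)

lemma has_cd_matrix_mult:
  fixes C :: "('a::{t2_space,second_countable_topology}, 'k::scalar, 'm::finite) chart"
    and F :: "'a \<Rightarrow> 'k ^ 'n::finite ^ 'l" and G :: "'a \<Rightarrow> 'k ^ 'r ^ 'n"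
  assumes "manifold cat A" "C \<in> A" "p \<in> dom C"
    and "\<And>k. has_cd C i (\<lambda>q. F q $ a $ k) (F' $ a $ k) p"
    and "\<And>k. has_cd C i (\<lambda>q. G q $ k $ b) (G' $ k $ b) p"
  shows "has_cd C i (\<lambda>q. (F q ** G q) $ a $ b) ((F' ** G p + F p ** G') $ a $ b) p"
proof -
  have "has_cd C i (\<lambda>q. \<Sum>k\<in>UNIV. F q $ a $ k * G q $ k $ b)
      (\<Sum>k\<in>UNIV. F' $ a $ k * G p $ k $ b + F p $ a $ k * G' $ k $ b) p"
    using assms by (intro has_cd_sum has_cd_mult) auto
  then show ?thesis by (simp add: matrix_matrix_mult_def sum.distrib)
qed

section \<open>An almost Hermitian manifold at one point, in one chart and one local metric\<close>

locale hermitian_chart =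
  fixes cat :: regularity
    and A :: "('a::{t2_space,second_countable_topology}, 'k::scalar, 'm::finite) chart set"
    and c :: "('a, 'k, 'm) cstruct" and J :: "('a, 'k, 'm) field2"
    and U :: "'a set" and g :: "('a, 'k, 'm) field2"
    and C :: "('a, 'k, 'm) chart" and p :: 'a
  assumes herm: "almost_hermitian cat A c J"
    and Ug: "(U, g) \<in> c" and C: "C \<in> A" and pU: "p \<in> U" and pC: "p \<in> dom C"
begin

lemma man: "manifold cat A"
  using herm by (simp add: almost_hermitian_def)

lemma metric: "local_metric cat A U g"
  using herm Ug by (auto simp: almost_hermitian_def conformal_structure_def)

lemma open_U: "open U"
  using metric by (simp add: local_metric_def)

lemma J_square: "q \<in> dom C \<Longrightarrow> J C q ** J C q = - mat 1"
  using herm C by (simp add: almost_hermitian_def almost_complex_def)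

lemma g_props:
  assumes "q \<in> U \<inter> dom C"
  shows g_sym: "transpose (g C q) = g C q" and g_inv: "invertible (g C q)"
    and g_J: "transpose (J C q) ** g C q ** J C q = g C q"
proof -
  show "transpose (g C q) = g C q" "invertible (g C q)"
    using metric C assms by (auto simp: local_metric_def)
  have "bil (g C q) (J C q *v X) (J C q *v Y) = bil (g C q) X Y" for X Y
    using herm Ug C assms unfolding almost_hermitian_def by blast
  then show "transpose (J C q) ** g C q ** J C q = g C q"
    by (simp add: bil_eq_iff bil_mult_left bil_mult_right matrix_mul_assoc)
qed

lemma p_mem: "p \<in> U \<inter> dom C"
  using pU pC by simp

lemma even_dim: "even CARD('m)"
  using hermitian_even_dim[OF g_inv[OF p_mem] g_sym[OF p_mem] g_J[OF p_mem] J_square[OF pC]] .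

lemma smooth_g: "smooth_at C p (\<lambda>q. g C q $ i $ j)"
proof (rule regular_on_smooth_at[OF man C])
  show "regular_on cat A (U \<inter> dom C) (\<lambda>q. g C q $ i $ j)"
    using metric C by (simp add: local_metric_def covariant2_def)
  show "open (U \<inter> dom C)" by (intro open_Int open_U manifold_open_dom[OF man C])
qed (use pU pC in auto)

lemma smooth_J: "smooth_at C p (\<lambda>q. J C q $ i $ j)"
proof (rule regular_on_smooth_at[OF man C])
  show "regular_on cat A (dom C) (\<lambda>q. J C q $ i $ j)"
    using herm C by (simp add: almost_hermitian_def almost_complex_def endo_field_def)
  show "open (dom C)" by (rule manifold_open_dom[OF man C])
qed (use pC in auto)

abbreviation "G \<equiv> g C p"
abbreviation "K \<equiv> J C p"
abbreviation "W \<equiv> transpose K ** G"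

definition dJ :: "'m \<Rightarrow> 'k ^ 'm ^ 'm" where "dJ i = (\<chi> k j. cd C i (\<lambda>q. J C q $ k $ j) p)"
definition dG :: "'m \<Rightarrow> 'k ^ 'm ^ 'm" where "dG i = (\<chi> k j. cd C i (\<lambda>q. g C q $ k $ j) p)"
definition d\<omega> :: "'m \<Rightarrow> 'k ^ 'm ^ 'm" where "d\<omega> i = (\<chi> k j. cd C i (\<lambda>q. kaehler_form g J C q $ k $ j) p)"

lemma has_cd_J: "has_cd C i (\<lambda>q. J C q $ k $ j) (dJ i $ k $ j) p"
  using smooth_at_has_cd[OF smooth_J] by (simp add: dJ_def)

lemma has_cd_g: "has_cd C i (\<lambda>q. g C q $ k $ j) (dG i $ k $ j) p"
  using smooth_at_has_cd[OF smooth_g] by (simp add: dG_def)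

text \<open>Differentiate \<open>J ** J = - mat 1\<close>.\<close>

lemma dJ_anticommute: "dJ i ** K + K ** dJ i = 0"
proof (rule matrix_eqI)
  fix k j
  have "has_cd C i (\<lambda>q. (J C q ** J C q) $ k $ j) ((dJ i ** K + K ** dJ i) $ k $ j) p"
    by (intro has_cd_matrix_mult[OF man C pC] has_cd_J)
  then have "has_cd C i (\<lambda>q. (- mat 1 :: 'k ^ 'm ^ 'm) $ k $ j) ((dJ i ** K + K ** dJ i) $ k $ j) p"
    by (subst has_cd_cong[OF man C manifold_open_dom[OF man C]]) (use pC J_square in auto)
  from cd_eqI[OF this] show "(dJ i ** K + K ** dJ i) $ k $ j = 0 $ k $ j"
    unfolding cd_eqI[OF has_cd_const] by simp
qed

lemma d\<omega>_eq: "d\<omega> i = transpose (dJ i) ** G + transpose K ** dG i"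
proof (rule matrix_eqI)
  fix k j
  have "has_cd C i (\<lambda>q. (transpose (J C q) ** g C q) $ k $ j) ((transpose (dJ i) ** G + transpose K ** dG i) $ k $ j) p"
    by (intro has_cd_matrix_mult[OF man C pC] has_cd_g) (simp add: transpose_def has_cd_J)
  from cd_eqI[OF this] show "d\<omega> i $ k $ j = (transpose (dJ i) ** G + transpose K ** dG i) $ k $ j"
    by (simp add: d\<omega>_def kaehler_form_eq)
qed

lemma W_skew: "transpose W = - W"
  by (rule hermitian_skew[OF g_sym[OF p_mem] g_J[OF p_mem] J_square[OF pC]])

lemma d\<omega>_skew: "transpose (d\<omega> i) = - d\<omega> i"
proof (rule matrix_eqI)
  fix k j
  have h: "has_cd C i (\<lambda>q. kaehler_form g J C q $ k $ j) (d\<omega> i $ k $ j) p" for k j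
    unfolding d\<omega>_eq kaehler_form_eq
    by (intro has_cd_matrix_mult[OF man C pC] has_cd_g) (simp add: transpose_def has_cd_J)
  have "has_cd C i (\<lambda>q. (- 1) * kaehler_form g J C q $ k $ j) (0 * kaehler_form g J C p $ k $ j + (- 1) * d\<omega> i $ k $ j) p"
    by (intro has_cd_mult[OF man C pC] has_cd_const h)
  then have "has_cd C i (\<lambda>q. kaehler_form g J C q $ j $ k) (- d\<omega> i $ k $ j) p"
  proof (subst has_cd_cong[OF man C open_U p_mem])
    fix q assume "q \<in> U \<inter> dom C"
    then have "transpose (kaehler_form g J C q) = - kaehler_form g J C q"
      unfolding kaehler_form_eq by (intro hermitian_skew g_sym g_J J_square) auto
    from skew_nth[OF this, of j k]
    show "kaehler_form g J C q $ j $ k = (- 1) * kaehler_form g J C q $ k $ j" by simp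
  qed simp
  from cd_eqI[OF this] cd_eqI[OF h] show "transpose (d\<omega> i) $ k $ j = (- d\<omega> i) $ k $ j"
    by (simp add: transpose_def)
qed

text \<open>The connection matrix in the direction of coordinate \<open>i\<close>. With it, the
  covariant derivative of J is the plain derivative plus a commutator, see
  \<open>DJ_eq\<close>.\<close>

definition chr :: "('a, 'k, 'm) field3 \<Rightarrow> 'm \<Rightarrow> 'k ^ 'm ^ 'm" where
  "chr D i = (\<chi> k j. D C p $ k $ i $ j)"
definition DJ :: "('a, 'k, 'm) field3 \<Rightarrow> 'm \<Rightarrow> 'k ^ 'm ^ 'm" where
  "DJ D i = (\<chi> k j. cov_endo D J C p i k j)"

lemma DJ_eq: "DJ D i = dJ i + chr D i ** K - K ** chr D i"
  by (rule matrix_eqI) (simp add: DJ_def chr_def dJ_def cov_endo_def matrix_matrix_mult_def mult.commute)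

lemma DJ_anticommute: "DJ D i ** K + K ** DJ D i = 0"
proof -
  have "DJ D i ** K + K ** DJ D i = (dJ i ** K + K ** dJ i) + chr D i ** (K ** K) - K ** K ** chr D i"
    unfolding DJ_eq by (simp add: matrix_ring_simps algebra_simps)
  then show ?thesis
    by (simp add: dJ_anticommute J_square[OF pC] matrix_minus_left matrix_minus_right)
qed

lemma dG_eq:
  assumes "weyl_form cat A D U g \<alpha>"
  shows "dG i = transpose (chr D i) ** G + G ** chr D i - mat (2 * \<alpha> C p $ i) ** G"
proof (rule matrix_eqI)
  fix j k
  have "cov_metric D g C p i j k = - 2 * \<alpha> C p $ i * g C p $ j $ k"
    using assms C p_mem by (simp add: weyl_form_def)
  then have "cd C i (\<lambda>q. g C q $ j $ k) p = - 2 * \<alpha> C p $ i * g C p $ j $ k +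
     (\<Sum>l\<in>UNIV. D C p $ l $ i $ j * g C p $ l $ k) + (\<Sum>l\<in>UNIV. D C p $ l $ i $ k * g C p $ j $ l)"
    by (simp add: cov_metric_def algebra_simps)
  then show "dG i $ j $ k = (transpose (chr D i) ** G + G ** chr D i - mat (2 * \<alpha> C p $ i) ** G) $ j $ k"
    by (simp add: mat_mult_nth, simp add: dG_def chr_def matrix_matrix_mult_def transpose_def mult.commute)
qed

text \<open>Differentiating \<omega> = g(J., .) and using D g = -2 \<alpha> g gives (D_i + 2
  \<alpha>_i) \<omega> = g((D_i J)., .). The connection terms of D_i stand on the right.\<close>

lemma d\<omega>_weyl:
  assumes "weyl_form cat A D U g \<alpha>"
  shows "d\<omega> i + mat (2 * \<alpha> C p $ i) ** W =
    transpose (DJ D i) ** G + transpose (chr D i) ** W + W ** chr D i"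
proof -
  have "transpose K ** (mat (2 * \<alpha> C p $ i) ** G) = mat (2 * \<alpha> C p $ i) ** W"
    by (rule matrix_mult_mat_left_commute)
  then show ?thesis
    unfolding d\<omega>_eq DJ_eq dG_eq[OF assms]
    by (simp add: matrix_ring_simps algebra_simps)
qed

text \<open>By \<open>d\<omega>_weyl\<close> this form is a weighted covariant derivative of the
  skew form \<omega>.\<close>

lemma DJ_skew:
  assumes "weyl_form cat A D U g \<alpha>"
  shows "transpose (transpose (DJ D i) ** G) = - (transpose (DJ D i) ** G)"
proof -
  have T: "transpose (DJ D i) ** G =
      d\<omega> i + mat (2 * \<alpha> C p $ i) ** W - transpose (chr D i) ** W - W ** chr D i"
    using d\<omega>_weyl[OF assms, of i] by (simp add: algebra_simps)
  have m: "mat (2 * \<alpha> C p $ i) ** W = W ** mat (2 * \<alpha> C p $ i)"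
    using matrix_mult_mat_left_commute[of W "2 * \<alpha> C p $ i" "mat 1"] by simp
  show ?thesis
    unfolding T transpose_add transpose_diff matrix_transpose_mul[of _ "transpose K ** G"]
      matrix_transpose_mul[of "transpose K ** G"] W_skew d\<omega>_skew
    by (simp add: m matrix_minus_left matrix_minus_right)
qed

lemma DJ_zero_dim2:
  assumes "weyl_form cat A D U g \<alpha>" "CARD('m) = 2"
  shows "DJ D i = 0"
  by (rule anticommuting_skew_dim2[OF assms(2) g_inv[OF p_mem] g_sym[OF p_mem] g_J[OF p_mem]
        J_square[OF pC] DJ_anticommute DJ_skew[OF assms(1)]])

text \<open>The dimension is even, so it is two or at least four. In the first case D J itself
  vanishes, in the second the trace condition belongs to the choice of D. Later arguments use only
  this conclusion and need no case distinction.\<close>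

lemma trace_DJ_zero:
  assumes "CARD('m) \<ge> 4 \<Longrightarrow> hermitian_weyl_connection cat A c J D"
    and "CARD('m) = 2 \<Longrightarrow> weyl_connection cat A c D"
  shows "weyl_connection cat A c D" "mtrace G (\<lambda>i j. DJ D i $ k $ j) = 0"
proof -
  have dim: "CARD('m) = 2 \<or> CARD('m) \<ge> 4"
  proof -
    have "CARD('m) \<noteq> 0" "CARD('m) \<noteq> 1" "CARD('m) \<noteq> 3" using even_dim by auto
    then show ?thesis by linarith
  qed
  then show w: "weyl_connection cat A c D"
    using assms by (auto simp: hermitian_weyl_connection_def)
  show "mtrace G (\<lambda>i j. DJ D i $ k $ j) = 0"
    using dim
  proof
    assume 2: "CARD('m) = 2"
    obtain \<alpha> where "weyl_form cat A D U g \<alpha>"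
      using w Ug unfolding weyl_connection_def by blast
    then show ?thesis by (simp add: DJ_zero_dim2[OF _ 2] mtrace_def)
  next
    assume "CARD('m) \<ge> 4"
    then have "hermitian_weyl_connection cat A c J D" by (rule assms(1))
    then have "mtrace G (\<lambda>i j. cov_endo D J C p i k j) = 0"
      using Ug C p_mem unfolding hermitian_weyl_connection_def by blast
    then show ?thesis by (simp add: DJ_def)
  qed
qed

text \<open>The connection terms are values \<omega>(D_i \<partial>_j, \<partial>_k), abbreviated
  \<open>s i j k\<close>. Zero torsion makes \<open>s\<close> symmetric in \<open>i\<close> and
  \<open>j\<close>, and the six terms of the cyclic sum cancel in pairs.\<close>

lemma dD_omega_eq:
  assumes \<alpha>: "weyl_form cat A D U g \<alpha>" and tf: "torsion_free A D"
  shows "dD_omega g J \<alpha> C p $ i $ j $ k =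
    (transpose (DJ D i) ** G) $ j $ k + (transpose (DJ D j) ** G) $ k $ i + (transpose (DJ D k) ** G) $ i $ j"
proof -
  define s where "s i j k = (\<Sum>l\<in>UNIV. chr D i $ l $ j * W $ l $ k)" for i j k
  have s_sym: "s i j k = s j i k" for i j k
    using tf C pC by (simp add: s_def chr_def torsion_free_def)
  have s2: "(W ** chr D i) $ j $ k = - s i k j" for i j k
    by (simp add: s_def matrix_matrix_mult_def[of W] skew_nth[OF W_skew, of j] sum_negf mult.commute)
  have s1: "(transpose (chr D i) ** W) $ j $ k = s i j k" for i j k
    by (simp add: s_def matrix_matrix_mult_def[of _ W] transpose_def[of "chr D i"])
  have *: "d\<omega> i $ j $ k + 2 * (\<alpha> C p $ i * W $ j $ k) = (transpose (DJ D i) ** G) $ j $ k + s i j k - s i k j" for i j k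
    using arg_cong[OF d\<omega>_weyl[OF \<alpha>, of i], of "\<lambda>M. M $ j $ k"] by (simp add: mat_mult_nth s1 s2 mult.assoc)
  have "dD_omega g J \<alpha> C p $ i $ j $ k = (d\<omega> i $ j $ k + 2 * (\<alpha> C p $ i * W $ j $ k)) +
      (d\<omega> j $ k $ i + 2 * (\<alpha> C p $ j * W $ k $ i)) + (d\<omega> k $ i $ j + 2 * (\<alpha> C p $ k * W $ i $ j))"
    unfolding dD_omega_def Let_def by (simp add: d\<omega>_def distrib_left add_ac) (simp add: kaehler_form_eq)
  also have "\<dots> = (transpose (DJ D i) ** G) $ j $ k + (transpose (DJ D j) ** G) $ k $ i + (transpose (DJ D k) ** G) $ i $ j"
    unfolding * using s_sym[of j i k] s_sym[of k j i] s_sym[of k i j] by simp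
  finally show ?thesis .
qed

text \<open>\<open>quasi_kaehler_algebra\<close> gives the identity after lowering the index with g;
  nondegeneracy of g then removes the third vector.\<close>

lemma quasi_kaehler:
  assumes \<alpha>: "weyl_form cat A D U g \<alpha>" and tf: "torsion_free A D" and mixed: "dD_omega_mixed_zero cat A c J D"
  shows "(\<Sum>a\<in>UNIV. \<Sum>b\<in>UNIV. K $ a $ i * K $ b $ j * DJ D a $ l $ b) = - DJ D i $ l $ j"
proof -
  define T where "T i = transpose (DJ D i) ** G" for i
  define t where "t X Y Z = (\<Sum>i\<in>UNIV. X $ i * bil (T i) Y Z)" for X Y Z :: "'k ^ 'm"
  define \<Omega> where "\<Omega> = dD_omega g J \<alpha> C p"
  have bil_minus: "bil (- M) Y Z = - bil M Y Z" "bil M (- Y) Z = - bil M Y Z" for M :: "'k ^ 'm ^ 'm" and Y Z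
    by (simp_all add: bil_def sum_negf)
  have KK: "K *v (K *v X) = - X" for X
    by (simp add: matrix_vector_mul_assoc J_square[OF pC] matrix_vector_mult_minus)
  \<comment> \<open>D J anticommutes with J and g is J-invariant: the first gives the sign, the
    second removes the remaining pair.\<close>
  have TJ: "transpose K ** T i ** K = - T i" for i
  proof -
    have "DJ D i ** K = - (K ** DJ D i)"
      using DJ_anticommute[of D i] by (simp only: eq_neg_iff_add_eq_0)
    then have "transpose K ** transpose (DJ D i) = - (transpose (DJ D i) ** transpose K)"
      by (simp flip: matrix_transpose_mul transpose_minus)
    then have "transpose K ** T i ** K = - (transpose (DJ D i) ** (transpose K ** G ** K))"
      by (simp add: T_def matrix_mul_assoc matrix_minus_left)
    then show ?thesis by (simp add: g_J[OF p_mem] T_def)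
  qed
  have "t (K *v X) (K *v Y) Z = - t X Y Z" for X Y Z
  proof (rule quasi_kaehler_algebra[where t = t and J = "(*v) K" and \<Omega> = "tri \<Omega>"])
    fix X Y Z :: "'k ^ 'm"
    have "bil (T i) Z Y = - bil (T i) Y Z" for i
      using bil_transpose[of "T i" Y Z] DJ_skew[OF \<alpha>, of i] by (simp add: T_def bil_minus)
    then show "t X Z Y = - t X Y Z" by (simp add: t_def sum_negf)
    show "t X (K *v Y) (K *v Z) = - t X Y Z"
      by (simp add: t_def bil_mult_left bil_mult_right matrix_mul_assoc TJ bil_minus sum_negf)
    show "t (K *v (K *v X)) Y Z = - t X Y Z" "t X (K *v (K *v Y)) Z = - t X Y Z"
      by (simp_all add: KK t_def bil_minus sum_negf)
    have "tri \<Omega> X Y Z = (\<Sum>i\<in>UNIV. \<Sum>j\<in>UNIV. \<Sum>k\<in>UNIV. T i $ j $ k * X $ i * Y $ j * Z $ k) +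
        (\<Sum>i\<in>UNIV. \<Sum>j\<in>UNIV. \<Sum>k\<in>UNIV. T j $ k $ i * X $ i * Y $ j * Z $ k) +
        (\<Sum>i\<in>UNIV. \<Sum>j\<in>UNIV. \<Sum>k\<in>UNIV. T k $ i $ j * X $ i * Y $ j * Z $ k)"
      by (simp add: tri_def \<Omega>_def dD_omega_eq[OF \<alpha> tf] T_def sum.distrib distrib_right)
    also have "(\<Sum>i\<in>UNIV. \<Sum>j\<in>UNIV. \<Sum>k\<in>UNIV. T i $ j $ k * X $ i * Y $ j * Z $ k) = t X Y Z"
      by (simp add: t_def bil_def sum_distrib_left mult_ac)
    also have "(\<Sum>i\<in>UNIV. \<Sum>j\<in>UNIV. \<Sum>k\<in>UNIV. T j $ k $ i * X $ i * Y $ j * Z $ k) = t Y Z X"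
      by (subst sum_swap3) (simp add: t_def bil_def sum_distrib_left mult_ac)
    also have "(\<Sum>i\<in>UNIV. \<Sum>j\<in>UNIV. \<Sum>k\<in>UNIV. T k $ i $ j * X $ i * Y $ j * Z $ k) = t Z X Y"
      by (subst sum_swap3, subst sum_swap3) (simp add: t_def bil_def sum_distrib_left mult_ac)
    finally show "tri \<Omega> X Y Z = t X Y Z + t Y Z X + t Z X Y" .
    \<comment> \<open>Evaluating on vectors with entries from K, together with the injectivity of
      \<open>cplx\<close>, brings the complexified hypothesis back to an identity over K.\<close>
    have "type_component K (1, 2) \<Omega> (cvec X) (cvec Y) (cvec Z) + type_component K (2, 1) \<Omega> (cvec X) (cvec Y) (cvec Z) = 0"
      using mixed Ug \<alpha> C p_mem unfolding dD_omega_mixed_zero_def \<Omega>_def by blast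
    then have "3 * cplx (tri \<Omega> X Y Z) + cplx (tri \<Omega> (K *v X) (K *v Y) Z) +
        cplx (tri \<Omega> (K *v X) Y (K *v Z)) + cplx (tri \<Omega> X (K *v Y) (K *v Z)) = 0"
      unfolding mixed_component by simp
    moreover have "cplx (3 * x) = 3 * cplx x" for x :: 'k
      using cplx_scaleR[of 3 x] by (simp add: scaleR_conv_of_real)
    ultimately have "cplx (3 * tri \<Omega> X Y Z + tri \<Omega> (K *v X) (K *v Y) Z +
        tri \<Omega> (K *v X) Y (K *v Z) + tri \<Omega> X (K *v Y) (K *v Z)) = 0"
      by (simp add: cplx_add)
    then show "3 * tri \<Omega> X Y Z + tri \<Omega> (K *v X) (K *v Y) Z +
        tri \<Omega> (K *v X) Y (K *v Z) + tri \<Omega> X (K *v Y) (K *v Z) = 0"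
      by (simp only: cplx_eq_0_iff)
  qed
  note t = this
  \<comment> \<open>Column \<open>j\<close> of \<open>F\<close> is (D_X J)(J \<partial>_j) for X = J
    \<partial>_i. Comparing \<open>transpose F ** G\<close> with \<open>- T i\<close> and cancelling
    \<open>G\<close> yields the claim.\<close>
  define F where "F = (\<chi> l j. \<Sum>a\<in>UNIV. K $ a $ i * (DJ D a ** K) $ l $ j)"
  have "(transpose F ** G) $ j $ k = (- T i) $ j $ k" for j k
  proof -
    have ax: "(\<Sum>a\<in>UNIV. axis i 1 $ a * f a) = f i" for f :: "'m \<Rightarrow> 'k"
    proof -
      have "(\<Sum>a\<in>UNIV. axis i 1 $ a * f a) = (\<Sum>a\<in>UNIV. if a = i then f a else 0)"
        by (intro sum.cong) (auto simp: axis_def)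
      then show ?thesis by simp
    qed
    have Kax: "(K *v axis i 1) $ a = K $ a $ i" for a
      using ax[of "\<lambda>l. K $ a $ l"] by (simp add: matrix_vector_mult_def mult.commute)
    have "(transpose F ** G) $ j $ k = (\<Sum>l\<in>UNIV. \<Sum>a\<in>UNIV. K $ a $ i * (DJ D a ** K) $ l $ j * G $ l $ k)"
      by (simp add: matrix_matrix_mult_def[of _ G] transpose_def F_def sum_distrib_right)
    also have "\<dots> = (\<Sum>a\<in>UNIV. K $ a $ i * (transpose (DJ D a ** K) ** G) $ j $ k)"
      by (subst sum.swap) (simp add: matrix_matrix_mult_def[of _ G] transpose_def sum_distrib_left mult.assoc)
    also have "\<dots> = (\<Sum>a\<in>UNIV. (K *v axis i 1) $ a * bil (T a) (K *v axis j 1) (axis k 1))"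
      by (simp add: bil_mult_left bil_axis T_def matrix_transpose_mul matrix_mul_assoc Kax)
    also have "\<dots> = - t (axis i 1) (axis j 1) (axis k 1)"
      using t[of "axis i 1" "axis j 1" "axis k 1"] by (simp add: t_def)
    also have "\<dots> = (- T i) $ j $ k"
      by (simp add: t_def ax bil_axis)
    finally show ?thesis .
  qed
  then have "transpose F ** G = - T i" by (intro matrix_eqI)
  then have "transpose F ** (G ** matrix_inv G) = - transpose (DJ D i) ** (G ** matrix_inv G)"
    by (simp add: T_def matrix_mul_assoc matrix_minus_left)
  then have "transpose F = transpose (- DJ D i)"
    by (simp add: matrix_inv_right[OF g_inv[OF p_mem]] transpose_minus)
  then have "F $ l $ j = - DJ D i $ l $ j" by (simp only: transpose_iff) simp
  moreover have "F $ l $ j = (\<Sum>a\<in>UNIV. \<Sum>b\<in>UNIV. K $ a $ i * K $ b $ j * DJ D a $ l $ b)"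
    by (simp add: F_def matrix_matrix_mult_def sum_distrib_left mult_ac)
  ultimately show ?thesis by simp
qed

end

section \<open>A holomorphic map at one point\<close>

lemma axis_vector_matrix_mult: "(axis c 1 v* (M :: 'a::comm_semiring_1 ^ 'm ^ 'n)) $ i = M $ c $ i"
proof -
  have "(\<Sum>d\<in>UNIV. M $ d $ i * axis c 1 $ d) = (\<Sum>d\<in>UNIV. if d = c then M $ d $ i else 0)"
    by (intro sum.cong) (auto simp: axis_def)
  then show ?thesis by (simp add: vector_matrix_mult_def mult.commute)
qed

text \<open>The trace condition on the source is an assumption here, since both parts of the theorem
  use it. On the target only a Weyl connection is fixed, as the two parts treat its D J
  differently.\<close>

locale hermitian_chart_map =
  M: hermitian_chart cat A cM JM U g C p + N: hermitian_chart cat B cN JN V h C' "\<phi> p"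
  for cat :: regularity
    and A :: "('a::{t2_space,second_countable_topology}, 'k::scalar, 'm::finite) chart set"
    and cM :: "('a, 'k, 'm) cstruct" and JM :: "('a, 'k, 'm) field2"
    and U :: "'a set" and g :: "('a, 'k, 'm) field2" and C :: "('a, 'k, 'm) chart" and p :: 'a
    and B :: "('b::{t2_space,second_countable_topology}, 'k, 'n::finite) chart set"
    and cN :: "('b, 'k, 'n) cstruct" and JN :: "('b, 'k, 'n) field2"
    and V :: "'b set" and h :: "('b, 'k, 'n) field2" and C' :: "('b, 'k, 'n) chart"
    and \<phi> :: "'a \<Rightarrow> 'b" +
  fixes DM :: "('a, 'k, 'm) field3" and DN :: "('b, 'k, 'n) field3"
  assumes holo: "holomorphic_map cat A JM B JN \<phi>"
    and weyl_M: "weyl_connection cat A cM DM" and weyl_N: "weyl_connection cat B cN DN"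
    and trace_M: "\<And>k. mtrace (g C p) (\<lambda>i j. M.DJ DM i $ k $ j) = 0"
begin

lemma regular: "regular_map cat A B \<phi>"
  using holo by (simp add: holomorphic_map_def)

abbreviation "P \<equiv> dmap C C' \<phi> p"
abbreviation "H \<equiv> matrix_inv M.G"
abbreviation "\<tau> a \<equiv> mtrace M.G (second_fundamental DM DN C C' \<phi> p a)"

definition dP :: "'m \<Rightarrow> 'k ^ 'm ^ 'n" where
  "dP i = (\<chi> a j. cd C i (\<lambda>q. dmap C C' \<phi> q $ a $ j) p)"
definition b :: "'m \<Rightarrow> 'k ^ 'm ^ 'n" where
  "b i = (\<chi> a j. second_fundamental DM DN C C' \<phi> p a i j)"
text \<open>This and the next two matrices are pullbacks to the bundle \<phi>^* TN: the direction
  index of the object on the target is contracted with d\<phi>(\<partial>_i), which is column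
  \<open>i\<close> of \<open>P\<close>.\<close>

definition pb_chr :: "'m \<Rightarrow> 'k ^ 'n ^ 'n" where
  "pb_chr i = (\<chi> a c. \<Sum>d\<in>UNIV. N.chr DN d $ a $ c * P $ d $ i)"
definition pb_dJ :: "'m \<Rightarrow> 'k ^ 'n ^ 'n" where
  "pb_dJ i = (\<chi> a c. \<Sum>d\<in>UNIV. N.dJ d $ a $ c * P $ d $ i)"
definition pb_DJ :: "'m \<Rightarrow> 'k ^ 'n ^ 'n" where
  "pb_DJ i = (\<chi> a c. \<Sum>d\<in>UNIV. N.DJ DN d $ a $ c * P $ d $ i)"
text \<open>The inverse metric of the source pushed forward by d\<phi>. Tracing a bilinear form
  pulled back from the target amounts to contracting it with \<open>Q\<close>, see
  \<open>Q_sum\<close>.\<close>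

definition Q :: "'k ^ 'n ^ 'n" where
  "Q = P ** H ** transpose P"

lemma smooth_\<phi>: "smooth_at C p (\<lambda>q. crd C' (\<phi> q) $ a)"
  by (rule regular_map_smooth_at[OF M.man N.man regular M.C N.C M.pC N.pC])

lemma has_cd_P: "has_cd C i (\<lambda>q. dmap C C' \<phi> q $ a $ j) (dP i $ a $ j) p"
proof -
  have "smooth_at C p (cd C j (\<lambda>q. crd C' (\<phi> q) $ a))"
    by (rule smooth_at_cd[OF M.man M.C M.pC smooth_\<phi>])
  from smooth_at_has_cd[OF this] show ?thesis
    by (simp add: dP_def dmap_def)
qed

lemma dP_sym: "dP i $ a $ j = dP j $ a $ i"
  using cd_commute[OF M.man M.C M.pC smooth_\<phi>] by (simp add: dP_def dmap_def)

lemma second_fundamental_eq: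
  "second_fundamental DM DN C C' \<phi> p a i j = dP i $ a $ j -
     (\<Sum>k\<in>UNIV. DM C p $ k $ i $ j * P $ a $ k) +
     (\<Sum>d\<in>UNIV. \<Sum>c\<in>UNIV. DN C' (\<phi> p) $ a $ d $ c * P $ d $ i * P $ c $ j)"
  by (simp add: second_fundamental_def dP_def) (simp add: dmap_def)

lemma b_eq: "b i = dP i - P ** M.chr DM i + pb_chr i ** P"
proof (rule matrix_eqI)
  fix a j
  have "(\<Sum>d\<in>UNIV. \<Sum>c\<in>UNIV. DN C' (\<phi> p) $ a $ d $ c * P $ d $ i * P $ c $ j) = (pb_chr i ** P) $ a $ j"
    by (subst sum.swap) (simp add: matrix_matrix_mult_def pb_chr_def N.chr_def sum_distrib_right)
  moreover have "(\<Sum>k\<in>UNIV. DM C p $ k $ i $ j * P $ a $ k) = (P ** M.chr DM i) $ a $ j"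
    by (simp add: matrix_matrix_mult_def M.chr_def mult.commute)
  ultimately show "b i $ a $ j = (dP i - P ** M.chr DM i + pb_chr i ** P) $ a $ j"
    by (simp add: b_def second_fundamental_eq)
qed

text \<open>Second coordinate derivatives commute and both connections are torsion free.\<close>

lemma b_sym: "b i $ a $ j = b j $ a $ i"
proof -
  have tf: "torsion_free A DM" "torsion_free B DN"
    using weyl_M weyl_N by (simp_all add: weyl_connection_def)
  have M: "DM C p $ k $ i $ j = DM C p $ k $ j $ i" for k
    using tf(1) M.C M.pC unfolding torsion_free_def by blast
  have N: "DN C' (\<phi> p) $ a $ d $ c = DN C' (\<phi> p) $ a $ c $ d" for d c
    using tf(2) N.C N.pC unfolding torsion_free_def by blast
  have "(\<Sum>d\<in>UNIV. \<Sum>c\<in>UNIV. DN C' (\<phi> p) $ a $ d $ c * P $ d $ i * P $ c $ j) =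
      (\<Sum>c\<in>UNIV. \<Sum>d\<in>UNIV. DN C' (\<phi> p) $ a $ d $ c * P $ d $ i * P $ c $ j)"
    by (rule sum.swap)
  also have "\<dots> = (\<Sum>d\<in>UNIV. \<Sum>c\<in>UNIV. DN C' (\<phi> p) $ a $ d $ c * P $ d $ j * P $ c $ i)"
    by (intro sum.cong refl) (subst N, simp add: mult_ac)
  finally show ?thesis
    by (simp add: b_def second_fundamental_eq M dP_sym[of i])
qed

lemma pb_DJ_eq: "pb_DJ i = pb_dJ i + pb_chr i ** N.K - N.K ** pb_chr i"
proof (rule matrix_eqI)
  fix a c
  have "(\<Sum>d\<in>UNIV. (N.chr DN d ** N.K) $ a $ c * P $ d $ i) = (pb_chr i ** N.K) $ a $ c"
    by (simp add: matrix_matrix_mult_def pb_chr_def sum_distrib_right, subst sum.swap) (simp add: mult_ac)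
  moreover have "(\<Sum>d\<in>UNIV. (N.K ** N.chr DN d) $ a $ c * P $ d $ i) = (N.K ** pb_chr i) $ a $ c"
    by (simp add: matrix_matrix_mult_def pb_chr_def sum_distrib_right sum_distrib_left, subst sum.swap)
       (simp add: mult_ac)
  ultimately show "pb_DJ i $ a $ c = (pb_dJ i + pb_chr i ** N.K - N.K ** pb_chr i) $ a $ c"
    by (simp add: pb_DJ_def N.DJ_eq pb_dJ_def algebra_simps sum.distrib sum_subtractf)
qed

text \<open>The product rule for d\<phi> J = J d\<phi>. The J of the target is evaluated along
  \<phi>, so the chain rule produces its derivative in the direction d\<phi>(\<partial>_i).\<close>

lemma holomorphic_differentiated: "dP i ** M.K + P ** M.dJ i = pb_dJ i ** P + N.K ** dP i"
proof (rule matrix_eqI)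
  fix a j
  have "has_cd C i (\<lambda>q. JN C' (\<phi> q) $ a $ c) (pb_dJ i $ a $ c) p" for a c
    using has_cd_compose[OF M.man N.man regular M.C N.C M.pC N.pC N.smooth_J, of i a c]
    by (simp add: pb_dJ_def N.dJ_def)
  then have 1: "has_cd C i (\<lambda>q. (JN C' (\<phi> q) ** dmap C C' \<phi> q) $ a $ j) ((pb_dJ i ** P + N.K ** dP i) $ a $ j) p"
    by (intro has_cd_matrix_mult[OF M.man M.C M.pC] has_cd_P)
  have "has_cd C i (\<lambda>q. (dmap C C' \<phi> q ** JM C q) $ a $ j) ((dP i ** M.K + P ** M.dJ i) $ a $ j) p"
    by (intro has_cd_matrix_mult[OF M.man M.C M.pC] has_cd_P M.has_cd_J)
  then have 2: "has_cd C i (\<lambda>q. (JN C' (\<phi> q) ** dmap C C' \<phi> q) $ a $ j) ((dP i ** M.K + P ** M.dJ i) $ a $ j) p"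
  proof (subst has_cd_cong[OF M.man M.C])
    show "open {q\<in>dom C. \<phi> q \<in> dom C'}"
      by (rule open_chart_preimage[OF M.man regular M.C manifold_open_dom[OF N.man N.C]])
    show "p \<in> {q\<in>dom C. \<phi> q \<in> dom C'} \<inter> dom C" using M.pC N.pC by simp
    show "(JN C' (\<phi> q) ** dmap C C' \<phi> q) $ a $ j = (dmap C C' \<phi> q ** JM C q) $ a $ j"
      if "q \<in> {q\<in>dom C. \<phi> q \<in> dom C'} \<inter> dom C" for q
      using holo that M.C N.C by (simp add: holomorphic_map_def)
  qed
  show "(dP i ** M.K + P ** M.dJ i) $ a $ j = (pb_dJ i ** P + N.K ** dP i) $ a $ j"
    by (rule trans[OF cd_eqI[OF 2, symmetric] cd_eqI[OF 1]])
qed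

lemma holomorphic_P: "P ** M.K = N.K ** P"
  using holo M.C N.C M.pC N.pC by (simp add: holomorphic_map_def)

text \<open>Using \<open>holomorphic_P\<close>, the connection terms on the two sides cancel, and
  \<open>holomorphic_differentiated\<close> remains.\<close>

lemma b_J: "b i ** M.K + P ** M.DJ DM i = pb_DJ i ** P + N.K ** b i"
proof -
  have "b i ** M.K + P ** M.DJ DM i =
      (dP i ** M.K + P ** M.dJ i) - (P ** M.K) ** M.chr DM i + pb_chr i ** (P ** M.K)"
    unfolding b_eq M.DJ_eq by (simp add: matrix_ring_simps algebra_simps)
  also have "\<dots> = pb_DJ i ** P + N.K ** b i"
    unfolding holomorphic_differentiated holomorphic_P b_eq pb_DJ_eq
    by (simp add: matrix_ring_simps algebra_simps)
  finally show ?thesis .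
qed

lemma H_J: "M.K ** H ** transpose M.K = H"
  by (rule matrix_inv_transform[OF M.g_inv[OF M.p_mem] M.g_J[OF M.p_mem] M.J_square[OF M.pC]])

lemma H_sym: "transpose H = H"
  by (rule matrix_inv_symmetric[OF M.g_inv[OF M.p_mem] M.g_sym[OF M.p_mem]])

lemma Q_eq: "Q $ c $ d = (\<Sum>i\<in>UNIV. \<Sum>j\<in>UNIV. H $ i $ j * (P $ c $ i * P $ d $ j))"
  by (subst sum.swap) (simp add: Q_def matrix_matrix_mult_def transpose_def sum_distrib_right sum_distrib_left mult_ac)

lemma Q_J: "N.K ** Q ** transpose N.K = Q"
proof -
  have "N.K ** Q ** transpose N.K = (N.K ** P) ** H ** transpose (N.K ** P)"
    by (simp add: Q_def matrix_transpose_mul matrix_mul_assoc)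
  also have "\<dots> = P ** (M.K ** H ** transpose M.K) ** transpose P"
    by (simp add: holomorphic_P[symmetric] matrix_transpose_mul matrix_mul_assoc)
  finally show ?thesis by (simp add: H_J Q_def)
qed

lemma Q_sum:
  "(\<Sum>i\<in>UNIV. \<Sum>j\<in>UNIV. H $ i $ j * (\<Sum>c\<in>UNIV. \<Sum>d\<in>UNIV. f c d * (P $ c $ i * P $ d $ j))) =
   (\<Sum>c\<in>UNIV. \<Sum>d\<in>UNIV. Q $ c $ d * f c d)"
proof -
  have "(\<Sum>i\<in>UNIV. \<Sum>j\<in>UNIV. H $ i $ j * (\<Sum>c\<in>UNIV. \<Sum>d\<in>UNIV. f c d * (P $ c $ i * P $ d $ j))) =
      (\<Sum>i\<in>UNIV. \<Sum>j\<in>UNIV. \<Sum>c\<in>UNIV. \<Sum>d\<in>UNIV. H $ i $ j * (P $ c $ i * P $ d $ j) * f c d)"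
    by (simp add: sum_distrib_left mult_ac)
  also have "\<dots> = (\<Sum>c\<in>UNIV. \<Sum>d\<in>UNIV. \<Sum>i\<in>UNIV. \<Sum>j\<in>UNIV. H $ i $ j * (P $ c $ i * P $ d $ j) * f c d)"
    by (rule sum_swap4)
  also have "\<dots> = (\<Sum>c\<in>UNIV. \<Sum>d\<in>UNIV. Q $ c $ d * f c d)"
    by (simp add: Q_eq sum_distrib_right)
  finally show ?thesis .
qed

lemma trace_identity:
  "(\<Sum>c\<in>UNIV. N.K $ a $ c * \<tau> c) = - (\<Sum>c\<in>UNIV. \<Sum>d\<in>UNIV. Q $ c $ d * N.DJ DN c $ a $ d)"
proof -
  \<comment> \<open>Contracting \<open>b\<close> composed with J against the inverse metric is
    contracting \<open>b\<close> against \<open>H ** transpose M.K\<close>. This matrix is skew,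
    since \<open>H\<close> is symmetric and J-invariant, while \<open>b\<close> is
    symmetric.\<close>
  have "transpose M.K ** transpose M.K = - mat 1"
    using arg_cong[OF M.J_square[OF M.pC], of transpose] by (simp add: matrix_transpose_mul transpose_minus)
  then have "M.K ** H ** (transpose M.K ** transpose M.K) = - (M.K ** H)"
    by (simp add: matrix_minus_right)
  then have "H ** transpose M.K = - (M.K ** H)"
    by (simp add: matrix_mul_assoc H_J)
  moreover have "transpose (H ** transpose M.K) = M.K ** H"
    by (simp add: matrix_transpose_mul H_sym)
  ultimately have "transpose (H ** transpose M.K) = - (H ** transpose M.K)"
    by simp
  from trace_skew_zero[OF b_sym this]
  have "(\<Sum>i\<in>UNIV. \<Sum>l\<in>UNIV. (H ** transpose M.K) $ i $ l * b i $ a $ l) = 0" .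
  moreover have "(\<Sum>l\<in>UNIV. (H ** transpose M.K) $ i $ l * b i $ a $ l) =
      (\<Sum>j\<in>UNIV. H $ i $ j * (b i ** M.K) $ a $ j)" for i
  proof -
    have "(\<Sum>l\<in>UNIV. (H ** transpose M.K) $ i $ l * b i $ a $ l) =
        (\<Sum>l\<in>UNIV. \<Sum>j\<in>UNIV. H $ i $ j * (b i $ a $ l * M.K $ l $ j))"
      by (simp add: matrix_matrix_mult_def transpose_def sum_distrib_right sum_distrib_left mult_ac)
    also have "\<dots> = (\<Sum>j\<in>UNIV. \<Sum>l\<in>UNIV. H $ i $ j * (b i $ a $ l * M.K $ l $ j))"
      by (rule sum.swap)
    also have "\<dots> = (\<Sum>j\<in>UNIV. H $ i $ j * (b i ** M.K) $ a $ j)"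
      by (simp add: matrix_matrix_mult_def sum_distrib_left)
    finally show ?thesis .
  qed
  ultimately have 1: "mtrace M.G (\<lambda>i j. (b i ** M.K) $ a $ j) = 0"
    by (simp add: mtrace_def)
  have "mtrace M.G (\<lambda>i j. (P ** M.DJ DM i) $ a $ j) = (\<Sum>k\<in>UNIV. P $ a $ k * mtrace M.G (\<lambda>i j. M.DJ DM i $ k $ j))"
  proof -
    have "mtrace M.G (\<lambda>i j. (P ** M.DJ DM i) $ a $ j) =
        (\<Sum>i\<in>UNIV. \<Sum>j\<in>UNIV. \<Sum>k\<in>UNIV. P $ a $ k * (H $ i $ j * M.DJ DM i $ k $ j))"
      by (simp add: mtrace_def matrix_matrix_mult_def sum_distrib_left mult_ac)
    also have "\<dots> = (\<Sum>k\<in>UNIV. \<Sum>i\<in>UNIV. \<Sum>j\<in>UNIV. P $ a $ k * (H $ i $ j * M.DJ DM i $ k $ j))"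
      by (rule sum_swap3[symmetric])
    finally show ?thesis by (simp add: mtrace_def sum_distrib_left)
  qed
  then have 2: "mtrace M.G (\<lambda>i j. (P ** M.DJ DM i) $ a $ j) = 0"
    by (simp add: trace_M)
  have "mtrace M.G (\<lambda>i j. (pb_DJ i ** P) $ a $ j) =
      (\<Sum>i\<in>UNIV. \<Sum>j\<in>UNIV. H $ i $ j * (\<Sum>c\<in>UNIV. \<Sum>d\<in>UNIV. N.DJ DN c $ a $ d * (P $ c $ i * P $ d $ j)))"
    unfolding mtrace_def
  proof (intro sum.cong refl arg_cong2[where f = "(*)"])
    fix i j
    show "(pb_DJ i ** P) $ a $ j = (\<Sum>c\<in>UNIV. \<Sum>d\<in>UNIV. N.DJ DN c $ a $ d * (P $ c $ i * P $ d $ j))"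
      by (subst sum.swap) (simp add: matrix_matrix_mult_def pb_DJ_def sum_distrib_right mult.assoc)
  qed
  then have 3: "mtrace M.G (\<lambda>i j. (pb_DJ i ** P) $ a $ j) = (\<Sum>c\<in>UNIV. \<Sum>d\<in>UNIV. Q $ c $ d * N.DJ DN c $ a $ d)"
    by (simp only: Q_sum)
  have 4: "mtrace M.G (\<lambda>i j. (N.K ** b i) $ a $ j) = (\<Sum>c\<in>UNIV. N.K $ a $ c * \<tau> c)"
  proof -
    have "mtrace M.G (\<lambda>i j. (N.K ** b i) $ a $ j) =
        (\<Sum>i\<in>UNIV. \<Sum>j\<in>UNIV. \<Sum>c\<in>UNIV. N.K $ a $ c * (H $ i $ j * b i $ c $ j))"
      by (simp add: mtrace_def matrix_matrix_mult_def sum_distrib_left mult_ac)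
    also have "\<dots> = (\<Sum>c\<in>UNIV. \<Sum>i\<in>UNIV. \<Sum>j\<in>UNIV. N.K $ a $ c * (H $ i $ j * b i $ c $ j))"
      by (rule sum_swap3[symmetric])
    finally show ?thesis by (simp add: mtrace_def sum_distrib_left b_def)
  qed
  have add: "mtrace M.G (\<lambda>i j. f i j + f' i j) = mtrace M.G f + mtrace M.G f'" for f f'
    by (simp add: mtrace_def distrib_left sum.distrib)
  have "mtrace M.G (\<lambda>i j. (b i ** M.K + P ** M.DJ DM i) $ a $ j) = 0"
    by (simp add: add 1 2)
  then have "mtrace M.G (\<lambda>i j. (pb_DJ i ** P + N.K ** b i) $ a $ j) = 0"
    unfolding b_J .
  then have "(\<Sum>c\<in>UNIV. \<Sum>d\<in>UNIV. Q $ c $ d * N.DJ DN c $ a $ d) + (\<Sum>c\<in>UNIV. N.K $ a $ c * \<tau> c) = 0"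
    by (simp add: add 3 4)
  then show ?thesis by (simp add: eq_neg_iff_add_eq_0 add.commute)
qed

text \<open>The hypothesis annihilates the right side of \<open>trace_identity\<close>, and J is
  injective because its square is \<open>- mat 1\<close>.\<close>

lemma tension_zero:
  assumes "\<And>a. (\<Sum>c\<in>UNIV. \<Sum>d\<in>UNIV. Q $ c $ d * N.DJ DN c $ a $ d) = 0"
  shows "\<tau> a = 0"
proof -
  define v where "v = (\<chi> c. \<tau> c)"
  have "N.K *v v = 0"
    using trace_identity assms by (simp add: vec_eq_iff matrix_vector_mult_def v_def)
  then have "(N.K ** N.K) *v v = 0" by (simp flip: matrix_vector_mul_assoc)
  then have "v = 0" by (simp add: N.J_square[OF N.pC] matrix_vector_mult_minus)
  then have "v $ a = 0" by simp
  then show ?thesis by (simp add: v_def)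
qed

lemma tension_zero_mixed:
  assumes "dD_omega_mixed_zero cat B cN JN DN"
  shows "\<tau> a = 0"
proof (rule tension_zero)
  obtain \<alpha> where \<alpha>: "weyl_form cat B DN V h \<alpha>"
    using weyl_N N.Ug unfolding weyl_connection_def by blast
  have tf: "torsion_free B DN" using weyl_N by (simp add: weyl_connection_def)
  show "(\<Sum>c\<in>UNIV. \<Sum>d\<in>UNIV. Q $ c $ d * N.DJ DN c $ a $ d) = 0" for a
    by (rule trace_quasi_kaehler_zero[OF N.quasi_kaehler[OF \<alpha> tf assms] Q_J])
qed

text \<open>Horizontal weak conformality on coordinate covectors says that \<open>Q\<close> is
  \<Lambda> times the inverse metric of the target. One factor \<open>l\<close> serves all forms, so
  the lemma covers both D J and the Hessian of a function.\<close>

lemma Q_conformal: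
  assumes "horizontally_weakly_conformal A cM B cN \<phi>"
  shows "\<exists>l. \<forall>f. (\<Sum>c\<in>UNIV. \<Sum>d\<in>UNIV. Q $ c $ d * f c d) = l * mtrace N.G f"
proof -
  obtain \<Lambda> where \<Lambda>: "\<forall>C\<in>A. \<forall>C'\<in>B. \<forall>p\<in>U \<inter> dom C. \<phi> p \<in> V \<inter> dom C' \<longrightarrow>
      (\<forall>\<alpha> \<beta>. bil (matrix_inv (g C p)) (\<alpha> v* dmap C C' \<phi> p) (\<beta> v* dmap C C' \<phi> p) =
        \<Lambda> p * bil (matrix_inv (h C' (\<phi> p))) \<alpha> \<beta>)"
    using assms M.Ug N.Ug unfolding horizontally_weakly_conformal_def by blast
  have "Q $ c $ d = \<Lambda> p * matrix_inv N.G $ c $ d" for c d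
  proof -
    have "Q $ c $ d = bil H (axis c 1 v* P) (axis d 1 v* P)"
      by (simp add: bil_def Q_eq axis_vector_matrix_mult mult.assoc)
    also have "\<dots> = \<Lambda> p * bil (matrix_inv N.G) (axis c 1) (axis d 1)"
      using \<Lambda> M.C N.C M.p_mem N.p_mem by blast
    finally show ?thesis by (simp add: bil_axis)
  qed
  then have "(\<Sum>c\<in>UNIV. \<Sum>d\<in>UNIV. Q $ c $ d * f c d) = \<Lambda> p * mtrace N.G f" for f
    by (simp add: mtrace_def sum_distrib_left mult.assoc)
  then show ?thesis by blast
qed

lemma tension_zero_conformal:
  assumes "horizontally_weakly_conformal A cM B cN \<phi>"
    and trace_N: "\<And>k. mtrace N.G (\<lambda>i j. N.DJ DN i $ k $ j) = 0"
  shows "\<tau> a = 0"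
proof (rule tension_zero)
  obtain l where "\<forall>f. (\<Sum>c\<in>UNIV. \<Sum>d\<in>UNIV. Q $ c $ d * f c d) = l * mtrace N.G f"
    using Q_conformal[OF assms(1)] by blast
  then show "(\<Sum>c\<in>UNIV. \<Sum>d\<in>UNIV. Q $ c $ d * N.DJ DN c $ a $ d) = 0" for a
    by (simp add: trace_N)
qed

text \<open>The composition law \<open>\<nabla>d(f \<circ> \<phi>) = df(\<nabla>d\<phi>) + \<phi>\<^sup>*(\<nabla>df)\<close>, traced.\<close>

lemma composite_trace:
  assumes f: "\<And>q. q \<in> S \<inter> dom C' \<Longrightarrow> smooth_at C' q f" and S: "open S" "\<phi> p \<in> S"
  shows "mtrace M.G (\<lambda>i j. cd C i (\<lambda>q. cd C j (\<lambda>r. f (\<phi> r)) q) p -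
      (\<Sum>k\<in>UNIV. DM C p $ k $ i $ j * cd C k (\<lambda>r. f (\<phi> r)) p)) =
    (\<Sum>a\<in>UNIV. cd C' a f (\<phi> p) * \<tau> a) +
    (\<Sum>c\<in>UNIV. \<Sum>d\<in>UNIV. Q $ c $ d * (cd C' c (\<lambda>q. cd C' d f q) (\<phi> p) -
      (\<Sum>k\<in>UNIV. DN C' (\<phi> p) $ k $ c $ d * cd C' k f (\<phi> p))))"
proof -
  define hess where "hess c d = cd C' c (\<lambda>q. cd C' d f q) (\<phi> p) -
      (\<Sum>k\<in>UNIV. DN C' (\<phi> p) $ k $ c $ d * cd C' k f (\<phi> p))" for c d
  define df where "df a = cd C' a f (\<phi> p)" for a
  define X where "X = {q\<in>dom C. \<phi> q \<in> S \<inter> dom C'}"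
  have X: "open X" "p \<in> X \<inter> dom C"
    unfolding X_def
    by (intro open_chart_preimage[OF M.man regular M.C] open_Int S manifold_open_dom[OF N.man N.C])
       (use S M.pC N.pC in simp)
  have d1: "cd C j (\<lambda>r. f (\<phi> r)) q = (\<Sum>a\<in>UNIV. cd C' a f (\<phi> q) * dmap C C' \<phi> q $ a $ j)"
    if "q \<in> X \<inter> dom C" for q j
    using that by (intro cd_eqI has_cd_compose[OF M.man N.man regular M.C N.C] f) (auto simp: X_def)
  have d2: "cd C i (\<lambda>q. cd C j (\<lambda>r. f (\<phi> r)) q) p = (\<Sum>a\<in>UNIV.
      (\<Sum>c\<in>UNIV. cd C' c (cd C' a f) (\<phi> p) * P $ c $ i) * P $ a $ j + df a * dP i $ a $ j)" for i j
  proof -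
    have "smooth_at C' (\<phi> p) (cd C' a f)" for a
      using S N.pC by (intro smooth_at_cd[OF N.man N.C] f) auto
    then have "has_cd C i (\<lambda>q. \<Sum>a\<in>UNIV. cd C' a f (\<phi> q) * dmap C C' \<phi> q $ a $ j)
      (\<Sum>a\<in>UNIV. (\<Sum>c\<in>UNIV. cd C' c (cd C' a f) (\<phi> p) * P $ c $ i) * P $ a $ j + df a * dP i $ a $ j) p"
      unfolding df_def
      by (intro has_cd_sum has_cd_mult[OF M.man M.C M.pC] has_cd_P
          has_cd_compose[OF M.man N.man regular M.C N.C M.pC N.pC])
    then show ?thesis
      by (intro cd_eqI) (subst has_cd_cong[OF M.man M.C X d1])
  qed
  have "cd C i (\<lambda>q. cd C j (\<lambda>r. f (\<phi> r)) q) p - (\<Sum>k\<in>UNIV. DM C p $ k $ i $ j * cd C k (\<lambda>r. f (\<phi> r)) p) =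
      (\<Sum>a\<in>UNIV. df a * second_fundamental DM DN C C' \<phi> p a i j) +
      (\<Sum>c\<in>UNIV. \<Sum>d\<in>UNIV. hess c d * (P $ c $ i * P $ d $ j))" for i j
  proof -
    have e1: "cd C i (\<lambda>q. cd C j (\<lambda>r. f (\<phi> r)) q) p =
        (\<Sum>c\<in>UNIV. \<Sum>d\<in>UNIV. cd C' c (cd C' d f) (\<phi> p) * (P $ c $ i * P $ d $ j)) + (\<Sum>a\<in>UNIV. df a * dP i $ a $ j)"
      unfolding d2 sum.distrib sum_distrib_right
      by (subst sum.swap) (simp only: mult.assoc)
    have e2: "(\<Sum>k\<in>UNIV. DM C p $ k $ i $ j * cd C k (\<lambda>r. f (\<phi> r)) p) =
        (\<Sum>a\<in>UNIV. df a * (\<Sum>k\<in>UNIV. DM C p $ k $ i $ j * P $ a $ k))"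
      unfolding d1[OF X(2)] df_def sum_distrib_left
      by (subst sum.swap) (simp add: mult_ac)
    have e3: "(\<Sum>c\<in>UNIV. \<Sum>d\<in>UNIV. (\<Sum>k\<in>UNIV. DN C' (\<phi> p) $ k $ c $ d * cd C' k f (\<phi> p)) * (P $ c $ i * P $ d $ j)) =
        (\<Sum>a\<in>UNIV. df a * (\<Sum>c\<in>UNIV. \<Sum>d\<in>UNIV. DN C' (\<phi> p) $ a $ c $ d * P $ c $ i * P $ d $ j))"
      unfolding df_def sum_distrib_left sum_distrib_right
      by (subst sum_swap3[symmetric]) (simp add: mult_ac)
    have h1: "(\<Sum>c\<in>UNIV. \<Sum>d\<in>UNIV. hess c d * (P $ c $ i * P $ d $ j)) =
        (\<Sum>c\<in>UNIV. \<Sum>d\<in>UNIV. cd C' c (cd C' d f) (\<phi> p) * (P $ c $ i * P $ d $ j)) -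
        (\<Sum>c\<in>UNIV. \<Sum>d\<in>UNIV. (\<Sum>k\<in>UNIV. DN C' (\<phi> p) $ k $ c $ d * cd C' k f (\<phi> p)) * (P $ c $ i * P $ d $ j))"
      by (simp add: hess_def left_diff_distrib sum_subtractf)
    have h2: "(\<Sum>a\<in>UNIV. df a * second_fundamental DM DN C C' \<phi> p a i j) =
        (\<Sum>a\<in>UNIV. df a * dP i $ a $ j) - (\<Sum>a\<in>UNIV. df a * (\<Sum>k\<in>UNIV. DM C p $ k $ i $ j * P $ a $ k)) +
        (\<Sum>a\<in>UNIV. df a * (\<Sum>c\<in>UNIV. \<Sum>d\<in>UNIV. DN C' (\<phi> p) $ a $ c $ d * P $ c $ i * P $ d $ j))"
      by (simp only: second_fundamental_eq distrib_left right_diff_distrib sum.distrib sum_subtractf)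
    show ?thesis
      unfolding e1 e2 h1 h2 e3 by simp
  qed
  then have "mtrace M.G (\<lambda>i j. cd C i (\<lambda>q. cd C j (\<lambda>r. f (\<phi> r)) q) p -
      (\<Sum>k\<in>UNIV. DM C p $ k $ i $ j * cd C k (\<lambda>r. f (\<phi> r)) p)) =
      (\<Sum>i\<in>UNIV. \<Sum>j\<in>UNIV. H $ i $ j * (\<Sum>a\<in>UNIV. df a * second_fundamental DM DN C C' \<phi> p a i j)) +
      (\<Sum>i\<in>UNIV. \<Sum>j\<in>UNIV. H $ i $ j * (\<Sum>c\<in>UNIV. \<Sum>d\<in>UNIV. hess c d * (P $ c $ i * P $ d $ j)))"
    by (simp add: mtrace_def distrib_left sum.distrib)
  also have "(\<Sum>i\<in>UNIV. \<Sum>j\<in>UNIV. H $ i $ j * (\<Sum>a\<in>UNIV. df a * second_fundamental DM DN C C' \<phi> p a i j)) =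
      (\<Sum>a\<in>UNIV. df a * \<tau> a)"
  proof -
    have "(\<Sum>i\<in>UNIV. \<Sum>j\<in>UNIV. H $ i $ j * (\<Sum>a\<in>UNIV. df a * second_fundamental DM DN C C' \<phi> p a i j)) =
        (\<Sum>i\<in>UNIV. \<Sum>j\<in>UNIV. \<Sum>a\<in>UNIV. df a * (H $ i $ j * second_fundamental DM DN C C' \<phi> p a i j))"
      by (simp add: sum_distrib_left mult_ac)
    also have "\<dots> = (\<Sum>a\<in>UNIV. \<Sum>i\<in>UNIV. \<Sum>j\<in>UNIV. df a * (H $ i $ j * second_fundamental DM DN C C' \<phi> p a i j))"
      by (rule sum_swap3[symmetric])
    finally show ?thesis by (simp add: mtrace_def sum_distrib_left)
  qed
  finally show ?thesis
    unfolding Q_sum by (simp only: hess_def df_def)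
qed

text \<open>In \<open>composite_trace\<close> the first sum vanishes with the tension; the second
  is, by conformality, a multiple of the trace that vanishes for harmonic \<open>f\<close>.\<close>

lemma composite_harmonic:
  assumes conf: "horizontally_weakly_conformal A cM B cN \<phi>"
    and \<tau>: "\<And>a. \<tau> a = 0"
    and f: "harmonic_fun cat B cN DN S f" and S: "open S" "\<phi> p \<in> S"
  shows "mtrace M.G (\<lambda>i j. cd C i (\<lambda>q. cd C j (\<lambda>r. f (\<phi> r)) q) p -
      (\<Sum>k\<in>UNIV. DM C p $ k $ i $ j * cd C k (\<lambda>r. f (\<phi> r)) p)) = 0"
proof -
  have smooth: "smooth_at C' q f" if "q \<in> S \<inter> dom C'" for q
    using f S that by (intro regular_on_smooth_at[OF N.man N.C]) (auto simp: harmonic_fun_def)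
  have "mtrace N.G (\<lambda>c d. cd C' c (\<lambda>q. cd C' d f q) (\<phi> p) -
      (\<Sum>k\<in>UNIV. DN C' (\<phi> p) $ k $ c $ d * cd C' k f (\<phi> p))) = 0"
    using f S N.Ug N.C N.p_mem unfolding harmonic_fun_def by blast
  moreover obtain l where "\<forall>f. (\<Sum>c\<in>UNIV. \<Sum>d\<in>UNIV. Q $ c $ d * f c d) = l * mtrace N.G f"
    using Q_conformal[OF conf] by blast
  ultimately show ?thesis
    using composite_trace[OF smooth S] by (simp add: \<tau>)
qed

end

theorem proposition3p5:
  fixes cat :: regularity
    and A :: "('a::{t2_space,second_countable_topology}, 'k::scalar, 'm::finite) chart set"
    and cM :: "('a, 'k, 'm) cstruct"
    and JM :: "('a, 'k, 'm) field2"
    and DM :: "('a, 'k, 'm) field3"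
    and B :: "('b::{t2_space,second_countable_topology}, 'k, 'n::finite) chart set"
    and cN :: "('b, 'k, 'n) cstruct"
    and JN :: "('b, 'k, 'n) field2"
    and DN :: "('b, 'k, 'n) field3"
    and \<phi> :: "'a \<Rightarrow> 'b"
  assumes "almost_hermitian cat A cM JM"
    and "almost_hermitian cat B cN JN"
    and "CARD('m) \<ge> 4 \<Longrightarrow> hermitian_weyl_connection cat A cM JM DM"
    and "CARD('m) = 2 \<Longrightarrow> weyl_connection cat A cM DM"
    and "CARD('n) \<ge> 4 \<Longrightarrow> hermitian_weyl_connection cat B cN JN DN"
    and "CARD('n) = 2 \<Longrightarrow> weyl_connection cat B cN DN"
    and "holomorphic_map cat A JM B JN \<phi>"
  shows "(dD_omega_mixed_zero cat B cN JN DN \<longrightarrow> harmonic_map cat A cM DM B DN \<phi>) \<and>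
         (horizontally_weakly_conformal A cM B cN \<phi> \<and> nowhere_degenerate_fibres A cM B \<phi> \<longrightarrow>
            harmonic_map cat A cM DM B DN \<phi> \<and> harmonic_morphism cat A cM DM B cN DN \<phi>)"
proof -
  have AM: "almost_hermitian cat A cM JM" and BN: "almost_hermitian cat B cN JN"
    and holo: "holomorphic_map cat A JM B JN \<phi>"
    and map: "regular_map cat A B \<phi>"
    using assms(1,2,7) by (auto simp: holomorphic_map_def)
  have cover: "\<exists>V h. (V, h) \<in> cN \<and> q \<in> V" if "C' \<in> B" "q \<in> dom C'" for C' q
  proof -
    have "q \<in> carrier B" using that by (auto simp: carrier_def)
    also have "carrier B = (\<Union>(V, h)\<in>cN. V)"
      using BN by (simp add: almost_hermitian_def conformal_structure_def)
    finally show ?thesis by auto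
  qed
  \<comment> \<open>A local metric of the target around \<phi> p has to be chosen, because a
    harmonic map refers only to metrics of the source. The trace on the target is recorded
    separately for the conformal case.\<close>
  have chart: "\<exists>V h. hermitian_chart_map cat A cM JM U g C p B cN JN V h C' \<phi> DM DN \<and>
      (\<forall>k. mtrace (h C' (\<phi> p)) (\<lambda>i j. hermitian_chart.DJ JN C' (\<phi> p) DN i $ k $ j) = 0)"
    if "(U, g) \<in> cM" "C \<in> A" "C' \<in> B" "p \<in> U \<inter> dom C" "\<phi> p \<in> dom C'" for U g C C' p
  proof -
    from cover[OF that(3,5)] obtain V h where Vh: "(V, h) \<in> cN" "\<phi> p \<in> V" by blast
    interpret M: hermitian_chart cat A cM JM U g C p
      using that AM by unfold_locales auto
    interpret N: hermitian_chart cat B cN JN V h C' "\<phi> p"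
      using that Vh BN by unfold_locales auto
    have "hermitian_chart_map cat A cM JM U g C p B cN JN V h C' \<phi> DM DN"
      using M.trace_DJ_zero[OF assms(3,4)] N.trace_DJ_zero[OF assms(5,6)] holo by unfold_locales
    then show ?thesis using N.trace_DJ_zero(2)[OF assms(5,6)] by blast
  qed
  have harmonic_mixed: "harmonic_map cat A cM DM B DN \<phi>" if "dD_omega_mixed_zero cat B cN JN DN"
    unfolding harmonic_map_def
    using map chart hermitian_chart_map.tension_zero_mixed[OF _ that] by blast
  have tension: "mtrace (g C p) (second_fundamental DM DN C C' \<phi> p a) = 0"
    if "horizontally_weakly_conformal A cM B cN \<phi>"
      "(U, g) \<in> cM" "C \<in> A" "C' \<in> B" "p \<in> U \<inter> dom C" "\<phi> p \<in> dom C'" for U g C C' p a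
    using chart[OF that(2-6)] hermitian_chart_map.tension_zero_conformal[OF _ that(1)] by blast
  have harmonic: "harmonic_map cat A cM DM B DN \<phi>" if "horizontally_weakly_conformal A cM B cN \<phi>"
    unfolding harmonic_map_def using map tension[OF that] by blast
  have "harmonic_morphism cat A cM DM B cN DN \<phi>" if conf: "horizontally_weakly_conformal A cM B cN \<phi>"
    unfolding harmonic_morphism_def
  proof (intro conjI map allI impI, elim conjE)
    fix S f assume S: "open S" "S \<subseteq> carrier B" and f: "harmonic_fun cat B cN DN S f"
    have "regular_on cat A {p\<in>carrier A. \<phi> p \<in> S} (\<lambda>p. f (\<phi> p))"
      using AM BN map f S
      by (intro regular_on_compose[of cat A B]) (auto simp: almost_hermitian_def harmonic_fun_def)
    moreover have "mtrace (g C p) (\<lambda>i j. cd C i (\<lambda>q. cd C j (\<lambda>p. f (\<phi> p)) q) p -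
        (\<Sum>k\<in>UNIV. DM C p $ k $ i $ j * cd C k (\<lambda>p. f (\<phi> p)) p)) = 0"
      if Ug: "(U, g) \<in> cM" and C: "C \<in> A" and p: "p \<in> {p\<in>carrier A. \<phi> p \<in> S} \<inter> U \<inter> dom C" for U g C p
    proof -
      \<comment> \<open>Harmonicity of the pulled back function mentions no chart of the target, so
        any chart around \<phi> p will do.\<close>
      obtain C' where C': "C' \<in> B" "\<phi> p \<in> dom C'"
        using p S by (auto simp: carrier_def)
      have pU: "p \<in> U \<inter> dom C" and pS: "\<phi> p \<in> S" using p by auto
      obtain V h where "hermitian_chart_map cat A cM JM U g C p B cN JN V h C' \<phi> DM DN"
        using chart[OF Ug C C'(1) pU C'(2)] by blast
      from hermitian_chart_map.composite_harmonic[OF this conf tension[OF conf Ug C C'(1) pU C'(2)] f S(1) pS]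
      show ?thesis .
    qed
    ultimately show "harmonic_fun cat A cM DM {p\<in>carrier A. \<phi> p \<in> S} (\<lambda>p. f (\<phi> p))"
      unfolding harmonic_fun_def by blast
  qed
  with harmonic_mixed harmonic show ?thesis by blast
qed

end
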